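(* The operator $\mathcal{A}$ has compact resolvent.
   Context: Setting: $\Omega\subseteq\mathbb{R}^d$ is a bounded domain with Lipschitz boundary $\Gamma$; $\Omega$ carries Lebesgue measure and $\Gamma$ the surface measure $S$. Given are $\alpha\in L^\infty(\Omega;\mathbb{R})$ and $\beta,\gamma\in L^\infty(\Gamma;\mathbb{R})$ such that for some constant $\eta>0$ one has $\alpha\ge\eta$ a.e. on $\Omega$ and $\beta\ge\eta$ a.e. on $\Gamma$. All function spaces are complex valued unless indicated. Notation: $\langle f,g\rangle_\Omega=\int_\Omega f\overline{g}\,dx$, $\langle\nabla u,\nabla v\rangle_\Omega=\int_\Omega\sum_{j=1}^d\partial_ju\,\overline{\partial_jv}\,dx$, $\langle f,g\rangle_{\Gamma,\beta}=\int_\Gamma f\overline g\,\beta^{-1}dS$. $H^1_\Delta(\Omega)=\{u\in H^1(\Omega):\Delta u\in L^2(\Omega)\}$ with $\Delta$ the distributional Laplacian. $\mathrm{tr}$ is the usual trace operator on $H^1(\Omega)$. The Neumann Laplacian has domain $D(\Delta_N)=\{u\in H^1_\Delta(\Omega):\langle\nabla u,\nabla v\rangle_\Omega=-\langle\Delta u,v\rangle_\Omega\ \forall v\in H^1(\Omega)\}$. Hilbert space: $\mathcal{H}=L^2(\Omega)\times L^2(\Gamma,\beta^{-1}dS)$ with inner product $\langle(u_1,u_2),(v_1,v_2)\rangle_{\mathcal{H}}=\langle u_1,v_1\rangle_\Omega+\langle u_2,v_2\rangle_{\Gamma,\beta}$. Form: $D(\mathfrak{a})=\{(u_1,u_2)\in\mathcal{H}:u_1\in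 D(\Delta_N),\ u_2=\mathrm{tr}\,u_1\}$ and $\mathfrak{a}(u,v)=\langle\alpha\Delta u_1,\Delta v_1\rangle_\Omega+\langle\gamma u_2,v_2\rangle_{\Gamma,\beta}$. Associated operator: $u\in D(\mathcal{A})$ and $\mathcal{A}u=f$ if and only if $u\in D(\mathfrak{a})$, $f\in\mathcal{H}$ and $\mathfrak{a}(u,v)=\langle f,v\rangle_{\mathcal{H}}$ for all $v\in D(\mathfrak{a})$. The operator $\mathcal{A}$ is self-adjoint and bounded from below on $\mathcal{H}$. *)

theory Defs
  imports "HOL-Analysis.Analysis"
begin

section \<open>Lipschitz domains and surface measure\<close>

text \<open>
  \<Omega> is a bounded Lipschitz domain if it is a nonempty bounded connected open set which near every
  boundary point is, in suitable orthonormal coordinates with last axis \<nu>, the strict epigraph of a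
  Lipschitz function of the remaining coordinates. The orthogonal projection of \<open>x\<close> along \<nu> plays
  the role of these remaining coordinates, so no rotation has to be named. In dimension one the
  hyperplane is a point and \<Omega> is a bounded open interval.
\<close>

definition bounded_lipschitz_domain :: "'a::euclidean_space set \<Rightarrow> bool" where
  "bounded_lipschitz_domain \<Omega> \<longleftrightarrow>
     open \<Omega> \<and> connected \<Omega> \<and> \<Omega> \<noteq> {} \<and> bounded \<Omega> \<and>
     (\<forall>p \<in> frontier \<Omega>. \<exists>U \<nu> h L. open U \<and> p \<in> U \<and> norm \<nu> = 1 \<and>
        L-lipschitz_on {y. y \<bullet> \<nu> = 0} (h :: 'a \<Rightarrow> real) \<and>
        \<Omega> \<inter> U = {x \<in> U. x \<bullet> \<nu> > h (x - (x \<bullet> \<nu>) *\<^sub>R \<nu>)})"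

text \<open>
  Surface measure is the Hausdorff measure of codimension one, normalised by the volume of the unit
  ball so that it is Lebesgue measure on hyperplanes. Empty covering sets are given weight
  0 explicitly because \<open>0 ^ 0 = 1\<close>, so that for \<open>s = 0\<close> one obtains the counting measure.
\<close>

definition hausdorff_premeasure :: "nat \<Rightarrow> real \<Rightarrow> 'a::euclidean_space set \<Rightarrow> ennreal" where
  "hausdorff_premeasure s \<delta> A =
     (INF E \<in> {E :: nat \<Rightarrow> 'a set. A \<subseteq> (\<Union>i. E i) \<and> (\<forall>i. bounded (E i) \<and> diameter (E i) \<le> \<delta>)}.
        \<Sum>i. if E i = {} then 0
             else ennreal (unit_ball_vol (real s) * (diameter (E i) / 2) ^ s))"

definition hausdorff_outer :: "nat \<Rightarrow> 'a::euclidean_space set \<Rightarrow> ennreal" where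
  "hausdorff_outer s A = (SUP \<delta> \<in> {0<..}. hausdorff_premeasure s \<delta> A)"

definition hausdorff_measure :: "nat \<Rightarrow> 'a::euclidean_space measure" where
  "hausdorff_measure s = measure_of UNIV (sets borel) (hausdorff_outer s)"

definition surface_measure :: "'a::euclidean_space set \<Rightarrow> 'a measure" where
  "surface_measure \<Omega> = restrict_space (hausdorff_measure (DIM('a) - 1)) (frontier \<Omega>)"

section \<open>Lebesgue spaces\<close>

text \<open>
  Elements of Lebesgue spaces are represented by functions; everything below is invariant under
  changing them on null sets.
\<close>

definition Linfty :: "'a measure \<Rightarrow> ('a \<Rightarrow> real) set" where
  "Linfty M = {f \<in> borel_measurable M. \<exists>C. AE x in M. \<bar>f x\<bar> \<le> C}"

definition L2 :: "'a measure \<Rightarrow> ('a \<Rightarrow> complex) set" where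
  "L2 M = {f \<in> borel_measurable M. integrable M (\<lambda>x. (cmod (f x))\<^sup>2)}"

definition L2_inner :: "'a measure \<Rightarrow> ('a \<Rightarrow> complex) \<Rightarrow> ('a \<Rightarrow> complex) \<Rightarrow> complex" where
  "L2_inner M f g = (LINT x|M. f x * cnj (g x))"

definition L2_norm :: "'a measure \<Rightarrow> ('a \<Rightarrow> complex) \<Rightarrow> real" where
  "L2_norm M f = sqrt (LINT x|M. (cmod (f x))\<^sup>2)"

section \<open>Weak derivatives and Sobolev spaces\<close>

abbreviation partial :: "'a::euclidean_space \<Rightarrow> ('a \<Rightarrow> complex) \<Rightarrow> 'a \<Rightarrow> complex" where
  "partial j f \<equiv> (\<lambda>x. frechet_derivative f (at x) j)"

fun Ck :: "nat \<Rightarrow> ('a::euclidean_space \<Rightarrow> complex) \<Rightarrow> bool" where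
  "Ck 0 f \<longleftrightarrow> continuous_on UNIV f"
| "Ck (Suc k) f \<longleftrightarrow> (\<forall>x. f differentiable (at x)) \<and> (\<forall>j\<in>Basis. Ck k (partial j f))"

definition smooth :: "('a::euclidean_space \<Rightarrow> complex) \<Rightarrow> bool" where
  "smooth f \<longleftrightarrow> (\<forall>k. Ck k f)"

definition test_functions :: "'a::euclidean_space set \<Rightarrow> ('a \<Rightarrow> complex) set" where
  "test_functions \<Omega> = {\<phi>. smooth \<phi> \<and> compact (closure {x. \<phi> x \<noteq> 0}) \<and> closure {x. \<phi> x \<noteq> 0} \<subseteq> \<Omega>}"

definition has_weak_partial ::
  "'a::euclidean_space set \<Rightarrow> 'a \<Rightarrow> ('a \<Rightarrow> complex) \<Rightarrow> ('a \<Rightarrow> complex) \<Rightarrow> bool" where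
  "has_weak_partial \<Omega> j u g \<longleftrightarrow> g \<in> L2 (lebesgue_on \<Omega>) \<and>
     (\<forall>\<phi>\<in>test_functions \<Omega>.
        (LINT x|lebesgue_on \<Omega>. u x * partial j \<phi> x) = - (LINT x|lebesgue_on \<Omega>. g x * \<phi> x))"

definition weak_partial ::
  "'a::euclidean_space set \<Rightarrow> 'a \<Rightarrow> ('a \<Rightarrow> complex) \<Rightarrow> 'a \<Rightarrow> complex" where
  "weak_partial \<Omega> j u = (SOME g. has_weak_partial \<Omega> j u g)"

definition H1 :: "'a::euclidean_space set \<Rightarrow> ('a \<Rightarrow> complex) set" where
  "H1 \<Omega> = {u \<in> L2 (lebesgue_on \<Omega>). \<forall>j\<in>Basis. \<exists>g. has_weak_partial \<Omega> j u g}"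

definition grad_inner ::
  "'a::euclidean_space set \<Rightarrow> ('a \<Rightarrow> complex) \<Rightarrow> ('a \<Rightarrow> complex) \<Rightarrow> complex" where
  "grad_inner \<Omega> u v =
     (LINT x|lebesgue_on \<Omega>. (\<Sum>j\<in>Basis. weak_partial \<Omega> j u x * cnj (weak_partial \<Omega> j v x)))"

definition H1_norm :: "'a::euclidean_space set \<Rightarrow> ('a \<Rightarrow> complex) \<Rightarrow> real" where
  "H1_norm \<Omega> u = sqrt ((L2_norm (lebesgue_on \<Omega>) u)\<^sup>2 + Re (grad_inner \<Omega> u u))"

definition has_distr_laplacian ::
  "'a::euclidean_space set \<Rightarrow> ('a \<Rightarrow> complex) \<Rightarrow> ('a \<Rightarrow> complex) \<Rightarrow> bool" where
  "has_distr_laplacian \<Omega> u w \<longleftrightarrow> w \<in> L2 (lebesgue_on \<Omega>) \<and>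
     (\<forall>\<phi>\<in>test_functions \<Omega>.
        (LINT x|lebesgue_on \<Omega>. u x * (\<Sum>j\<in>Basis. partial j (partial j \<phi>) x))
          = (LINT x|lebesgue_on \<Omega>. w x * \<phi> x))"

definition laplacian :: "'a::euclidean_space set \<Rightarrow> ('a \<Rightarrow> complex) \<Rightarrow> 'a \<Rightarrow> complex" where
  "laplacian \<Omega> u = (SOME w. has_distr_laplacian \<Omega> u w)"

definition H1_Delta :: "'a::euclidean_space set \<Rightarrow> ('a \<Rightarrow> complex) set" where
  "H1_Delta \<Omega> = {u \<in> H1 \<Omega>. \<exists>w. has_distr_laplacian \<Omega> u w}"

definition dom_neumann_laplacian :: "'a::euclidean_space set \<Rightarrow> ('a \<Rightarrow> complex) set" where
  "dom_neumann_laplacian \<Omega> =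
     {u \<in> H1_Delta \<Omega>. \<forall>v\<in>H1 \<Omega>. grad_inner \<Omega> u v = - L2_inner (lebesgue_on \<Omega>) (laplacian \<Omega> u) v}"

text \<open>
  The trace operator is the continuous extension to \<open>H\<^sup>1\<close> of the restriction map
  \<open>\<phi> \<mapsto> \<phi>|\<Gamma>\<close> on functions smooth up to the boundary, i.e. the
  closure of the graph of that map; the relation holds for \<open>g\<close> iff \<open>g = tr u\<close> almost everywhere.
\<close>

definition has_trace :: "'a::euclidean_space set \<Rightarrow> ('a \<Rightarrow> complex) \<Rightarrow> ('a \<Rightarrow> complex) \<Rightarrow> bool" where
  "has_trace \<Omega> u g \<longleftrightarrow> u \<in> H1 \<Omega> \<and> g \<in> L2 (surface_measure \<Omega>) \<and>
     (\<exists>\<phi> :: nat \<Rightarrow> 'a \<Rightarrow> complex. (\<forall>n. smooth (\<phi> n)) \<and>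
        (\<lambda>n. H1_norm \<Omega> (\<lambda>x. \<phi> n x - u x)) \<longlonglongrightarrow> 0 \<and>
        (\<lambda>n. L2_norm (surface_measure \<Omega>) (\<lambda>x. \<phi> n x - g x)) \<longlonglongrightarrow> 0)"

section \<open>The Hilbert space, the form and the associated operator\<close>

type_synonym 'a state = "('a \<Rightarrow> complex) \<times> ('a \<Rightarrow> complex)"

definition weighted_surface :: "'a::euclidean_space set \<Rightarrow> ('a \<Rightarrow> real) \<Rightarrow> 'a measure" where
  "weighted_surface \<Omega> \<beta> = density (surface_measure \<Omega>) (\<lambda>x. ennreal (inverse (\<beta> x)))"

definition Hsp :: "'a::euclidean_space set \<Rightarrow> ('a \<Rightarrow> real) \<Rightarrow> 'a state set" where
  "Hsp \<Omega> \<beta> = L2 (lebesgue_on \<Omega>) \<times> L2 (weighted_surface \<Omega> \<beta>)"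

definition Hsp_inner ::
  "'a::euclidean_space set \<Rightarrow> ('a \<Rightarrow> real) \<Rightarrow> 'a state \<Rightarrow> 'a state \<Rightarrow> complex" where
  "Hsp_inner \<Omega> \<beta> u v =
     L2_inner (lebesgue_on \<Omega>) (fst u) (fst v) + L2_inner (weighted_surface \<Omega> \<beta>) (snd u) (snd v)"

definition Hsp_norm :: "'a::euclidean_space set \<Rightarrow> ('a \<Rightarrow> real) \<Rightarrow> 'a state \<Rightarrow> real" where
  "Hsp_norm \<Omega> \<beta> u = sqrt (Re (Hsp_inner \<Omega> \<beta> u u))"

definition form_dom :: "'a::euclidean_space set \<Rightarrow> ('a \<Rightarrow> real) \<Rightarrow> 'a state set" where
  "form_dom \<Omega> \<beta> = {(u1, u2) \<in> Hsp \<Omega> \<beta>. u1 \<in> dom_neumann_laplacian \<Omega> \<and> has_trace \<Omega> u1 u2}"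

definition form ::
  "'a::euclidean_space set \<Rightarrow> ('a \<Rightarrow> real) \<Rightarrow> ('a \<Rightarrow> real) \<Rightarrow> ('a \<Rightarrow> real) \<Rightarrow>
     'a state \<Rightarrow> 'a state \<Rightarrow> complex" where
  "form \<Omega> \<alpha> \<beta> \<gamma> u v =
     L2_inner (lebesgue_on \<Omega>)
       (\<lambda>x. of_real (\<alpha> x) * laplacian \<Omega> (fst u) x) (laplacian \<Omega> (fst v)) +
     L2_inner (weighted_surface \<Omega> \<beta>) (\<lambda>x. of_real (\<gamma> x) * snd u x) (snd v)"

text \<open>Operators are given by their graphs: \<open>(u, f)\<close> belongs to the graph iff \<open>u \<in> D(A)\<close> and
  \<open>A u = f\<close> (up to null sets).\<close>

definition op_A ::
  "'a::euclidean_space set \<Rightarrow> ('a \<Rightarrow> real) \<Rightarrow> ('a \<Rightarrow> real) \<Rightarrow> ('a \<Rightarrow> real) \<Rightarrow>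
     ('a state \<times> 'a state) set" where
  "op_A \<Omega> \<alpha> \<beta> \<gamma> = {(u, f). u \<in> form_dom \<Omega> \<beta> \<and> f \<in> Hsp \<Omega> \<beta> \<and>
     (\<forall>v \<in> form_dom \<Omega> \<beta>. form \<Omega> \<alpha> \<beta> \<gamma> u v = Hsp_inner \<Omega> \<beta> f v)}"

section \<open>Compact resolvent\<close>

definition add_scaled :: "'a state \<Rightarrow> complex \<Rightarrow> 'a state \<Rightarrow> 'a state" where
  "add_scaled f c u = (\<lambda>x. fst f x + c * fst u x, \<lambda>x. snd f x + c * snd u x)"

text \<open>
  For a scalar \<mu>, \<open>(A - \<mu>) u = f\<close> means \<open>(u, f + \<mu> u) \<in> A\<close>. A scalar
  belongs to the resolvent set of a linear operator \<open>A\<close> on the seminormed space \<open>(V, N)\<close> iff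
  \<open>A - \<mu>\<close> is onto \<open>V\<close> with a bounded inverse. The bound contains injectivity: it forces
  \<open>N u = 0\<close> if \<open>(A - \<mu>) u = 0\<close>.
\<close>

definition resolvent_rel ::
  "('a state \<times> 'a state) set \<Rightarrow> complex \<Rightarrow> 'a state \<Rightarrow> 'a state \<Rightarrow> bool" where
  "resolvent_rel A \<mu> f u \<longleftrightarrow> (u, add_scaled f \<mu> u) \<in> A"

definition resolvent_set ::
  "'a state set \<Rightarrow> ('a state \<Rightarrow> real) \<Rightarrow> ('a state \<times> 'a state) set \<Rightarrow> complex set" where
  "resolvent_set V N A = {\<mu>.
     (\<forall>f\<in>V. \<exists>u\<in>V. resolvent_rel A \<mu> f u) \<and>
     (\<exists>C. \<forall>f\<in>V. \<forall>u\<in>V. resolvent_rel A \<mu> f u \<longrightarrow> N u \<le> C * N f)}"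

definition compact_rel ::
  "'a state set \<Rightarrow> ('a state \<Rightarrow> real) \<Rightarrow> ('a state \<Rightarrow> 'a state \<Rightarrow> bool) \<Rightarrow> bool" where
  "compact_rel V N R \<longleftrightarrow>
     (\<forall>f u :: nat \<Rightarrow> 'a state.
        (\<forall>n. f n \<in> V \<and> u n \<in> V \<and> R (f n) (u n)) \<and> bounded (range (\<lambda>n. N (f n))) \<longrightarrow>
        (\<exists>r w. strict_mono (r :: nat \<Rightarrow> nat) \<and> w \<in> V \<and>
           (\<lambda>n. N (add_scaled (u (r n)) (-1) w)) \<longlonglongrightarrow> 0))"

definition has_compact_resolvent ::
  "'a state set \<Rightarrow> ('a state \<Rightarrow> real) \<Rightarrow> ('a state \<times> 'a state) set \<Rightarrow> bool" where
  "has_compact_resolvent V N A \<longleftrightarrow>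
     resolvent_set V N A \<noteq> {} \<and> (\<forall>\<mu>\<in>resolvent_set V N A. compact_rel V N (resolvent_rel A \<mu>))"

end

theory Submission
  imports Defs "HOL-Computational_Algebra.Polynomial" "HOL-Complex_Analysis.Great_Picard"
begin

text \<open>
  The operator comes from a symmetric form which, after adding a multiple of the inner product,
  controls \<open>\<parallel>\<Delta>u\<parallel>\<^sup>2 + \<parallel>u\<parallel>\<^sup>2\<close> and whose domain is complete; by Riesz representation a sufficiently
  negative number lies in the resolvent set. For an arbitrary resolvent, bounded data give solutions
  with bounded \<open>u\<close>, \<open>\<Delta>u\<close> and, since \<open>\<parallel>\<nabla>u\<parallel>\<^sup>2 = - \<langle>\<Delta>u, u\<rangle>\<close>, bounded gradient. Rellich's theorem gives a
  subsequence converging in \<open>L\<^sup>2(\<Omega>)\<close>; the same identity applied to differences upgrades this to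
  convergence in \<open>H\<^sup>1\<close>, and the trace inequality then yields convergence on the boundary.

  Because the trace relation provides approximation by functions smooth up to the boundary, Rellich's
  theorem and the trace inequality are only needed for such functions. Both come from integrating
  along segments pointing into \<open>\<Omega>\<close> in the chart direction and from Fubini for shears, without
  coordinates on the boundary; the surface measure is compared with Lebesgue measure by a Vitali
  covering argument. Since \<open>measure_of\<close> yields either the given set function or 0, the upper bound by
  the Hausdorff outer measure is available without proving Caratheodory's condition.
\<close>

text \<open>Functions stand for their classes, so all inner products are only semidefinite;
  Cauchy-Schwarz, Riesz and completeness are therefore developed for seminorms. Since
  \<open>weak_partial\<close> and \<open>laplacian\<close> are chosen by \<open>SOME\<close>, even
  their linearity holds only almost everywhere and rests on uniqueness of weak derivatives. This is
  why bump functions and the fundamental lemma of the calculus of variations come early.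

  The obstacle in the compactness argument is that its tools live on different functions: the
  identity bounding the gradient by \<Delta> u holds for elements of the form domain, while Rellich
  and the trace inequality are proved for their smooth approximants. Cauchy estimates have to be
  moved back and forth between the two.

  At the boundary, the key object is the image of Lebesgue measure on a collar above the graph,
  collapsed onto the graph along the chart direction. It gives a ball of radius r about a boundary
  point mass at least a constant times r^(d-1), which is what a covering argument needs to dominate
  Hausdorff measure, and integrals against it are integrals over \<Omega>.\<close>

abbreviation esq :: "complex \<Rightarrow> ennreal" where
  "esq z \<equiv> ennreal ((cmod z)\<^sup>2)"

section \<open>Elementary inequalities; semi-inner product spaces and Riesz representation\<close>

lemma cmod_add_squared_le: "(cmod (a + b))\<^sup>2 \<le> 2 * (cmod a)\<^sup>2 + 2 * (cmod b)\<^sup>2"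
proof -
  have "(cmod (a + b))\<^sup>2 \<le> (cmod a + cmod b)\<^sup>2"
    by (intro power_mono norm_triangle_ineq) auto
  also have "\<dots> \<le> 2 * (cmod a)\<^sup>2 + 2 * (cmod b)\<^sup>2"
    using sum_squares_bound[of "cmod a" "cmod b"] by (simp add: power2_sum)
  finally show ?thesis .
qed

lemma tendsto_zero_if_le:
  fixes a b :: "nat \<Rightarrow> real"
  assumes "b \<longlonglongrightarrow> 0" "\<And>n. 0 \<le> a n" "\<And>n. a n \<le> b n"
  shows "a \<longlonglongrightarrow> 0"
  by (rule tendsto_sandwich[OF _ _ tendsto_const assms(1)]) (use assms(2,3) in simp_all)

lemma cauchy_mono:
  fixes a b :: "nat \<Rightarrow> nat \<Rightarrow> real"
  assumes "\<And>e. e > 0 \<Longrightarrow> \<exists>N. \<forall>i\<ge>N. \<forall>j\<ge>N. a i j < e" "\<And>i j. b i j \<le> k * a i j" "k > 0" "e > 0"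
  shows "\<exists>N. \<forall>i\<ge>N. \<forall>j\<ge>N. b i j < e"
proof -
  obtain N where "\<forall>i\<ge>N. \<forall>j\<ge>N. a i j < e / k" using assms(1)[of "e / k"] assms(3,4) by auto
  then have "\<forall>i\<ge>N. \<forall>j\<ge>N. b i j < e"
    using assms(2,3) by (metis (no_types, lifting) le_less_trans mult.commute pos_less_divide_eq)
  then show ?thesis ..
qed

text \<open>Sets of functions, or of pairs of functions, with \<open>comb u c v\<close> standing for
  u + c v. No algebraic law is assumed of \<open>comb\<close> and no definiteness of
  \<open>B\<close>; linear structure is visible only through the values of \<open>B\<close>.\<close>

locale semi_inner =
  fixes D :: "'v set" and comb :: "'v \<Rightarrow> complex \<Rightarrow> 'v \<Rightarrow> 'v" and B :: "'v \<Rightarrow> 'v \<Rightarrow> complex"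
  assumes comb_in: "\<And>u v c. u \<in> D \<Longrightarrow> v \<in> D \<Longrightarrow> comb u c v \<in> D"
    and lin: "\<And>u v w c. u \<in> D \<Longrightarrow> v \<in> D \<Longrightarrow> w \<in> D \<Longrightarrow> B (comb u c v) w = B u w + c * B v w"
    and herm: "\<And>u v. u \<in> D \<Longrightarrow> v \<in> D \<Longrightarrow> B u v = cnj (B v u)"
    and pos: "\<And>u. u \<in> D \<Longrightarrow> 0 \<le> Re (B u u)"
begin

abbreviation "nrm u \<equiv> sqrt (Re (B u u))"

lemma lin2:
  assumes "u \<in> D" "v \<in> D" "w \<in> D"
  shows "B w (comb u c v) = B w u + cnj c * B w v"
proof -
  have "B w (comb u c v) = cnj (B u w + c * B v w)"
    using assms lin[of u v w c] herm[of w "comb u c v"] comb_in by simp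
  also have "\<dots> = B w u + cnj c * B w v"
    using assms herm[of w u] herm[of w v] by simp
  finally show ?thesis .
qed

lemma quad:
  assumes u: "u \<in> D" and v: "v \<in> D"
  shows "Re (B (comb u c v) (comb u c v)) = Re (B u u) + 2 * Re (cnj c * B u v) + (cmod c)\<^sup>2 * Re (B v v)"
proof -
  have "B (comb u c v) (comb u c v) = B u u + cnj c * B u v + c * (cnj (B u v) + cnj c * B v v)"
    using lin[OF u v comb_in[OF u v]] lin2[OF u v u] lin2[OF u v v] herm[OF v u] by simp
  also have "\<dots> = B u u + cnj c * B u v + cnj (cnj c * B u v) + of_real ((cmod c)\<^sup>2) * B v v"
    by (simp add: algebra_simps complex_norm_square del: of_real_power)
  finally show ?thesis by simp
qed

text \<open>The quadratic of the seminorm along u - t (B u v) v, t real, stays nonnegative. Its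
  minimum t = 1 / \<open>B v v\<close> gives the claim. If \<open>B v v\<close> vanishes, which a
  seminorm permits, the expression is affine in t and a large t would make it negative unless
  \<open>B u v\<close> is 0.\<close>

lemma cs:
  assumes u: "u \<in> D" and v: "v \<in> D"
  shows "cmod (B u v) \<le> nrm u * nrm v"
proof -
  define b where "b = cmod (B u v)"
  have ineq: "0 \<le> Re (B u u) - 2 * t * b\<^sup>2 + t\<^sup>2 * b\<^sup>2 * Re (B v v)" for t :: real
  proof -
    have "cnj (- of_real t * B u v) * B u v = - of_real t * (B u v * cnj (B u v))"
      by simp
    also have "\<dots> = of_real (- t * b\<^sup>2)"
      unfolding b_def by (simp only: complex_norm_square[symmetric] of_real_mult of_real_minus)
    finally have "Re (cnj (- of_real t * B u v) * B u v) = - t * b\<^sup>2"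
      by (simp only: Re_complex_of_real)
    then show ?thesis
      using quad[OF u v, of "- of_real t * B u v"] pos[OF comb_in[OF u v, of "- of_real t * B u v"]]
      by (simp add: b_def norm_mult power_mult_distrib)
  qed
  have "b\<^sup>2 \<le> Re (B u u) * Re (B v v)"
  proof (cases "Re (B v v) = 0")
    case True
    have "b\<^sup>2 = 0"
    proof (rule ccontr)
      assume "b\<^sup>2 \<noteq> 0"
      then have "b\<^sup>2 > 0" by simp
      then show False
        using ineq[of "(Re (B u u) + 1) / (2 * b\<^sup>2)"] True by simp
    qed
    then show ?thesis using True by simp
  next
    case False
    then have q: "Re (B v v) > 0" using pos[OF v] by simp
    then show ?thesis
      using ineq[of "1 / Re (B v v)"] by (simp add: field_simps power2_eq_square)
  qed
  then have "sqrt (b\<^sup>2) \<le> sqrt (Re (B u u) * Re (B v v))"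
    by (rule real_sqrt_le_mono)
  then show ?thesis by (simp add: b_def real_sqrt_mult)
qed

lemma triangle:
  assumes u: "u \<in> D" and v: "v \<in> D"
  shows "nrm (comb u c v) \<le> nrm u + cmod c * nrm v"
proof (rule real_le_lsqrt)
  have "Re (cnj c * B u v) \<le> cmod c * (nrm u * nrm v)"
    using complex_Re_le_cmod[of "cnj c * B u v"] cs[OF u v]
    by (simp add: norm_mult) (meson mult_left_mono norm_ge_zero order_trans)
  then show "Re (B (comb u c v) (comb u c v)) \<le> (nrm u + cmod c * nrm v)\<^sup>2"
    using pos[OF u] pos[OF v] by (simp add: quad[OF u v] power2_sum power_mult_distrib algebra_simps)
  show "0 \<le> nrm u + cmod c * nrm v"
    using pos[OF u] pos[OF v] by simp
qed

text \<open>The representing vector minimises the energy \<open>B u u - 2 Re (l u)\<close>; the parallelogram law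
  makes minimising sequences Cauchy.\<close>

lemma riesz:
  fixes l :: "'v \<Rightarrow> complex"
  assumes ne: "D \<noteq> {}"
    and llin: "\<And>u v c. u \<in> D \<Longrightarrow> v \<in> D \<Longrightarrow> l (comb u c v) = l u + cnj c * l v"
    and lbound: "\<And>u. u \<in> D \<Longrightarrow> cmod (l u) \<le> K * nrm u"
    and complete: "\<And>s. (\<And>n. s n \<in> D) \<Longrightarrow>
      (\<And>e. e > 0 \<Longrightarrow> \<exists>N. \<forall>i\<ge>N. \<forall>j\<ge>N. nrm (comb (s i) (-1) (s j)) < e) \<Longrightarrow>
      \<exists>u\<in>D. (\<lambda>n. nrm (comb u (-1) (s n))) \<longlonglongrightarrow> 0"
  shows "\<exists>u\<in>D. \<forall>v\<in>D. B u v = l v"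
proof -
  define J where "J u = Re (B u u) - 2 * Re (l u)" for u
  define X where "X u w = 2 * Re (B u w - l w)" for u w
  have Jc: "J (comb u c w) = J u + 2 * Re (cnj c * (B u w - l w)) + (cmod c)\<^sup>2 * Re (B w w)"
    if "u \<in> D" "w \<in> D" for u w c
    using that by (simp add: J_def quad llin algebra_simps)
  have Jr: "J (comb u (of_real t) w) = J u + t * X u w + t\<^sup>2 * Re (B w w)"
    if "u \<in> D" "w \<in> D" for u w t
    using that by (simp add: Jc X_def algebra_simps)
  \<comment> \<open>\<open>Jr\<close> with t = 1 is of no help here, because u + (v - u) need not be
    v for an abstract \<open>comb\<close>; the expansion is read off from the values of
    \<open>B\<close> and \<open>l\<close> alone.\<close>
  have Jdiff: "J v = J u + X u (comb v (-1) u) + Re (B (comb v (-1) u) (comb v (-1) u))"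
    if u: "u \<in> D" and v: "v \<in> D" for u v
    using quad[OF v u, of "-1"] lin2[OF v u u, of "-1"] llin[OF v u, of "-1"] herm[OF u v]
    by (simp add: J_def X_def)
  \<comment> \<open>Completing the square: with n = \<open>nrm u\<close> the energy is at least n^2
    - 2 K n. Hence the infimum m below is finite.\<close>
  have K: "J u \<ge> - K\<^sup>2" if "u \<in> D" for u
  proof -
    have "Re (l u) \<le> K * nrm u"
      using lbound[OF that] complex_Re_le_cmod[of "l u"] by linarith
    moreover have "0 \<le> (nrm u - K)\<^sup>2" by simp
    ultimately show ?thesis
      using pos[OF that] by (simp add: J_def power2_diff algebra_simps)
  qed
  define m where "m = Inf (J ` D)"
  have bdd: "bdd_below (J ` D)" using K by (auto intro!: bdd_belowI2)
  have m_le: "m \<le> J u" if "u \<in> D" for u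
    unfolding m_def using bdd that by (intro cInf_lower) auto
  have "\<exists>u\<in>D. J u < m + 1 / real (Suc n)" for n
  proof -
    have "Inf (J ` D) < m + 1 / real (Suc n)" by (simp add: m_def)
    then show ?thesis using cInf_lessD[of "J ` D"] ne by blast
  qed
  then obtain s where s: "\<And>n. s n \<in> D" "\<And>n. J (s n) < m + 1 / real (Suc n)" by metis
  \<comment> \<open>With X the first-order term and Q the squared distance, the midpoint has energy
    J u + X/2 + Q/4, and J v = J u + X + Q. So Q/2 equals J u + J v minus twice the midpoint energy,
    which is at least m.\<close>
  have par: "Re (B (comb v (-1) u) (comb v (-1) u)) \<le> 2 * (J u + J v - 2 * m)"
    if u: "u \<in> D" and v: "v \<in> D" for u v
  proof -
    have w: "comb v (-1) u \<in> D" using comb_in[OF v u] .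
    have "m \<le> J (comb u (of_real (1/2)) (comb v (-1) u))"
      by (rule m_le[OF comb_in[OF u w]])
    then show ?thesis
      using Jr[OF u w, of "1/2"] Jdiff[OF u v] by (simp add: power2_eq_square)
  qed
  have "\<exists>u\<in>D. (\<lambda>n. nrm (comb u (-1) (s n))) \<longlonglongrightarrow> 0"
  proof (rule complete[OF s(1)])
    fix e :: real assume "e > 0"
    \<comment> \<open>\<open>par\<close> returns twice the sum of two excesses over m, each below
      e^2 / 4.\<close>
    then obtain N where N: "1 / real (Suc N) < e\<^sup>2 / 4"
      using nat_approx_posE[of "e\<^sup>2 / 4"] by auto
    have "nrm (comb (s i) (-1) (s j)) < e" if "i \<ge> N" "j \<ge> N" for i j
    proof -
      have "1 / real (Suc i) \<le> 1 / real (Suc N)" "1 / real (Suc j) \<le> 1 / real (Suc N)"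
        using that by (auto intro!: divide_left_mono)
      then have "Re (B (comb (s i) (-1) (s j)) (comb (s i) (-1) (s j))) < e\<^sup>2"
        using par[OF s(1)[of j] s(1)[of i]] less_le_trans[OF s(2)[of i], of "m + 1 / real (Suc N)"]
          less_le_trans[OF s(2)[of j], of "m + 1 / real (Suc N)"] N by argo
      then show ?thesis using \<open>e > 0\<close> by (metis abs_of_pos real_sqrt_abs real_sqrt_less_iff)
    qed
    then show "\<exists>N. \<forall>i\<ge>N. \<forall>j\<ge>N. nrm (comb (s i) (-1) (s j)) < e" by blast
  qed
  then obtain u where u: "u \<in> D" "(\<lambda>n. nrm (comb u (-1) (s n))) \<longlonglongrightarrow> 0" by blast
  \<comment> \<open>Expansion around \<open>s n\<close> instead of u: Cauchy-Schwarz and the bound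
    on \<open>l\<close> make the first-order term at most a multiple of the null sequence q, so the
    infimum is attained in the limit.\<close>
  have "J u \<le> m"
  proof (rule tendsto_le[OF sequentially_bot _ tendsto_const])
    define q where "q n = nrm (comb u (-1) (s n))" for n
    have q: "q \<longlonglongrightarrow> 0" using u(2) by (simp add: q_def[abs_def])
    have d: "(\<lambda>n. 1 / real (Suc n)) \<longlonglongrightarrow> 0"
      using LIMSEQ_Suc[OF lim_1_over_n] .
    show "(\<lambda>n. m + 1 / real (Suc n) + 2 * ((nrm u + q n + K) * q n) + (q n)\<^sup>2) \<longlonglongrightarrow> m"
      using tendsto_add[OF tendsto_add[OF tendsto_add[OF tendsto_const d]
            tendsto_mult[OF tendsto_const tendsto_mult[OF tendsto_add[OF tendsto_add[OF tendsto_const q] tendsto_const] q]]]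
            tendsto_power[OF q, of 2], of m 2 "nrm u" K] by simp
    show "\<forall>\<^sub>F n in sequentially. J u \<le> m + 1 / real (Suc n) + 2 * ((nrm u + q n + K) * q n) + (q n)\<^sup>2"
    proof (intro always_eventually allI)
      fix n
      let ?w = "comb u (-1) (s n)"
      have w: "?w \<in> D" using comb_in u s by blast
      have qq: "Re (B ?w ?w) = (q n)\<^sup>2" using pos[OF w] by (simp add: q_def)
      have "2 * Re (B (s n) ?w - l ?w) \<le> 2 * ((nrm u + q n + K) * q n)"
      proof -
        have "Re (B (s n) ?w) = Re (B u ?w) - Re (B ?w ?w)"
          using lin[OF u(1) s(1)[of n] w, of "-1"] by simp
        moreover have "Re (B u ?w) \<le> nrm u * q n"
          using cs[OF u(1) w] complex_Re_le_cmod[of "B u ?w"] by (simp add: q_def)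
        moreover have "- Re (l ?w) \<le> K * q n"
          using lbound[OF w] abs_Re_le_cmod[of "l ?w"] by (simp add: q_def)
        moreover have "- Re (B ?w ?w) \<le> q n * q n"
          using pos[OF w] by (simp add: q_def)
        ultimately show ?thesis by (simp add: algebra_simps)
      qed
      then show "J u \<le> m + 1 / real (Suc n) + 2 * ((nrm u + q n + K) * q n) + (q n)\<^sup>2"
        using Jdiff[OF s(1)[of n] u(1)] s(2)[of n] qq by (simp add: X_def)
    qed
  qed
  have "B u v = l v" if v: "v \<in> D" for v
  proof (rule ccontr)
    define b where "b = B u v - l v"
    assume "B u v \<noteq> l v"
    then have b: "(cmod b)\<^sup>2 > 0" by (simp add: b_def)
    define q where "q = Re (B v v)"
    \<comment> \<open>First variation in direction v, scaled by -t b: this factor makes the linear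
      term real and negative for t > 0.\<close>
    have "0 \<le> - 2 * t * (cmod b)\<^sup>2 + t\<^sup>2 * (cmod b)\<^sup>2 * q" for t :: real
    proof -
      have "cnj (- of_real t * b) * b = - of_real t * (b * cnj b)" by simp
      also have "\<dots> = of_real (- t * (cmod b)\<^sup>2)"
        by (simp only: complex_norm_square[symmetric] of_real_mult of_real_minus)
      finally have "Re (cnj (- of_real t * b) * b) = - t * (cmod b)\<^sup>2"
        by (simp only: Re_complex_of_real)
      then show ?thesis
        using Jc[OF u(1) v, of "- of_real t * b"] m_le[OF comb_in[OF u(1) v, of "- of_real t * b"]] \<open>J u \<le> m\<close>
        by (simp add: q_def b_def[symmetric] norm_mult power_mult_distrib)
    qed
    \<comment> \<open>This t remains meaningful for q = 0 and gives t^2 q - 2 t \<le> t - 2 t <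
      0.\<close>
    from this[of "1 / (1 + q)"] have "0 \<le> (1 / (1 + q) * (1 / (1 + q) * q) - 2 * (1 / (1 + q))) * (cmod b)\<^sup>2"
      by (simp add: algebra_simps power2_eq_square)
    then have "0 \<le> 1 / (1 + q) * (1 / (1 + q) * q) - 2 * (1 / (1 + q))"
      using b by (simp add: zero_le_mult_iff)
    moreover have q: "q \<ge> 0" using pos[OF v] by (simp add: q_def)
    moreover have "1 / (1 + q) * (1 / (1 + q) * q) \<le> 1 / (1 + q) * 1"
      using q by (intro mult_left_mono) auto
    moreover have "1 / (1 + q) > 0" using q by simp
    ultimately show False by linarith
  qed
  then show ?thesis using u(1) by blast
qed

end

section \<open>The space of square integrable functions and its completeness\<close>

lemma L2_measurable [measurable_dest]: "f \<in> L2 M \<Longrightarrow> f \<in> borel_measurable M"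
  by (simp add: L2_def)

lemma L2_integrable: "f \<in> L2 M \<Longrightarrow> integrable M (\<lambda>x. (cmod (f x))\<^sup>2)"
  by (simp add: L2_def)

lemma L2_bound:
  assumes "f \<in> borel_measurable M" "integrable M g" "AE x in M. (cmod (f x))\<^sup>2 \<le> g x"
  shows "f \<in> L2 M"
proof -
  have "AE x in M. norm ((cmod (f x))\<^sup>2) \<le> norm (g x)"
    using assms(3) by eventually_elim simp
  then show ?thesis
    using assms(1,2) unfolding L2_def by (auto intro: Bochner_Integration.integrable_bound)
qed

lemma L2_comb:
  assumes "f \<in> L2 M" "g \<in> L2 M"
  shows "(\<lambda>x. f x + c * g x) \<in> L2 M"
proof (rule L2_bound)
  show "(\<lambda>x. f x + c * g x) \<in> borel_measurable M"
    using assms by measurable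
  show "integrable M (\<lambda>x. 2 * (cmod (f x))\<^sup>2 + 2 * ((cmod c)\<^sup>2 * (cmod (g x))\<^sup>2))"
    using assms by (auto intro!: L2_integrable)
  show "AE x in M. (cmod (f x + c * g x))\<^sup>2 \<le> 2 * (cmod (f x))\<^sup>2 + 2 * ((cmod c)\<^sup>2 * (cmod (g x))\<^sup>2)"
    using cmod_add_squared_le by (intro AE_I2) (metis norm_mult power_mult_distrib)
qed

lemma L2_diff: "f \<in> L2 M \<Longrightarrow> g \<in> L2 M \<Longrightarrow> (\<lambda>x. f x - g x) \<in> L2 M"
  using L2_comb[of f M g "-1"] by simp

lemma L2_zero: "(\<lambda>x. 0) \<in> L2 M"
  by (simp add: L2_def)

lemma L2_mult_bounded:
  fixes a :: "'a \<Rightarrow> real"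
  assumes "f \<in> L2 M" "a \<in> borel_measurable M" "AE x in M. \<bar>a x\<bar> \<le> C"
  shows "(\<lambda>x. of_real (a x) * f x) \<in> L2 M"
proof (rule L2_bound)
  show "(\<lambda>x. of_real (a x) * f x) \<in> borel_measurable M"
    using assms(1,2) by measurable
  show "integrable M (\<lambda>x. C\<^sup>2 * (cmod (f x))\<^sup>2)"
    using assms(1) by (auto intro!: L2_integrable)
  show "AE x in M. (cmod (of_real (a x) * f x))\<^sup>2 \<le> C\<^sup>2 * (cmod (f x))\<^sup>2"
    using assms(3)
    by eventually_elim (simp add: norm_mult power_mult_distrib mult_right_mono abs_le_square_iff[symmetric])
qed

lemma L2_mult_integrable:
  assumes "f \<in> L2 M" "g \<in> L2 M"
  shows "integrable M (\<lambda>x. f x * g x)"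
proof (rule Bochner_Integration.integrable_bound)
  show "integrable M (\<lambda>x. (cmod (f x))\<^sup>2 + (cmod (g x))\<^sup>2)"
    using assms by (auto intro!: L2_integrable)
  show "(\<lambda>x. f x * g x) \<in> borel_measurable M"
    using assms by measurable
  have "cmod (f x) * cmod (g x) \<le> (cmod (f x))\<^sup>2 + (cmod (g x))\<^sup>2" for x
    using sum_squares_bound[of "cmod (f x)" "cmod (g x)"]
      mult_nonneg_nonneg[OF norm_ge_zero[of "f x"] norm_ge_zero[of "g x"]] by linarith
  then show "AE x in M. norm (f x * g x) \<le> norm ((cmod (f x))\<^sup>2 + (cmod (g x))\<^sup>2)"
    by (intro AE_I2) (simp add: norm_mult)
qed

lemma borel_measurable_cnj [measurable (raw)]:
  "f \<in> borel_measurable M \<Longrightarrow> (\<lambda>x. cnj (f x)) \<in> borel_measurable M"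
  by (rule borel_measurable_continuous_on[OF continuous_on_cnj[OF continuous_on_id]])

lemma L2_cnj: "f \<in> L2 M \<Longrightarrow> (\<lambda>x. cnj (f x)) \<in> L2 M"
  by (auto simp: L2_def)

lemma L2_inner_integrable: "f \<in> L2 M \<Longrightarrow> g \<in> L2 M \<Longrightarrow> integrable M (\<lambda>x. f x * cnj (g x))"
  by (intro L2_mult_integrable L2_cnj)

lemma L2_inner_self: "L2_inner M f f = of_real (LINT x|M. (cmod (f x))\<^sup>2)"
  unfolding L2_inner_def complex_norm_square[symmetric] by (rule integral_complex_of_real)

lemma L2_norm_eq: "L2_norm M f = sqrt (Re (L2_inner M f f))"
  by (simp add: L2_inner_self L2_norm_def)

lemma L2_norm_sq: "(L2_norm M f)\<^sup>2 = (LINT x|M. (cmod (f x))\<^sup>2)"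
  by (simp add: L2_norm_def)

lemma L2_norm_nonneg [simp]: "0 \<le> L2_norm M f"
  by (simp add: L2_norm_def)

lemma L2_inner_linear:
  assumes "f \<in> L2 M" "g \<in> L2 M" "h \<in> L2 M"
  shows "L2_inner M (\<lambda>x. f x + c * g x) h = L2_inner M f h + c * L2_inner M g h"
  unfolding L2_inner_def using assms
  by (simp add: distrib_right mult.assoc L2_inner_integrable)

lemma L2_inner_cnj: "L2_inner M f g = cnj (L2_inner M g f)"
  unfolding L2_inner_def by (subst Bochner_Integration.integral_cnj[symmetric]) (simp add: mult.commute)

interpretation L2: semi_inner "L2 M" "\<lambda>f c g x. f x + c * g x" "L2_inner M" for M :: "'a measure"
proof
  show "Re (L2_inner M u u) \<ge> 0" for u
    by (simp add: L2_inner_self)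
qed (auto intro: L2_comb L2_inner_linear L2_inner_cnj)

lemmas L2_CS = L2.cs[folded L2_norm_eq]
lemmas L2_triangle = L2.triangle[folded L2_norm_eq]

lemma L2_triangle_diff:
  assumes "f \<in> L2 M" "g \<in> L2 M"
  shows "L2_norm M (\<lambda>x. f x - g x) \<le> L2_norm M f + L2_norm M g"
  using L2_triangle[OF assms, of "-1"] by simp

lemma L2_triangle3:
  assumes "f \<in> L2 M" "g \<in> L2 M" "h \<in> L2 M"
  shows "L2_norm M (\<lambda>x. f x - h x) \<le> L2_norm M (\<lambda>x. f x - g x) + L2_norm M (\<lambda>x. g x - h x)"
  using L2_triangle[OF L2_diff[OF assms(1,2)] L2_diff[OF assms(2,3)], of 1] by simp

lemma L2_norm_minus_commute: "L2_norm M (\<lambda>x. f x - g x) = L2_norm M (\<lambda>x. g x - f x)"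
  by (simp add: L2_norm_def norm_minus_commute)

lemma L2_inner_cong_AE:
  assumes "AE x in M. f x = f' x" "AE x in M. g x = g' x"
    "f \<in> borel_measurable M" "f' \<in> borel_measurable M" "g \<in> borel_measurable M" "g' \<in> borel_measurable M"
  shows "L2_inner M f g = L2_inner M f' g'"
proof -
  have "AE x in M. f x * cnj (g x) = f' x * cnj (g' x)"
    using assms(1,2) by eventually_elim simp
  then show ?thesis unfolding L2_inner_def
    using assms(3-6) by (intro integral_cong_AE) auto
qed

lemma L2_norm_cong_AE:
  assumes "AE x in M. f x = f' x" "f \<in> borel_measurable M" "f' \<in> borel_measurable M"
  shows "L2_norm M f = L2_norm M f'"
  using L2_inner_cong_AE[OF assms(1,1,2,3,2,3)] by (simp add: L2_norm_eq)

lemma (in finite_measure) L2_const: "(\<lambda>x. c) \<in> L2 M"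
  by (simp add: L2_def)

lemma (in finite_measure) L1_le_L2:
  assumes f: "f \<in> L2 M"
  shows "integrable M f" "(LINT x|M. cmod (f x)) \<le> sqrt (measure M (space M)) * L2_norm M f"
proof -
  show i: "integrable M f" using L2_mult_integrable[OF f L2_const[of 1]] by simp
  have f': "(\<lambda>x. of_real (cmod (f x))) \<in> L2 M" using f by (auto simp: L2_def)
  have "L2_inner M (\<lambda>x. of_real (cmod (f x))) (\<lambda>x. 1) = of_real (LINT x|M. cmod (f x))"
    by (simp add: L2_inner_def)
  moreover have "cmod (of_real (LINT x|M. cmod (f x))) = (LINT x|M. cmod (f x))" by simp
  moreover have "L2_norm M (\<lambda>x. of_real (cmod (f x))) = L2_norm M f"
    "L2_norm M (\<lambda>x. 1) = sqrt (measure M (space M))"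
    by (simp_all add: L2_norm_def)
  ultimately show "(LINT x|M. cmod (f x)) \<le> sqrt (measure M (space M)) * L2_norm M f"
    using L2_CS[OF f' L2_const[of 1]] by (simp only: mult.commute)
qed

text \<open>On a finite measure a Cauchy sequence in L2 is Cauchy in L1, which supplies a
  subsequence converging almost everywhere. Fatou's lemma along that subsequence bounds the distance
  of each late \<open>f n\<close> from the limit.\<close>

lemma (in finite_measure) L2_complete:
  assumes f: "\<And>n. f n \<in> L2 M"
    and cauchy: "\<And>e. e > 0 \<Longrightarrow> \<exists>N. \<forall>i\<ge>N. \<forall>j\<ge>N. L2_norm M (\<lambda>x. f i x - f j x) < e"
  obtains g where "g \<in> L2 M" "(\<lambda>n. L2_norm M (\<lambda>x. f n x - g x)) \<longlonglongrightarrow> 0"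
proof -
  note [measurable] = L2_measurable[OF f]
  \<comment> \<open>The summand 1 keeps the divisor positive even for the zero measure.\<close>
  define K where "K = sqrt (measure M (space M)) + 1"
  have K: "K > 0" unfolding K_def by (simp add: add_nonneg_pos)
  obtain r where r: "strict_mono r" "AE x in M. Cauchy (\<lambda>i. f (r i) x)"
  proof (rule cauchy_L1_AE_cauchy_subseq[of M f])
    show "integrable M (f n)" for n using L1_le_L2(1)[OF f] .
    fix e :: real assume "e > 0"
    then obtain N where N: "\<And>i j. i \<ge> N \<Longrightarrow> j \<ge> N \<Longrightarrow> L2_norm M (\<lambda>x. f i x - f j x) < e / K"
      using cauchy[of "e / K"] K by (meson divide_pos_pos)
    have "(LINT x|M. norm (f i x - f j x)) < e" if "i \<ge> N" "j \<ge> N" for i j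
    proof -
      have "(LINT x|M. norm (f i x - f j x)) \<le> sqrt (measure M (space M)) * L2_norm M (\<lambda>x. f i x - f j x)"
        using L1_le_L2(2)[OF L2_diff[OF f f]] .
      also have "\<dots> \<le> K * L2_norm M (\<lambda>x. f i x - f j x)"
        by (intro mult_right_mono) (auto simp: K_def)
      also have "\<dots> < K * (e / K)" using N[OF that] K by (intro mult_strict_left_mono)
      finally show ?thesis using K by simp
    qed
    then show "\<exists>N. \<forall>i\<ge>N. \<forall>j\<ge>N. (LINT x|M. norm (f i x - f j x)) < e" by blast
  qed
  define g where "g x = lim (\<lambda>i. f (r i) x)" for x
  have g [measurable]: "g \<in> borel_measurable M"
    unfolding g_def by (rule borel_measurable_lim_metric) auto
  have lim: "AE x in M. (\<lambda>i. f (r i) x) \<longlonglongrightarrow> g x"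
    using r(2) by eventually_elim (simp add: g_def Cauchy_convergent convergent_LIMSEQ_iff[symmetric])
  have *: "\<exists>N. \<forall>n\<ge>N. (\<lambda>x. f n x - g x) \<in> L2 M \<and> L2_norm M (\<lambda>x. f n x - g x) \<le> e" if "e > 0" for e
  proof -
    obtain N where N: "\<And>i j. i \<ge> N \<Longrightarrow> j \<ge> N \<Longrightarrow> L2_norm M (\<lambda>x. f i x - f j x) < e"
      using cauchy[OF \<open>e > 0\<close>] by blast
    have "(\<lambda>x. f n x - g x) \<in> L2 M \<and> L2_norm M (\<lambda>x. f n x - g x) \<le> e" if n: "n \<ge> N" for n
    proof -
      have "(\<integral>\<^sup>+x. esq (f n x - g x) \<partial>M)
          = (\<integral>\<^sup>+x. liminf (\<lambda>i. esq (f n x - f (r i) x)) \<partial>M)"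
      proof (rule nn_integral_cong_AE, use lim in eventually_elim)
        fix x assume "(\<lambda>i. f (r i) x) \<longlonglongrightarrow> g x"
        then have "(\<lambda>i. esq (f n x - f (r i) x)) \<longlonglongrightarrow> esq (f n x - g x)"
          by (intro tendsto_intros)
        then show "esq (f n x - g x) = liminf (\<lambda>i. esq (f n x - f (r i) x))"
          by (rule lim_imp_Liminf[OF sequentially_bot, symmetric])
      qed
      also have "\<dots> \<le> liminf (\<lambda>i. \<integral>\<^sup>+x. esq (f n x - f (r i) x) \<partial>M)"
        by (rule nn_integral_liminf) auto
      also have "\<dots> \<le> ennreal (e\<^sup>2)"
      proof (rule order_trans[OF Liminf_le_Limsup])
        show "limsup (\<lambda>i. \<integral>\<^sup>+x. esq (f n x - f (r i) x) \<partial>M) \<le> ennreal (e\<^sup>2)"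
        proof (rule Limsup_bounded, rule eventually_sequentiallyI[of N])
          fix i assume "i \<ge> N"
          then have "r i \<ge> N" using seq_suble[OF r(1), of i] by linarith
          have "(\<integral>\<^sup>+x. esq (f n x - f (r i) x) \<partial>M) = ennreal ((L2_norm M (\<lambda>x. f n x - f (r i) x))\<^sup>2)"
            unfolding L2_norm_sq using L2_integrable[OF L2_diff[OF f f]]
            by (intro nn_integral_eq_integral) auto
          also have "\<dots> \<le> ennreal (e\<^sup>2)"
            using N[OF n \<open>r i \<ge> N\<close>] by (intro ennreal_leI power_mono) auto
          finally show "(\<integral>\<^sup>+x. esq (f n x - f (r i) x) \<partial>M) \<le> ennreal (e\<^sup>2)" .
        qed
      qed simp
      finally have le: "(\<integral>\<^sup>+x. esq (f n x - g x) \<partial>M) \<le> ennreal (e\<^sup>2)" .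
      have i: "integrable M (\<lambda>x. (cmod (f n x - g x))\<^sup>2)"
        using le by (intro integrableI_bounded) (auto intro: le_less_trans)
      have "(LINT x|M. (cmod (f n x - g x))\<^sup>2) \<le> e\<^sup>2"
        using le by (subst (asm) nn_integral_eq_integral[OF i]) auto
      then show ?thesis using i \<open>e > 0\<close>
        by (auto simp: L2_def L2_norm_def intro!: real_le_lsqrt)
    qed
    then show ?thesis by blast
  qed
  show thesis
  proof
    obtain n where n: "(\<lambda>x. f n x - g x) \<in> L2 M" using *[of 1] by auto
    show "g \<in> L2 M" using L2_diff[OF f[of n] n] by simp
    show "(\<lambda>n. L2_norm M (\<lambda>x. f n x - g x)) \<longlonglongrightarrow> 0"
    proof (rule LIMSEQ_I)
      fix e :: real assume "e > 0"
      then obtain N where "\<forall>n\<ge>N. L2_norm M (\<lambda>x. f n x - g x) \<le> e / 2"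
        using *[of "e/2"] by auto
      then show "\<exists>no. \<forall>n\<ge>no. norm (L2_norm M (\<lambda>x. f n x - g x) - 0) < e"
        using \<open>e > 0\<close> by (intro exI[of _ N]) (fastforce simp: abs_of_nonneg)
    qed
  qed
qed

section \<open>Smooth functions and bumps\<close>

lemma frechet_derivative_mult_complex:
  fixes f g :: "'a::euclidean_space \<Rightarrow> complex"
  assumes "f differentiable (at x)" "g differentiable (at x)"
  shows "frechet_derivative (\<lambda>x. f x * g x) (at x) j =
    f x * frechet_derivative g (at x) j + frechet_derivative f (at x) j * g x"
  using frechet_derivative_at[OF has_derivative_mult[OF assms[unfolded frechet_derivative_works]]]
  by (metis (no_types, lifting))

lemma frechet_derivative_comb_complex:
  fixes f g :: "'a::euclidean_space \<Rightarrow> complex"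
  assumes "f differentiable (at x)" "g differentiable (at x)"
  shows "frechet_derivative (\<lambda>x. f x + c * g x) (at x) j =
    frechet_derivative f (at x) j + c * frechet_derivative g (at x) j"
  using frechet_derivative_at[OF has_derivative_add[OF assms(1)[unfolded frechet_derivative_works]
      has_derivative_mult_right[OF assms(2)[unfolded frechet_derivative_works]]], of c]
  by (metis (no_types, lifting))

lemma Ck_Suc_imp_Ck: "Ck (Suc k) f \<Longrightarrow> Ck k f"
proof (induction k arbitrary: f)
  case 0
  then show ?case
    by (auto intro!: differentiable_imp_continuous_on simp: differentiable_on_def intro: differentiable_at_withinI)
next
  case (Suc k)
  then show ?case by (metis Ck.simps(2))
qed

lemma Ck_const: "Ck k (\<lambda>x. c)"
  by (induction k arbitrary: c) auto

lemma Ck_comb: "Ck k f \<Longrightarrow> Ck k g \<Longrightarrow> Ck k (\<lambda>x. f x + c * g x)"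
proof (induction k arbitrary: f g)
  case 0
  then show ?case by (auto intro!: continuous_intros)
next
  case (Suc k)
  then have "partial j (\<lambda>x. f x + c * g x) = (\<lambda>x. partial j f x + c * partial j g x)" for j
    by (intro ext frechet_derivative_comb_complex) auto
  then show ?case using Suc by (auto intro!: derivative_intros)
qed

lemma Ck_cmult: "Ck k f \<Longrightarrow> Ck k (\<lambda>x. c * f x)"
  using Ck_comb[OF Ck_const[of k 0]] by simp

lemma Ck_mult: "Ck k f \<Longrightarrow> Ck k g \<Longrightarrow> Ck k (\<lambda>x. f x * g x)"
proof (induction k arbitrary: f g)
  case 0
  then show ?case by (auto intro!: continuous_intros)
next
  case (Suc k)
  have eq: "partial j (\<lambda>x. f x * g x) = (\<lambda>x. f x * partial j g x + 1 * (partial j f x * g x))" for j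
    using Suc.prems by (intro ext) (simp add: frechet_derivative_mult_complex)
  have "Ck k (\<lambda>x. f x * partial j g x + 1 * (partial j f x * g x))" if "j \<in> Basis" for j
    using that Suc.prems Ck_Suc_imp_Ck[OF Suc.prems(1)] Ck_Suc_imp_Ck[OF Suc.prems(2)]
    by (intro Ck_comb Suc.IH) auto
  then show ?case using Suc.prems by (auto simp: eq intro!: derivative_intros)
qed

lemma Ck_prod: "finite I \<Longrightarrow> (\<And>i. i \<in> I \<Longrightarrow> Ck k (f i)) \<Longrightarrow> Ck k (\<lambda>x. \<Prod>i\<in>I. f i x)"
  by (induction I rule: finite_induct) (auto intro: Ck_const Ck_mult)

lemma smooth_Ck: "smooth f \<Longrightarrow> Ck k f"
  by (simp add: smooth_def)

lemma smooth_differentiable: "smooth f \<Longrightarrow> f differentiable (at x)"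
  using smooth_Ck[of f 1] by simp

lemma smooth_partial: "smooth f \<Longrightarrow> j \<in> Basis \<Longrightarrow> smooth (partial j f)"
  unfolding smooth_def by (metis Ck.simps(2))

lemma smooth_continuous: "smooth f \<Longrightarrow> continuous_on A f"
  using smooth_Ck[of f 0] by (auto intro: continuous_on_subset)

lemma smooth_comb: "smooth f \<Longrightarrow> smooth g \<Longrightarrow> smooth (\<lambda>x. f x + c * g x)"
  by (simp add: smooth_def Ck_comb)

lemma smooth_diff: "smooth f \<Longrightarrow> smooth g \<Longrightarrow> smooth (\<lambda>x. f x - g x)"
  using smooth_comb[of f g "-1"] by simp

lemma smooth_const: "smooth (\<lambda>x. c)"
  by (simp add: smooth_def Ck_const)

text \<open>For P = 1 this is the classical flat function exp(-1/t). The polynomial factor in 1/t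
  makes the family closed under differentiation, so smoothness follows by induction over all P at
  once.\<close>

definition expinv :: "real poly \<Rightarrow> real \<Rightarrow> real" where
  "expinv P t = (if t > 0 then poly P (1 / t) * exp (- (1 / t)) else 0)"

text \<open>The free power x^k is there for the induction on P: splitting off the constant
  coefficient raises the power in front of the rest by one.\<close>

lemma poly_div_exp_tendsto_0: "((\<lambda>x. x ^ k * poly P x / exp x) \<longlongrightarrow> (0::real)) at_top"
proof (induction P arbitrary: k)
  case (pCons a P)
  have "((\<lambda>x. a * (x ^ k / exp x) + x ^ Suc k * poly P x / exp x) \<longlongrightarrow> a * 0 + 0) at_top"
    by (intro tendsto_intros tendsto_power_div_exp_0 pCons)
  then show ?case by (simp add: field_simps)
qed simp

lemma expinv_tendsto_0: "(expinv P \<longlongrightarrow> 0) (at 0)"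
proof (rule filterlim_split_at_real)
  have "\<forall>\<^sub>F t in at_left 0. expinv P t = 0"
    by (auto simp: eventually_at_filter expinv_def)
  then show "(expinv P \<longlongrightarrow> 0) (at_left 0)"
    by (rule tendsto_eventually)
  have "((\<lambda>t. poly P (inverse t) / exp (inverse t)) \<longlongrightarrow> 0) (at_right 0)"
    using filterlim_compose[OF poly_div_exp_tendsto_0[of 0 P, simplified] filterlim_inverse_at_top_right] .
  moreover have "\<forall>\<^sub>F t in at_right 0. poly P (inverse t) / exp (inverse t) = expinv P t"
    by (auto simp: eventually_at_filter expinv_def exp_minus field_simps)
  ultimately show "(expinv P \<longlongrightarrow> 0) (at_right 0)"
    by (rule Lim_transform_eventually)
qed

text \<open>With y = 1/t, the derivative of P(y) exp(-y) in t is y^2 (P - P')(y) exp(-y). At t = 0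
  the difference quotient is \<open>expinv\<close> of the polynomial y P, whose limit is 0.\<close>

lemma expinv_DERIV:
  "(expinv P has_real_derivative expinv ([:0, 0, 1:] * (P - pderiv P)) t) (at t)"
proof -
  consider "t > 0" | "t < 0" | "t = 0" by linarith
  then show ?thesis
  proof cases
    case 1
    have "((\<lambda>t. poly P (1 / t) * exp (- (1 / t))) has_real_derivative
        expinv ([:0, 0, 1:] * (P - pderiv P)) t) (at t)"
      using 1 by (auto intro!: derivative_eq_intros DERIV_chain2[OF poly_DERIV]
          simp: expinv_def power2_eq_square field_simps)
    then show ?thesis
      by (rule DERIV_cong_ev[THEN iffD1, rotated -1])
         (use 1 eventually_nhds_in_open[of "{0<..}" t] in \<open>auto elim!: eventually_mono simp: expinv_def\<close>)
  next
    case 2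
    have "((\<lambda>t. 0) has_real_derivative expinv ([:0, 0, 1:] * (P - pderiv P)) t) (at t)"
      using 2 by (simp add: expinv_def)
    then show ?thesis
      by (rule DERIV_cong_ev[THEN iffD1, rotated -1])
         (use 2 eventually_nhds_in_open[of "{..<0}" t] in \<open>auto elim!: eventually_mono simp: expinv_def\<close>)
  next
    case 3
    have "(\<lambda>h. (expinv P (0 + h) - expinv P 0) / h) = expinv (pCons 0 P)"
      by (auto simp: expinv_def fun_eq_iff)
    then show ?thesis
      using 3 expinv_tendsto_0[of "pCons 0 P"] by (simp add: DERIV_def expinv_def)
  qed
qed

lemma expinv_has_derivative:
  fixes b x :: "'a::euclidean_space"
  shows "((\<lambda>x. complex_of_real (expinv P (c * (x \<bullet> b) + d))) has_derivative
    (\<lambda>h. of_real (c * (h \<bullet> b) * expinv ([:0, 0, 1:] * (P - pderiv P)) (c * (x \<bullet> b) + d)))) (at x)"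
  by (rule has_derivative_of_real, rule DERIV_compose_FDERIV[OF expinv_DERIV])
     (auto intro!: derivative_eq_intros)

lemma Ck_expinv: "Ck k (\<lambda>x::'a::euclidean_space. of_real (expinv P (c * (x \<bullet> b) + d)))"
proof (induction k arbitrary: P)
  case 0
  show ?case
    unfolding Ck.simps using has_derivative_continuous[OF expinv_has_derivative]
    by (intro continuous_at_imp_continuous_on ballI)
next
  case (Suc k)
  have eq: "partial j (\<lambda>x::'a. complex_of_real (expinv P (c * (x \<bullet> b) + d))) =
      (\<lambda>x. of_real (c * (j \<bullet> b)) * of_real (expinv ([:0, 0, 1:] * (P - pderiv P)) (c * (x \<bullet> b) + d)))" for j
    by (intro ext) (simp add: frechet_derivative_at[OF expinv_has_derivative, symmetric])
  show ?case
    unfolding Ck.simps eq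
    by (intro conjI allI ballI Ck_cmult Suc differentiableI[OF expinv_has_derivative])
qed

text \<open>Products of flat functions of the distances to the faces of the box, speeded up by n +
  1. They stay below 1 and converge to the indicator of the open box, so dominated convergence turns
  test integrals into box integrals.\<close>

definition bump :: "'a::euclidean_space \<Rightarrow> 'a \<Rightarrow> nat \<Rightarrow> 'a \<Rightarrow> real" where
  "bump a b n x = (\<Prod>i\<in>Basis. expinv 1 (real (Suc n) * (x \<bullet> i - a \<bullet> i)) * expinv 1 (real (Suc n) * (b \<bullet> i - x \<bullet> i)))"

lemma expinv_1: "0 \<le> expinv 1 t" "expinv 1 t \<le> 1" "expinv 1 t \<noteq> 0 \<longleftrightarrow> t > 0"
  by (auto simp: expinv_def)

lemma expinv_1_tendsto:
  assumes "t > 0" shows "(\<lambda>n. expinv 1 (real (Suc n) * t)) \<longlonglongrightarrow> 1"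
proof -
  have "(\<lambda>n. exp (- (1 / real (Suc n) * (1 / t)))) \<longlonglongrightarrow> exp (- (0 * (1 / t)))"
    by (intro tendsto_intros LIMSEQ_Suc[OF lim_1_over_n])
  then show ?thesis using assms by (simp add: expinv_def)
qed

lemma bump_bound: "0 \<le> bump a b n x" "bump a b n x \<le> 1"
  unfolding bump_def by (auto intro!: prod_nonneg prod_le_1 mult_nonneg_nonneg mult_le_one simp: expinv_1)

lemma bump_nonzero: "bump a b n x \<noteq> 0 \<longleftrightarrow> x \<in> box a b"
  by (auto simp: bump_def box_def expinv_1 prod_zero_iff zero_less_mult_iff)

lemma bump_tendsto: "(\<lambda>n. bump a b n x) \<longlonglongrightarrow> indicator (box a b) x"
proof (cases "x \<in> box a b")
  case True
  have "(\<lambda>n. bump a b n x) \<longlonglongrightarrow> (\<Prod>i\<in>(Basis::'a set). 1 * 1)"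
    unfolding bump_def using True
    by (intro tendsto_prod tendsto_mult expinv_1_tendsto) (auto simp: box_def)
  then show ?thesis using True by simp
next
  case False
  then have "bump a b n x = 0" for n using bump_nonzero by blast
  then show ?thesis using False by simp
qed

lemma bump_test_function:
  assumes "cbox a b \<subseteq> \<Omega>"
  shows "(\<lambda>x. of_real (bump a b n x)) \<in> test_functions \<Omega>"
proof -
  have "Ck k (\<lambda>x::'a. complex_of_real (bump a b n x))" for k
  proof -
    have "Ck k (\<lambda>x. \<Prod>i\<in>Basis. complex_of_real (expinv 1 (real (Suc n) * (x \<bullet> i) + (- real (Suc n) * (a \<bullet> i)))) *
        complex_of_real (expinv 1 (- real (Suc n) * (x \<bullet> i) + real (Suc n) * (b \<bullet> i))))"
      by (intro Ck_prod Ck_mult Ck_expinv) auto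
    moreover have "real (Suc n) * (x \<bullet> i - a \<bullet> i) = real (Suc n) * (x \<bullet> i) + (- real (Suc n) * (a \<bullet> i))"
      "real (Suc n) * (b \<bullet> i - x \<bullet> i) = - real (Suc n) * (x \<bullet> i) + real (Suc n) * (b \<bullet> i)" for x i :: 'a
      by (simp_all only: distrib_left mult_minus_left mult_minus_right diff_conv_add_uminus add.commute)
    ultimately show ?thesis by (simp only: bump_def of_real_prod of_real_mult)
  qed
  moreover have sub: "closure {x. complex_of_real (bump a b n x) \<noteq> 0} \<subseteq> cbox a b"
    using bump_nonzero[of a b n] box_subset_cbox[of a b] by (intro closure_minimal) auto
  moreover have "compact (closure {x. complex_of_real (bump a b n x) \<noteq> 0})"
    using sub by (auto intro: bounded_subset bounded_cbox simp: compact_eq_bounded_closed)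
  ultimately show ?thesis using assms by (auto simp: test_functions_def smooth_def)
qed

lemma test_functions_partial:
  assumes "\<phi> \<in> test_functions \<Omega>" "j \<in> Basis"
  shows "partial j \<phi> \<in> test_functions \<Omega>"
proof -
  have "partial j \<phi> x = 0" if "x \<notin> closure {x. \<phi> x \<noteq> 0}" for x
  proof -
    have "((\<lambda>x. 0) has_derivative (\<lambda>h. 0)) (at x)" by simp
    then have "(\<phi> has_derivative (\<lambda>h. 0)) (at x)"
      by (rule has_derivative_transform_within_open[of _ _ _ _ "- closure {x. \<phi> x \<noteq> 0}"])
         (use that closure_subset[of "{x. \<phi> x \<noteq> 0}"] in auto)
    then show ?thesis using frechet_derivative_at by metis
  qed
  then have "{x. partial j \<phi> x \<noteq> 0} \<subseteq> closure {x. \<phi> x \<noteq> 0}" by blast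
  then have sub: "closure {x. partial j \<phi> x \<noteq> 0} \<subseteq> closure {x. \<phi> x \<noteq> 0}"
    by (simp add: closure_minimal)
  moreover have "compact (closure {x. partial j \<phi> x \<noteq> 0})"
    using sub assms(1) by (auto simp: test_functions_def compact_eq_bounded_closed intro: bounded_subset)
  ultimately show ?thesis
    using assms smooth_partial[of \<phi> j] by (auto simp: test_functions_def)
qed

section \<open>The fundamental lemma of the calculus of variations\<close>

text \<open>Positive and negative part of f are densities of finite measures that agree on open
  boxes, an intersection-stable generator of the Borel sets. The measures are equal, hence so are
  the densities almost everywhere.\<close>

lemma AE_zero_if_box_integrals_zero_lborel:
  fixes f :: "'a::euclidean_space \<Rightarrow> real"
  assumes f: "integrable lborel f"
    and zero: "\<And>a b. (LINT x|lborel. indicator (box a b) x * f x) = 0"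
  shows "AE x in lborel. f x = 0"
proof -
  have [measurable]: "f \<in> borel_measurable lborel" using f by auto
  define p where "p x = ennreal (f x)" for x
  define m where "m x = ennreal (- f x)" for x
  have [measurable]: "p \<in> borel_measurable lborel" "m \<in> borel_measurable lborel"
    by (simp_all add: p_def[abs_def] m_def[abs_def])
  have fin: "integral\<^sup>N lborel p < \<infinity>"
  proof -
    have "integral\<^sup>N lborel p \<le> (\<integral>\<^sup>+x. norm (f x) \<partial>lborel)"
      unfolding p_def by (intro nn_integral_mono ennreal_leI) auto
    also have "\<dots> < \<infinity>" using f by (simp add: integrable_iff_bounded)
    finally show ?thesis .
  qed
  have box: "emeasure (density lborel p) (box a b) = emeasure (density lborel m) (box a b)" for a b
  proof -
    have i: "integrable lborel (\<lambda>x. indicator (box a b) x * f x)"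
      using integrable_mult_indicator[OF _ f, of "box a b"] by simp
    have "(\<integral>\<^sup>+x. ennreal (indicator (box a b) x * f x) \<partial>lborel) =
        (\<integral>\<^sup>+x. ennreal (- (indicator (box a b) x * f x)) \<partial>lborel)"
    proof -
      have A: "(\<integral>\<^sup>+x. ennreal (indicator (box a b) x * f x) \<partial>lborel) < \<infinity>"
        "(\<integral>\<^sup>+x. ennreal (- (indicator (box a b) x * f x)) \<partial>lborel) < \<infinity>"
        using i unfolding real_integrable_def by (simp_all add: less_top)
      then show ?thesis
        using zero[of a b] real_lebesgue_integral_def[OF i]
        by (metis (no_types, lifting) diff_eq_diff_eq diff_self enn2real_nonneg ennreal_enn2real_if infinity_ennreal_def less_irrefl right_minus_eq)
    qed
    moreover have "ennreal (indicator (box a b) x * f x) = p x * indicator (box a b) x"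
      "ennreal (- (indicator (box a b) x * f x)) = m x * indicator (box a b) x" for x
      by (auto simp: p_def m_def indicator_def)
    ultimately show ?thesis by (simp add: emeasure_density)
  qed
  have "density lborel p = density lborel m"
  proof (rule measure_eqI_generator_eq[where E = "range (\<lambda>(a, b). box a b)" and \<Omega> = UNIV
        and A = "\<lambda>n. box (- real n *\<^sub>R One) (real n *\<^sub>R One)"])
    show "Int_stable (range (\<lambda>(a, b). box a b :: 'a set))"
      by (auto simp: Int_stable_def box_Int_box)
    show "sets (density lborel p) = sigma_sets UNIV (range (\<lambda>(a, b). box a b))"
      "sets (density lborel m) = sigma_sets UNIV (range (\<lambda>(a, b). box a b))"
      by (simp_all add: borel_eq_box)
    show "emeasure (density lborel p) (box (- real n *\<^sub>R One) (real n *\<^sub>R One)) \<noteq> \<infinity>" for n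
    proof -
      have "emeasure (density lborel p) (box (- real n *\<^sub>R One) (real n *\<^sub>R One)) \<le> integral\<^sup>N lborel p"
        by (auto simp: emeasure_density intro!: nn_integral_mono split: split_indicator)
      then show ?thesis using fin by auto
    qed
    show "(\<Union>n. box (- real n *\<^sub>R One) (real n *\<^sub>R One)) = (UNIV :: 'a set)"
      using UN_box_eq_UNIV by simp
  qed (auto simp: box)
  then have "AE x in lborel. p x = m x"
    using sigma_finite_lborel by (subst (asm) sigma_finite_measure.density_unique_iff) auto
  then show ?thesis
  proof eventually_elim
    case (elim x)
    show "f x = 0"
      by (cases "f x" "0 :: real" rule: linorder_cases) (use elim in \<open>auto simp: p_def m_def ennreal_neg ennreal_eq_0_iff\<close>)
  qed
qed

text \<open>\<open>lebesgue\<close> is the completion of \<open>lborel\<close>, so f may be replaced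
  by a Borel version with the same box integrals.\<close>

lemma AE_zero_if_box_integrals_zero:
  fixes f :: "'a::euclidean_space \<Rightarrow> real"
  assumes f: "integrable lebesgue f"
    and zero: "\<And>a b. (LINT x|lebesgue. indicator (box a b) x * f x) = 0"
  shows "AE x in lebesgue. f x = 0"
proof -
  have fm: "f \<in> borel_measurable lebesgue" using f by auto
  then obtain g where g[measurable]: "g \<in> borel_measurable lborel" "AE x in lborel. f x = g x"
    using completion_ex_borel_measurable_real by blast
  then have ae: "AE x in lebesgue. f x = g x" by (auto intro: AE_completion)
  have gi: "integrable lebesgue g"
    using integrable_cong_AE_imp[OF f _ ae] g(1) by (simp add: measurable_completion)
  have "AE x in lborel. g x = 0"
  proof (rule AE_zero_if_box_integrals_zero_lborel)
    show "integrable lborel g" using gi by (simp add: integrable_completion)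
    fix a b
    have "(LINT x|lborel. indicator (box a b) x * g x) = (LINT x|lebesgue. indicator (box a b) x * g x)"
      by (simp add: integral_completion)
    also have "\<dots> = (LINT x|lebesgue. indicator (box a b) x * f x)"
    proof (rule integral_cong_AE)
      show "AE x in lebesgue. indicator (box a b) x * g x = indicator (box a b) x * f x"
        using ae by eventually_elim simp
      have i: "(indicator (box a b) :: 'a \<Rightarrow> real) \<in> borel_measurable lebesgue"
        by (intro borel_measurable_indicator) auto
      show "(\<lambda>x. indicator (box a b) x * g x) \<in> borel_measurable lebesgue"
        using i g(1) by (intro borel_measurable_times) (auto intro: measurable_completion)
      show "(\<lambda>x. indicator (box a b) x * f x) \<in> borel_measurable lebesgue"
        using i fm by (intro borel_measurable_times)
    qed
    finally show "(LINT x|lborel. indicator (box a b) x * g x) = 0" using zero by simp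
  qed
  then have "AE x in lebesgue. g x = 0" by (rule AE_completion)
  with ae show ?thesis by eventually_elim simp
qed

lemma AE_zero_if_box_integrals_zero_complex:
  fixes f :: "'a::euclidean_space \<Rightarrow> complex"
  assumes f: "integrable lebesgue f"
    and zero: "\<And>a b. (LINT x|lebesgue. indicator (box a b) x *\<^sub>R f x) = 0"
  shows "AE x in lebesgue. f x = 0"
proof -
  have i: "integrable lebesgue (\<lambda>x. indicator (box a b) x *\<^sub>R f x)" for a b
    by (rule integrable_mult_indicator[OF _ f]) auto
  have "AE x in lebesgue. Re (f x) = 0"
  proof (rule AE_zero_if_box_integrals_zero[OF integrable_Re[OF f]])
    show "(LINT x|lebesgue. indicator (box a b) x * Re (f x)) = 0" for a b
      using integral_Re[OF i[of a b]] zero[of a b] by simp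
  qed
  moreover have "AE x in lebesgue. Im (f x) = 0"
  proof (rule AE_zero_if_box_integrals_zero[OF integrable_Im[OF f]])
    show "(LINT x|lebesgue. indicator (box a b) x * Im (f x)) = 0" for a b
      using integral_Im[OF i[of a b]] zero[of a b] by simp
  qed
  ultimately show ?thesis by eventually_elim (simp add: complex_eq_iff)
qed

text \<open>Bumps give vanishing integrals over open boxes whose closure lies in \<Omega>. After
  multiplication of g by the indicator of one such box all box integrals vanish, so g is null there;
  by Lindelof countably many such boxes exhaust \<Omega>.\<close>

lemma fundamental_lemma:
  fixes g :: "'a::euclidean_space \<Rightarrow> complex"
  assumes \<Omega>: "open \<Omega>" and g: "integrable (lebesgue_on \<Omega>) g"
    and zero: "\<And>\<phi>. \<phi> \<in> test_functions \<Omega> \<Longrightarrow> (LINT x|lebesgue_on \<Omega>. g x * \<phi> x) = 0"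
  shows "AE x in lebesgue_on \<Omega>. g x = 0"
proof -
  have \<Omega>s: "\<Omega> \<in> sets lebesgue" using \<Omega> by auto
  have [measurable]: "g \<in> borel_measurable (lebesgue_on \<Omega>)" using g by auto
  have box0: "(LINT x|lebesgue_on \<Omega>. indicator (box a b) x *\<^sub>R g x) = 0" if "cbox a b \<subseteq> \<Omega>" for a b
  proof -
    have "(\<lambda>n. LINT x|lebesgue_on \<Omega>. g x * of_real (bump a b n x)) \<longlonglongrightarrow>
        (LINT x|lebesgue_on \<Omega>. g x * of_real (indicator (box a b) x))"
    proof (rule integral_dominated_convergence)
      show "integrable (lebesgue_on \<Omega>) (\<lambda>x. norm (g x))" using g by simp
      have "continuous_on UNIV (\<lambda>x. complex_of_real (bump a b n x))" for n
        using bump_test_function[OF that, of n] smooth_continuous unfolding test_functions_def by blast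
      then have "(\<lambda>x. complex_of_real (bump a b n x)) \<in> borel_measurable (lebesgue_on \<Omega>)" for n
        using \<Omega>s by (intro continuous_imp_measurable_on_sets_lebesgue) (auto intro: continuous_on_subset)
      then show "(\<lambda>x. g x * complex_of_real (bump a b n x)) \<in> borel_measurable (lebesgue_on \<Omega>)" for n
        by auto
      have "(\<lambda>x. complex_of_real (indicator (box a b) x)) \<in> borel_measurable lborel" by auto
      then have "(\<lambda>x. complex_of_real (indicator (box a b) x)) \<in> borel_measurable (lebesgue_on \<Omega>)"
        by (intro measurable_restrict_space1 measurable_completion)
      then show "(\<lambda>x. g x * complex_of_real (indicator (box a b) x)) \<in> borel_measurable (lebesgue_on \<Omega>)"
        by auto
      show "AE x in lebesgue_on \<Omega>. (\<lambda>n. g x * complex_of_real (bump a b n x)) \<longlonglongrightarrow> g x * complex_of_real (indicator (box a b) x)"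
        by (intro AE_I2 tendsto_intros bump_tendsto)
      show "AE x in lebesgue_on \<Omega>. norm (g x * complex_of_real (bump a b n x)) \<le> norm (g x)" for n
        using bump_bound[of a b n] by (intro AE_I2) (auto simp: norm_mult intro!: mult_left_le)
    qed
    moreover have "(LINT x|lebesgue_on \<Omega>. g x * of_real (bump a b n x)) = 0" for n
      by (rule zero[OF bump_test_function[OF that]])
    ultimately have "(LINT x|lebesgue_on \<Omega>. g x * of_real (indicator (box a b) x)) = 0"
      by (simp add: LIMSEQ_const_iff)
    then show ?thesis by (simp add: scaleR_conv_of_real mult.commute)
  qed
  have gl: "integrable lebesgue (\<lambda>x. indicator \<Omega> x *\<^sub>R g x)"
    using g integrable_restrict_space[of \<Omega> lebesgue g] \<Omega>s by simp
  have K: "AE x in lebesgue. x \<in> box c d \<longrightarrow> g x = 0" if K: "cbox c d \<subseteq> \<Omega>" for c d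
  proof -
    have int: "integrable lebesgue (\<lambda>x. indicator (box c d) x *\<^sub>R (indicator \<Omega> x *\<^sub>R g x))"
      by (rule integrable_mult_indicator[OF _ gl]) auto
    have z: "(LINT x|lebesgue. indicator (box a b) x *\<^sub>R (indicator (box c d) x *\<^sub>R (indicator \<Omega> x *\<^sub>R g x))) = 0" for a b
    proof -
      obtain a' b' where ab: "box a b \<inter> box c d = box a' b'" "cbox a' b' \<subseteq> \<Omega>"
      proof (cases "box a b \<inter> box c d = {}")
        \<comment> \<open>An open box can be empty while the closed box with the same corners is
          not. The empty intersection therefore gets corners for which both are empty.\<close>
        case True
        obtain i :: 'a where "i \<in> Basis" using nonempty_Basis by blast
        then have "cbox One (0::'a) = {}" "box One (0::'a) = {}"
          by (auto simp: box_eq_empty intro!: bexI[of _ i])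
        then show ?thesis using that[of One 0] True by simp
      next
        case False
        obtain a' b' where "box a b \<inter> box c d = box a' b'" using box_Int_box by blast
        moreover from this False have "cbox a' b' \<subseteq> cbox c d"
          using closure_box[of a' b'] closure_mono[of "box a' b'" "box c d"] closure_minimal[OF box_subset_cbox closed_cbox, of c d]
          by (metis Int_lower2 order_trans)
        ultimately show ?thesis using that K by blast
      qed
      have "(LINT x|lebesgue. indicator (box a b) x *\<^sub>R (indicator (box c d) x *\<^sub>R (indicator \<Omega> x *\<^sub>R g x)))
          = (LINT x|lebesgue. indicator \<Omega> x *\<^sub>R (indicator (box a' b') x *\<^sub>R g x))"
        unfolding ab(1)[symmetric] by (intro Bochner_Integration.integral_cong refl) (auto simp: indicator_def)
      also have "\<dots> = (LINT x|lebesgue_on \<Omega>. indicator (box a' b') x *\<^sub>R g x)"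
        using \<Omega>s by (simp add: integral_restrict_space)
      finally show ?thesis using box0[OF ab(2)] by simp
    qed
    have sub: "x \<in> \<Omega>" if "x \<in> box c d" for x using K box_subset_cbox that by blast
    have "AE x in lebesgue. indicator (box c d) x *\<^sub>R (indicator \<Omega> x *\<^sub>R g x) = 0"
      by (rule AE_zero_if_box_integrals_zero_complex[OF int z])
    then show ?thesis
      by eventually_elim (auto simp: sub)
  qed
  have "\<exists>\<D>. countable \<D> \<and> \<Union>\<D> = \<Omega> \<and> (\<forall>X\<in>\<D>. \<exists>a b. X = box a b \<and> cbox a b \<subseteq> \<Omega>)"
  proof -
    have "\<exists>a b. x \<in> box a b \<and> cbox a b \<subseteq> \<Omega>" if "x \<in> \<Omega>" for x
      using open_contains_cbox[OF \<Omega> that] by metis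
    then obtain A B where AB: "\<And>x. x \<in> \<Omega> \<Longrightarrow> x \<in> box (A x) (B x) \<and> cbox (A x) (B x) \<subseteq> \<Omega>"
      by metis
    obtain F where F: "F \<subseteq> (\<lambda>x. box (A x) (B x)) ` \<Omega>" "countable F" "\<Union>F = \<Union>((\<lambda>x. box (A x) (B x)) ` \<Omega>)"
      using Lindelof[of "(\<lambda>x. box (A x) (B x)) ` \<Omega>"] by (metis (no_types, lifting) imageE open_box)
    have "\<Union>F = \<Omega>" unfolding F(3)
    proof
      show "\<Union>((\<lambda>x. box (A x) (B x)) ` \<Omega>) \<subseteq> \<Omega>"
        using AB box_subset_cbox by (meson UN_least order_trans)
    qed (use AB in auto)
    moreover have "\<exists>a b. X = box a b \<and> cbox a b \<subseteq> \<Omega>" if "X \<in> F" for X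
    proof -
      obtain x where "x \<in> \<Omega>" "X = box (A x) (B x)" using F(1) \<open>X \<in> F\<close> by auto
      then show ?thesis using AB by auto
    qed
    ultimately show ?thesis using F(2) by auto
  qed
  then obtain F where F: "countable F" "\<Union>F = \<Omega>" "\<forall>X\<in>F. \<exists>a b. X = box a b \<and> cbox a b \<subseteq> \<Omega>"
    by (elim exE conjE)
  have "AE x in lebesgue. \<forall>X\<in>F. x \<in> X \<longrightarrow> g x = 0"
    unfolding AE_ball_countable[OF F(1)]
  proof
    fix X assume "X \<in> F"
    then obtain a b where "X = box a b" "cbox a b \<subseteq> \<Omega>" using bspec[OF F(3) \<open>X \<in> F\<close>] by (elim exE conjE)
    then show "AE x in lebesgue. x \<in> X \<longrightarrow> g x = 0" using K by simp
  qed
  then have "AE x in lebesgue. x \<in> \<Omega> \<longrightarrow> g x = 0"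
    by (rule AE_mp) (use F(2) in \<open>auto intro!: AE_I2\<close>)
  then show ?thesis using \<Omega>s by (simp add: AE_restrict_space_iff)
qed

section \<open>Integration by parts\<close>

lemma continuous_compact_support_bounded:
  fixes f :: "'a::euclidean_space \<Rightarrow> complex"
  assumes "continuous_on UNIV f" "compact K" "\<And>x. x \<notin> K \<Longrightarrow> f x = 0"
  obtains M where "M \<ge> 0" "\<And>x. cmod (f x) \<le> M"
proof -
  have "bounded (f ` K)"
    using assms(1,2) by (intro compact_imp_bounded compact_continuous_image) (auto intro: continuous_on_subset)
  then obtain M where "\<And>x. x \<in> K \<Longrightarrow> cmod (f x) \<le> M" by (auto simp: bounded_iff)
  then have "cmod (f x) \<le> max 0 M" for x
    using assms(3)[of x] by (cases "x \<in> K") (auto simp: le_max_iff_disj)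
  then show ?thesis using that[of "max 0 M"] by simp
qed

lemma integral_translate:
  fixes f :: "'a::euclidean_space \<Rightarrow> complex"
  assumes "f \<in> borel_measurable borel"
  shows "(LINT x|lborel. f (x + c)) = (LINT x|lborel. f x)"
  using integral_distr[of "(+) c" lborel borel f] assms by (simp add: lborel_distr_plus add.commute)

text \<open>Translation invariance gives integral zero for the difference quotients, which converge
  dominatedly.\<close>

lemma integral_partial_eq_zero:
  fixes f :: "'a::euclidean_space \<Rightarrow> complex"
  assumes d: "\<And>x. f differentiable (at x)" and c: "continuous_on UNIV (partial j f)"
    and j: "j \<in> Basis" and K: "compact K" and f0: "\<And>x. x \<notin> K \<Longrightarrow> f x = 0"
  shows "(LINT x|lborel. partial j f x) = 0"
proof -
  have D: "(f has_derivative frechet_derivative f (at x)) (at x)" for x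
    using d frechet_derivative_works by blast
  have cf: "continuous_on UNIV f"
    using d by (auto intro!: differentiable_imp_continuous_on simp: differentiable_on_def intro: differentiable_at_withinI)
  have [measurable]: "f \<in> borel_measurable borel" "partial j f \<in> borel_measurable borel"
    using cf c by (auto intro: borel_measurable_continuous_onI)
  have p0: "partial j f x = 0" if "x \<notin> K" for x
  proof -
    have "((\<lambda>x. 0) has_derivative (\<lambda>h. 0)) (at x)" by simp
    then have "(f has_derivative (\<lambda>h. 0)) (at x)"
      by (rule has_derivative_transform_within_open[of _ _ _ _ "- K"])
         (use that f0 K in \<open>auto simp: open_Compl compact_imp_closed\<close>)
    then show ?thesis using frechet_derivative_at by metis
  qed
  obtain M where M: "M \<ge> 0" "\<And>x. cmod (partial j f x) \<le> M"
    using continuous_compact_support_bounded[OF c K p0] by blast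
  obtain M' where M': "M' \<ge> 0" "\<And>x. cmod (f x) \<le> M'"
    using continuous_compact_support_bounded[OF cf K f0] by blast
  obtain R where R: "\<And>x. x \<in> K \<Longrightarrow> norm x \<le> R"
    using compact_imp_bounded[OF K] by (auto simp: bounded_iff)
  have intf: "integrable lborel f"
  proof (rule Bochner_Integration.integrable_bound)
    show "integrable lborel (\<lambda>x. M' * indicator (cball 0 R) x :: real)"
      by (intro integrable_mult_right integrable_real_indicator emeasure_bounded_finite) auto
    show "AE x in lborel. norm (f x) \<le> norm (M' * indicator (cball 0 R) x :: real)"
      using M' f0 R by (intro AE_I2) (fastforce simp: indicator_def)
  qed simp
  define q where "q n x = of_nat (Suc n) * (f (x + (1 / real (Suc n)) *\<^sub>R j) - f x)" for n x
  have [measurable]: "q n \<in> borel_measurable borel" for n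
    unfolding q_def by measurable
  have intt: "integrable lborel (\<lambda>x. f (x + c))" for c
    using integrable_distr_eq[of "(+) c" lborel borel f] intf by (simp add: lborel_distr_plus add.commute)
  have "(LINT x|lborel. q n x) = 0" for n
    unfolding q_def using intf intt by (simp add: integral_translate)
  moreover have "(\<lambda>n. LINT x|lborel. q n x) \<longlonglongrightarrow> (LINT x|lborel. partial j f x)"
  proof (rule integral_dominated_convergence)
    \<comment> \<open>Shifts have length at most 1, so all difference quotients vanish outside the
      ball of radius R + 1; inside, the mean value inequality bounds them by M.\<close>
    show "integrable lborel (\<lambda>x. M * indicator (cball 0 (R + 1)) x :: real)"
      by (intro integrable_mult_right integrable_real_indicator emeasure_bounded_finite) auto
    show "AE x in lborel. (\<lambda>n. q n x) \<longlonglongrightarrow> partial j f x"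
    proof (rule AE_I2)
      fix x
      define y where "y n = x + (1 / real (Suc n)) *\<^sub>R j" for n
      have "y \<longlonglongrightarrow> x + 0 *\<^sub>R j"
        unfolding y_def by (intro tendsto_intros LIMSEQ_Suc[OF lim_1_over_n])
      then have "filterlim y (at x) sequentially"
        using j by (auto simp: filterlim_at y_def)
      moreover have "((\<lambda>y. (1 / norm (y - x)) *\<^sub>R (f y - (f x + frechet_derivative f (at x) (y - x)))) \<longlongrightarrow> 0) (at x)"
        using D[of x] unfolding has_derivative_within by blast
      ultimately have "(\<lambda>n. (1 / norm (y n - x)) *\<^sub>R (f (y n) - (f x + frechet_derivative f (at x) (y n - x)))) \<longlonglongrightarrow> 0"
        by (rule filterlim_compose[rotated])
      moreover have "(1 / norm (y n - x)) *\<^sub>R (f (y n) - (f x + frechet_derivative f (at x) (y n - x))) = q n x - partial j f x" for n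
      proof -
        have "frechet_derivative f (at x) (y n - x) = (1 / real (Suc n)) *\<^sub>R partial j f x"
          using linear_frechet_derivative[OF d[of x]] by (simp add: y_def linear_scale)
        moreover have "1 / norm (y n - x) = real (Suc n)"
          using j by (simp add: y_def)
        ultimately show ?thesis
          by (simp add: q_def y_def scaleR_conv_of_real field_simps del: of_nat_Suc)
      qed
      ultimately show "(\<lambda>n. q n x) \<longlonglongrightarrow> partial j f x"
        by (simp add: LIM_zero_iff)
    qed
    show "AE x in lborel. norm (q n x) \<le> M * indicator (cball 0 (R + 1)) x" for n
    proof (rule AE_I2)
      fix x
      define t where "t = 1 / real (Suc n)"
      have t: "t > 0" "t \<le> 1" "real (Suc n) * t = 1" by (auto simp: t_def)
      show "norm (q n x) \<le> M * indicator (cball 0 (R + 1)) x"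
      proof (cases "x \<in> cball 0 (R + 1)")
        case True
        have der: "((\<lambda>s. f (x + s *\<^sub>R j)) has_derivative (\<lambda>h. frechet_derivative f (at (x + s *\<^sub>R j)) (h *\<^sub>R j))) (at s)" for s
          by (rule has_derivative_compose[OF _ D, where f = "\<lambda>s. x + s *\<^sub>R j"]) (auto intro!: derivative_eq_intros)
        have "\<exists>s\<in>{0<..<t}. norm (f (x + t *\<^sub>R j) - f (x + 0 *\<^sub>R j)) \<le> norm (frechet_derivative f (at (x + s *\<^sub>R j)) ((t - 0) *\<^sub>R j))"
        proof (rule mvt_general[OF t(1)])
          show "continuous_on {0..t} (\<lambda>s. f (x + s *\<^sub>R j))"
            using der by (auto intro!: continuous_at_imp_continuous_on has_derivative_continuous)
        qed (rule der)
        then obtain s where "norm (f (x + t *\<^sub>R j) - f x) \<le> norm (frechet_derivative f (at (x + s *\<^sub>R j)) (t *\<^sub>R j))"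
          by auto
        also have "\<dots> = t * norm (partial j f (x + s *\<^sub>R j))"
          using linear_frechet_derivative[OF d[of "x + s *\<^sub>R j"]] t by (simp add: linear_scale)
        also have "\<dots> \<le> t * M" using M t by (intro mult_left_mono) auto
        finally have "norm (f (x + t *\<^sub>R j) - f x) \<le> t * M" .
        then have "real (Suc n) * norm (f (x + t *\<^sub>R j) - f x) \<le> real (Suc n) * (t * M)"
          by (intro mult_left_mono) auto
        also have "\<dots> = M" using t(3) by (simp only: mult.assoc[symmetric] mult_1_left)
        finally show ?thesis using True
          by (simp add: q_def norm_mult t_def del: of_nat_Suc)
      next
        case False
        have "x \<notin> K" using R[of x] False by auto
        moreover have "x + t *\<^sub>R j \<notin> K"
        proof
          assume "x + t *\<^sub>R j \<in> K"
          then have "norm (x + t *\<^sub>R j) \<le> R" using R by blast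
          moreover have "norm x \<le> norm (x + t *\<^sub>R j) + norm (t *\<^sub>R j)"
            using norm_triangle_ineq4[of "x + t *\<^sub>R j" "t *\<^sub>R j"] by simp
          ultimately show False using False t j by simp
        qed
        ultimately show ?thesis using f0 M(1) by (simp add: q_def t_def)
      qed
    qed
  qed simp_all
  ultimately show ?thesis by (simp add: LIMSEQ_const_iff)
qed

lemma integral_lebesgue_on_eq_lborel:
  fixes F :: "'a::euclidean_space \<Rightarrow> complex"
  assumes "continuous_on UNIV F" "\<Omega> \<in> sets lebesgue" "\<And>x. x \<notin> \<Omega> \<Longrightarrow> F x = 0"
  shows "(LINT x|lebesgue_on \<Omega>. F x) = (LINT x|lborel. F x)"
proof -
  have "(LINT x|lebesgue_on \<Omega>. F x) = (LINT x|lebesgue. indicator \<Omega> x *\<^sub>R F x)"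
    using assms(2) by (simp add: integral_restrict_space)
  also have "\<dots> = (LINT x|lebesgue. F x)"
    using assms(3) by (intro Bochner_Integration.integral_cong) (auto simp: indicator_def)
  also have "\<dots> = (LINT x|lborel. F x)"
    using assms(1) by (intro integral_completion) (simp add: borel_measurable_continuous_onI)
  finally show ?thesis .
qed

section \<open>Weak derivatives on bounded open sets\<close>

locale bounded_open =
  fixes \<Omega> :: "'a::euclidean_space set"
  assumes open_\<Omega>: "open \<Omega>" and bounded_\<Omega>: "bounded \<Omega>"
begin

abbreviation "\<L> \<equiv> lebesgue_on \<Omega>"
abbreviation "\<Delta> \<equiv> laplacian \<Omega>"
abbreviation "wd \<equiv> weak_partial \<Omega>"

lemma sets_\<Omega>: "\<Omega> \<in> sets lebesgue"
  using open_\<Omega> by auto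

sublocale finite_measure \<L>
  by (intro finite_measure_lebesgue_on lmeasurable_open open_\<Omega> bounded_\<Omega>)

lemma continuous_measurable:
  fixes f :: "'a \<Rightarrow> complex"
  assumes "continuous_on UNIV f" shows "f \<in> borel_measurable \<L>"
  using assms sets_\<Omega> by (intro continuous_imp_measurable_on_sets_lebesgue) (auto intro: continuous_on_subset)

lemma continuous_L2:
  fixes f :: "'a \<Rightarrow> complex"
  assumes "continuous_on UNIV f" shows "f \<in> L2 \<L>"
proof -
  have "compact (f ` closure \<Omega>)"
    using assms bounded_\<Omega> by (intro compact_continuous_image) (auto intro: continuous_on_subset)
  then obtain M where M: "\<And>x. x \<in> closure \<Omega> \<Longrightarrow> cmod (f x) \<le> M"
    using compact_imp_bounded by (fastforce simp: bounded_iff)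
  show ?thesis
  proof (rule L2_bound[OF continuous_measurable[OF assms]])
    show "integrable \<L> (\<lambda>x. M\<^sup>2)" by simp
    show "AE x in \<L>. (cmod (f x))\<^sup>2 \<le> M\<^sup>2"
      using M closure_subset[of \<Omega>] by (intro AE_I2) (auto intro!: power_mono)
  qed
qed

lemma test_continuous: "\<phi> \<in> test_functions \<Omega> \<Longrightarrow> continuous_on UNIV \<phi>"
  by (simp add: test_functions_def smooth_continuous)

lemma test_L2: "\<phi> \<in> test_functions \<Omega> \<Longrightarrow> \<phi> \<in> L2 \<L>"
  by (intro continuous_L2 test_continuous)

lemma lap_test_L2: "\<phi> \<in> test_functions \<Omega> \<Longrightarrow> (\<lambda>x. \<Sum>j\<in>Basis. partial j (partial j \<phi>) x) \<in> L2 \<L>"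
  by (intro continuous_L2 continuous_on_sum test_continuous test_functions_partial)

lemma AE_eq_if_test_integrals_eq:
  assumes f: "f \<in> L2 \<L>" and g: "g \<in> L2 \<L>"
    and eq: "\<And>\<phi>. \<phi> \<in> test_functions \<Omega> \<Longrightarrow> (LINT x|\<L>. f x * \<phi> x) = (LINT x|\<L>. g x * \<phi> x)"
  shows "AE x in \<L>. f x = g x"
proof -
  have "AE x in \<L>. f x - g x = 0"
  proof (rule fundamental_lemma[OF open_\<Omega>])
    show "integrable \<L> (\<lambda>x. f x - g x)" by (rule L1_le_L2(1)[OF L2_diff[OF f g]])
    fix \<phi> assume \<phi>: "\<phi> \<in> test_functions \<Omega>"
    show "(LINT x|\<L>. (f x - g x) * \<phi> x) = 0"
      using L2_mult_integrable[OF f test_L2[OF \<phi>]] L2_mult_integrable[OF g test_L2[OF \<phi>]] eq[OF \<phi>]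
      by (simp add: left_diff_distrib)
  qed
  then show ?thesis by eventually_elim simp
qed

text \<open>This makes the choice in \<open>weak_partial\<close> harmless: any other weak derivative
  may replace the chosen one up to a null set, and all calculus rules for \<open>wd\<close> are
  derived in this way.\<close>

lemma has_weak_partial_unique:
  assumes "has_weak_partial \<Omega> j u f" "has_weak_partial \<Omega> j u g"
  shows "AE x in \<L>. f x = g x"
proof (rule AE_eq_if_test_integrals_eq)
  fix \<phi> assume "\<phi> \<in> test_functions \<Omega>"
  then have "- (LINT x|\<L>. f x * \<phi> x) = - (LINT x|\<L>. g x * \<phi> x)"
    using assms unfolding has_weak_partial_def by metis
  then show "(LINT x|\<L>. f x * \<phi> x) = (LINT x|\<L>. g x * \<phi> x)" by simp
qed (use assms in \<open>auto simp: has_weak_partial_def\<close>)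

lemma has_distr_laplacian_unique:
  assumes "has_distr_laplacian \<Omega> u f" "has_distr_laplacian \<Omega> u g"
  shows "AE x in \<L>. f x = g x"
  by (rule AE_eq_if_test_integrals_eq) (use assms in \<open>auto simp: has_distr_laplacian_def\<close>)

lemma weak_partial_works: "u \<in> H1 \<Omega> \<Longrightarrow> j \<in> Basis \<Longrightarrow> has_weak_partial \<Omega> j u (wd j u)"
  unfolding weak_partial_def H1_def by (simp add: someI_ex)

lemma weak_partial_L2: "u \<in> H1 \<Omega> \<Longrightarrow> j \<in> Basis \<Longrightarrow> wd j u \<in> L2 \<L>"
  using weak_partial_works by (auto simp: has_weak_partial_def)

lemma weak_partial_eq: "has_weak_partial \<Omega> j u g \<Longrightarrow> AE x in \<L>. wd j u x = g x"
  unfolding weak_partial_def by (rule has_weak_partial_unique[OF someI[of "has_weak_partial \<Omega> j u"]])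

lemma laplacian_works: "u \<in> H1_Delta \<Omega> \<Longrightarrow> has_distr_laplacian \<Omega> u (\<Delta> u)"
  unfolding laplacian_def H1_Delta_def by (simp add: someI_ex)

lemma laplacian_L2: "u \<in> H1_Delta \<Omega> \<Longrightarrow> \<Delta> u \<in> L2 \<L>"
  using laplacian_works by (auto simp: has_distr_laplacian_def)

lemma laplacian_eq: "has_distr_laplacian \<Omega> u g \<Longrightarrow> AE x in \<L>. \<Delta> u x = g x"
  unfolding laplacian_def by (rule has_distr_laplacian_unique[OF someI[of "has_distr_laplacian \<Omega> u"]])

lemma has_weak_partial_comb:
  assumes u: "u \<in> L2 \<L>" "has_weak_partial \<Omega> j u f" and v: "v \<in> L2 \<L>" "has_weak_partial \<Omega> j v g"
    and j: "j \<in> Basis"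
  shows "has_weak_partial \<Omega> j (\<lambda>x. u x + c * v x) (\<lambda>x. f x + c * g x)"
  unfolding has_weak_partial_def
proof (intro conjI ballI)
  have f: "f \<in> L2 \<L>" and g: "g \<in> L2 \<L>" using u v by (auto simp: has_weak_partial_def)
  then show "(\<lambda>x. f x + c * g x) \<in> L2 \<L>" by (rule L2_comb)
  fix \<phi> assume \<phi>: "\<phi> \<in> test_functions \<Omega>"
  note \<phi>2 = test_L2[OF \<phi>] and \<phi>j = test_L2[OF test_functions_partial[OF \<phi> j]]
  have "(LINT x|\<L>. (u x + c * v x) * partial j \<phi> x) = (LINT x|\<L>. u x * partial j \<phi> x) + c * (LINT x|\<L>. v x * partial j \<phi> x)"
    using L2_mult_integrable[OF u(1) \<phi>j] L2_mult_integrable[OF v(1) \<phi>j] by (simp add: distrib_right mult.assoc)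
  also have "\<dots> = - ((LINT x|\<L>. f x * \<phi> x) + c * (LINT x|\<L>. g x * \<phi> x))"
    using u(2) v(2) \<phi> by (simp add: has_weak_partial_def)
  also have "\<dots> = - (LINT x|\<L>. (f x + c * g x) * \<phi> x)"
    using L2_mult_integrable[OF f \<phi>2] L2_mult_integrable[OF g \<phi>2] by (simp add: distrib_right mult.assoc)
  finally show "(LINT x|\<L>. (u x + c * v x) * partial j \<phi> x) = - (LINT x|\<L>. (f x + c * g x) * \<phi> x)" .
qed

lemma has_distr_laplacian_comb:
  assumes u: "u \<in> L2 \<L>" "has_distr_laplacian \<Omega> u f" and v: "v \<in> L2 \<L>" "has_distr_laplacian \<Omega> v g"
  shows "has_distr_laplacian \<Omega> (\<lambda>x. u x + c * v x) (\<lambda>x. f x + c * g x)"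
  unfolding has_distr_laplacian_def
proof (intro conjI ballI)
  have f: "f \<in> L2 \<L>" and g: "g \<in> L2 \<L>" using u v by (auto simp: has_distr_laplacian_def)
  then show "(\<lambda>x. f x + c * g x) \<in> L2 \<L>" by (rule L2_comb)
  fix \<phi> assume \<phi>: "\<phi> \<in> test_functions \<Omega>"
  let ?D = "\<lambda>x. \<Sum>j\<in>Basis. partial j (partial j \<phi>) x"
  note \<phi>2 = test_L2[OF \<phi>] and \<phi>j = lap_test_L2[OF \<phi>]
  have "(LINT x|\<L>. (u x + c * v x) * ?D x) = (LINT x|\<L>. u x * ?D x) + c * (LINT x|\<L>. v x * ?D x)"
    using L2_mult_integrable[OF u(1) \<phi>j] L2_mult_integrable[OF v(1) \<phi>j] by (simp add: distrib_right mult.assoc)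
  also have "\<dots> = (LINT x|\<L>. f x * \<phi> x) + c * (LINT x|\<L>. g x * \<phi> x)"
    using u(2) v(2) \<phi> by (simp add: has_distr_laplacian_def)
  also have "\<dots> = (LINT x|\<L>. (f x + c * g x) * \<phi> x)"
    using L2_mult_integrable[OF f \<phi>2] L2_mult_integrable[OF g \<phi>2] by (simp add: distrib_right mult.assoc)
  finally show "(LINT x|\<L>. (u x + c * v x) * ?D x) = (LINT x|\<L>. (f x + c * g x) * \<phi> x)" .
qed

text \<open>The product with a test function has compact support in \<Omega>, so the integral of its
  partial derivative over the whole space is zero, and the product rule splits that integral. No
  boundary terms arise.\<close>

lemma smooth_has_weak_partial:
  assumes \<phi>: "smooth \<phi>" and j: "j \<in> Basis"
  shows "has_weak_partial \<Omega> j \<phi> (partial j \<phi>)"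
  unfolding has_weak_partial_def
proof (intro conjI ballI)
  have cp: "continuous_on UNIV \<phi>" "continuous_on UNIV (partial j \<phi>)"
    using \<phi> j by (auto intro: smooth_continuous smooth_partial)
  then show "partial j \<phi> \<in> L2 \<L>" by (intro continuous_L2)
  fix \<psi> assume \<psi>: "\<psi> \<in> test_functions \<Omega>"
  define K where "K = closure {x. \<psi> x \<noteq> 0}"
  have K: "compact K" "K \<subseteq> \<Omega>" using \<psi> by (auto simp: test_functions_def K_def)
  have s: "smooth \<psi>" using \<psi> by (auto simp: test_functions_def)
  have cs: "continuous_on UNIV \<psi>" "continuous_on UNIV (partial j \<psi>)"
    using s j by (auto intro: smooth_continuous smooth_partial)
  have z: "\<psi> x = 0" if "x \<notin> K" for x using that closure_subset[of "{x. \<psi> x \<noteq> 0}"] by (auto simp: K_def)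
  have z': "\<psi> x = 0" if "x \<notin> \<Omega>" for x using that z K by auto
  have eq: "partial j (\<lambda>x. \<phi> x * \<psi> x) = (\<lambda>x. \<phi> x * partial j \<psi> x + partial j \<phi> x * \<psi> x)"
    by (intro ext frechet_derivative_mult_complex smooth_differentiable \<phi> s)
  have "(LINT x|lborel. partial j (\<lambda>x. \<phi> x * \<psi> x) x) = 0"
  proof (rule integral_partial_eq_zero[OF _ _ j K(1)])
    show "continuous_on UNIV (partial j (\<lambda>x. \<phi> x * \<psi> x))"
      unfolding eq using cp cs by (intro continuous_intros)
    show "(\<lambda>x. \<phi> x * \<psi> x) differentiable at x" for x
      using \<phi> s by (intro differentiable_mult smooth_differentiable)
  qed (simp add: z)
  moreover have "(LINT x|\<L>. partial j (\<lambda>x. \<phi> x * \<psi> x) x) = (LINT x|lborel. partial j (\<lambda>x. \<phi> x * \<psi> x) x)"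
  proof (rule integral_lebesgue_on_eq_lborel[OF _ sets_\<Omega>])
    show "continuous_on UNIV (partial j (\<lambda>x. \<phi> x * \<psi> x))"
      unfolding eq using cp cs by (intro continuous_intros)
    fix x assume x: "x \<notin> \<Omega>"
    have "partial j \<psi> x = 0"
      using test_functions_partial[OF \<psi> j] x closure_subset[of "{x. partial j \<psi> x \<noteq> 0}"] by (auto simp: test_functions_def)
    then show "partial j (\<lambda>x. \<phi> x * \<psi> x) x = 0"
      using fun_cong[OF eq, of x] z'[OF x] by simp
  qed
  ultimately have "(LINT x|\<L>. \<phi> x * partial j \<psi> x + partial j \<phi> x * \<psi> x) = 0"
    unfolding eq by simp
  then show "(LINT x|\<L>. \<phi> x * partial j \<psi> x) = - (LINT x|\<L>. partial j \<phi> x * \<psi> x)"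
    using L2_mult_integrable[OF continuous_L2[OF cp(1)] continuous_L2[OF cs(2)]]
      L2_mult_integrable[OF continuous_L2[OF cp(2)] continuous_L2[OF cs(1)]]
    by (simp add: eq_neg_iff_add_eq_0)
qed

lemma H1_L2: "u \<in> H1 \<Omega> \<Longrightarrow> u \<in> L2 \<L>"
  by (simp add: H1_def)

lemma smooth_H1: "smooth \<phi> \<Longrightarrow> \<phi> \<in> H1 \<Omega>"
  unfolding H1_def using smooth_has_weak_partial continuous_L2[OF smooth_continuous] by blast

lemma H1_comb: "u \<in> H1 \<Omega> \<Longrightarrow> v \<in> H1 \<Omega> \<Longrightarrow> (\<lambda>x. u x + c * v x) \<in> H1 \<Omega>"
  unfolding H1_def using has_weak_partial_comb by (fast intro: L2_comb)

lemma H1_diff: "u \<in> H1 \<Omega> \<Longrightarrow> v \<in> H1 \<Omega> \<Longrightarrow> (\<lambda>x. u x - v x) \<in> H1 \<Omega>"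
  using H1_comb[of u v "-1"] by simp

lemma weak_partial_comb:
  assumes "u \<in> H1 \<Omega>" "v \<in> H1 \<Omega>" "j \<in> Basis"
  shows "AE x in \<L>. wd j (\<lambda>x. u x + c * v x) x = wd j u x + c * wd j v x"
  using assms by (intro weak_partial_eq has_weak_partial_comb weak_partial_works H1_L2)

lemma H1_Delta_comb: "u \<in> H1_Delta \<Omega> \<Longrightarrow> v \<in> H1_Delta \<Omega> \<Longrightarrow> (\<lambda>x. u x + c * v x) \<in> H1_Delta \<Omega>"
  unfolding H1_Delta_def using has_distr_laplacian_comb H1_L2 by (fast intro: H1_comb)

lemma laplacian_comb:
  assumes "u \<in> H1_Delta \<Omega>" "v \<in> H1_Delta \<Omega>"
  shows "AE x in \<L>. \<Delta> (\<lambda>x. u x + c * v x) x = \<Delta> u x + c * \<Delta> v x"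
  using assms by (intro laplacian_eq has_distr_laplacian_comb laplacian_works) (auto simp: H1_Delta_def H1_L2)

lemma grad_inner_eq:
  assumes "u \<in> H1 \<Omega>" "v \<in> H1 \<Omega>"
  shows "grad_inner \<Omega> u v = (\<Sum>j\<in>Basis. L2_inner \<L> (wd j u) (wd j v))"
  unfolding grad_inner_def L2_inner_def using assms
  by (intro Bochner_Integration.integral_sum) (auto intro: L2_inner_integrable weak_partial_L2)

lemma grad_inner_linear:
  assumes "u \<in> H1 \<Omega>" "v \<in> H1 \<Omega>" "w \<in> H1 \<Omega>"
  shows "grad_inner \<Omega> (\<lambda>x. u x + c * v x) w = grad_inner \<Omega> u w + c * grad_inner \<Omega> v w"
proof -
  have "L2_inner \<L> (wd j (\<lambda>x. u x + c * v x)) (wd j w) =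
      L2_inner \<L> (wd j u) (wd j w) + c * L2_inner \<L> (wd j v) (wd j w)"
    if j: "j \<in> Basis" for j
  proof -
    note L = weak_partial_L2[OF assms(1) j] weak_partial_L2[OF assms(2) j] weak_partial_L2[OF assms(3) j]
      weak_partial_L2[OF H1_comb[OF assms(1,2), of c] j]
    have "L2_inner \<L> (wd j (\<lambda>x. u x + c * v x)) (wd j w) =
      L2_inner \<L> (\<lambda>x. wd j u x + c * wd j v x) (wd j w)"
      by (rule L2_inner_cong_AE[OF weak_partial_comb[OF assms(1,2) j]])
         (auto intro: L2_measurable L L2_comb)
    then show ?thesis by (simp add: L2_inner_linear L)
  qed
  then show ?thesis using assms
    by (simp add: grad_inner_eq H1_comb sum.distrib sum_distrib_left)
qed

lemma grad_inner_cnj: "grad_inner \<Omega> u v = cnj (grad_inner \<Omega> v u)"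
  unfolding grad_inner_def by (subst Bochner_Integration.integral_cnj[symmetric]) (simp add: mult.commute)

lemma grad_inner_self:
  assumes "u \<in> H1 \<Omega>"
  shows "grad_inner \<Omega> u u = of_real (\<Sum>j\<in>Basis. (L2_norm \<L> (wd j u))\<^sup>2)"
  by (simp add: grad_inner_eq assms L2_inner_self L2_norm_sq)

lemma H1_norm_sq:
  assumes "u \<in> H1 \<Omega>"
  shows "(H1_norm \<Omega> u)\<^sup>2 = (L2_norm \<L> u)\<^sup>2 + (\<Sum>j\<in>Basis. (L2_norm \<L> (wd j u))\<^sup>2)"
  unfolding H1_norm_def grad_inner_self[OF assms] by (simp add: sum_nonneg)

sublocale H1: semi_inner "H1 \<Omega>" "\<lambda>f c g x. f x + c * g x" "\<lambda>u v. L2_inner \<L> u v + grad_inner \<Omega> u v"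
proof
  fix u v w :: "'a \<Rightarrow> complex" and c
  assume u: "u \<in> H1 \<Omega>"
  show "0 \<le> Re (L2_inner \<L> u u + grad_inner \<Omega> u u)"
    using u by (simp add: L2_inner_self grad_inner_self sum_nonneg)
  assume v: "v \<in> H1 \<Omega>"
  show "(\<lambda>x. u x + c * v x) \<in> H1 \<Omega>" by (rule H1_comb[OF u v])
  show "L2_inner \<L> u v + grad_inner \<Omega> u v = cnj (L2_inner \<L> v u + grad_inner \<Omega> v u)"
    using L2_inner_cnj[of \<L> u v] grad_inner_cnj[of u v] by simp
  assume w: "w \<in> H1 \<Omega>"
  show "L2_inner \<L> (\<lambda>x. u x + c * v x) w + grad_inner \<Omega> (\<lambda>x. u x + c * v x) w =
      L2_inner \<L> u w + grad_inner \<Omega> u w + c * (L2_inner \<L> v w + grad_inner \<Omega> v w)"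
    using u v w by (simp add: L2_inner_linear H1_L2 grad_inner_linear algebra_simps)
qed

lemma H1_norm_eq: "H1_norm \<Omega> u = sqrt (Re (L2_inner \<L> u u + grad_inner \<Omega> u u))"
  by (simp add: H1_norm_def L2_inner_self L2_norm_sq)

lemmas H1_triangle = H1.triangle[folded H1_norm_eq]

lemma H1_norm_nonneg: "u \<in> H1 \<Omega> \<Longrightarrow> 0 \<le> H1_norm \<Omega> u"
  unfolding H1_norm_eq using H1.pos by simp

text \<open>Chosen weak derivatives of f and -f are related only almost everywhere, so symmetry is
  obtained from the triangle inequality applied to 0 - (v - u).\<close>

lemma H1_norm_minus_commute:
  assumes "u \<in> H1 \<Omega>" "v \<in> H1 \<Omega>"
  shows "H1_norm \<Omega> (\<lambda>x. u x - v x) = H1_norm \<Omega> (\<lambda>x. v x - u x)"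
proof -
  have "H1_norm \<Omega> (\<lambda>x. u x - v x) \<le> H1_norm \<Omega> (\<lambda>x. v x - u x)" if "u \<in> H1 \<Omega>" "v \<in> H1 \<Omega>" for u v
  proof -
    have z: "(\<lambda>x. 0) \<in> H1 \<Omega>" by (rule smooth_H1[OF smooth_const])
    \<comment> \<open>0 - 0 is the same function as 0, so the expansion \<open>quad\<close> with c =
      -1 reads Q = Q - 2 Q + Q.\<close>
    have "H1_norm \<Omega> (\<lambda>x. 0) = 0" by (simp add: H1_norm_sq[OF z] H1_norm_eq) (use H1.quad[OF z z, of "-1"] in simp)
    then show ?thesis
      using H1_triangle[OF z H1_diff[OF that(2,1)], of "-1"] by simp
  qed
  from this[OF assms] this[OF assms(2,1)] show ?thesis by simp
qed

lemma H1_triangle3: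
  assumes "f \<in> H1 \<Omega>" "g \<in> H1 \<Omega>" "h \<in> H1 \<Omega>"
  shows "H1_norm \<Omega> (\<lambda>x. f x - h x) \<le> H1_norm \<Omega> (\<lambda>x. f x - g x) + H1_norm \<Omega> (\<lambda>x. g x - h x)"
  using H1_triangle[OF H1_diff[OF assms(1,2)] H1_diff[OF assms(2,3)], of 1] by simp

text \<open>Passage from chosen weak derivatives to classical ones, so that pointwise estimates
  along segments can bound \<open>H1_norm\<close>.\<close>

lemma H1_norm_smooth_sq:
  assumes "smooth \<phi>"
  shows "(H1_norm \<Omega> \<phi>)\<^sup>2 = (LINT x|\<L>. (cmod (\<phi> x))\<^sup>2 + (\<Sum>j\<in>Basis. (cmod (partial j \<phi> x))\<^sup>2))"
proof -
  have j2: "partial j \<phi> \<in> L2 \<L>" if "j \<in> Basis" for j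
    using smooth_has_weak_partial[OF assms that] by (simp add: has_weak_partial_def)
  have "L2_norm \<L> (wd j \<phi>) = L2_norm \<L> (partial j \<phi>)" if j: "j \<in> Basis" for j
    by (rule L2_norm_cong_AE[OF weak_partial_eq[OF smooth_has_weak_partial[OF assms j]]])
       (auto intro: L2_measurable weak_partial_L2 smooth_H1 assms j j2)
  moreover have "integrable \<L> (\<lambda>x. (cmod (\<phi> x))\<^sup>2)" "\<And>j. j \<in> Basis \<Longrightarrow> integrable \<L> (\<lambda>x. (cmod (partial j \<phi> x))\<^sup>2)"
    using j2 assms by (auto intro: L2_integrable continuous_L2 smooth_continuous)
  ultimately show ?thesis
    by (simp add: H1_norm_sq[OF smooth_H1[OF assms]] L2_norm_sq)
qed

lemma L2_inner_tendsto:
  assumes u: "\<And>n. u n \<in> L2 \<L>" "u0 \<in> L2 \<L>" "(\<lambda>n. L2_norm \<L> (\<lambda>x. u n x - u0 x)) \<longlonglongrightarrow> 0"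
    and v: "v \<in> L2 \<L>"
  shows "(\<lambda>n. LINT x|\<L>. u n x * v x) \<longlonglongrightarrow> (LINT x|\<L>. u0 x * v x)"
proof -
  have "(\<lambda>n. (LINT x|\<L>. u n x * v x) - (LINT x|\<L>. u0 x * v x)) \<longlonglongrightarrow> 0"
  proof (rule Lim_null_comparison)
    show "(\<lambda>n. L2_norm \<L> (\<lambda>x. u n x - u0 x) * L2_norm \<L> (\<lambda>x. cnj (v x))) \<longlonglongrightarrow> 0"
      using tendsto_mult_right[OF u(3)] by simp
    have "cmod ((LINT x|\<L>. u n x * v x) - (LINT x|\<L>. u0 x * v x)) \<le> L2_norm \<L> (\<lambda>x. u n x - u0 x) * L2_norm \<L> (\<lambda>x. cnj (v x))" for n
      using L2_CS[OF L2_diff[OF u(1)[of n] u(2)] L2_cnj[OF v]] L2_mult_integrable[OF u(1)[of n] v] L2_mult_integrable[OF u(2) v]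
      by (simp add: L2_inner_def left_diff_distrib)
    then show "\<forall>\<^sub>F n in sequentially. norm ((LINT x|\<L>. u n x * v x) - (LINT x|\<L>. u0 x * v x)) \<le> L2_norm \<L> (\<lambda>x. u n x - u0 x) * L2_norm \<L> (\<lambda>x. cnj (v x))"
      by simp
  qed
  then show ?thesis by (simp add: LIM_zero_iff)
qed

text \<open>Pairing with a fixed test function is continuous in L2, so the defining identity
  survives the limit on both sides.\<close>

lemma has_weak_partial_closed:
  assumes u: "\<And>n. u n \<in> L2 \<L>" "u0 \<in> L2 \<L>" "(\<lambda>n. L2_norm \<L> (\<lambda>x. u n x - u0 x)) \<longlonglongrightarrow> 0"
    and g: "g0 \<in> L2 \<L>" "(\<lambda>n. L2_norm \<L> (\<lambda>x. g n x - g0 x)) \<longlonglongrightarrow> 0"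
    and ug: "\<And>n. has_weak_partial \<Omega> j (u n) (g n)" and j: "j \<in> Basis"
  shows "has_weak_partial \<Omega> j u0 g0"
  unfolding has_weak_partial_def
proof (intro conjI ballI g(1))
  fix \<phi> assume \<phi>: "\<phi> \<in> test_functions \<Omega>"
  have gn: "g n \<in> L2 \<L>" for n using ug by (simp add: has_weak_partial_def)
  have "(\<lambda>n. LINT x|\<L>. u n x * partial j \<phi> x) \<longlonglongrightarrow> (LINT x|\<L>. u0 x * partial j \<phi> x)"
    by (rule L2_inner_tendsto[OF u test_L2[OF test_functions_partial[OF \<phi> j]]])
  moreover have "(\<lambda>n. - (LINT x|\<L>. g n x * \<phi> x)) \<longlonglongrightarrow> - (LINT x|\<L>. g0 x * \<phi> x)"
    by (intro tendsto_minus L2_inner_tendsto[OF gn g test_L2[OF \<phi>]])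
  moreover have "(LINT x|\<L>. u n x * partial j \<phi> x) = - (LINT x|\<L>. g n x * \<phi> x)" for n
    using ug \<phi> by (simp add: has_weak_partial_def)
  ultimately show "(LINT x|\<L>. u0 x * partial j \<phi> x) = - (LINT x|\<L>. g0 x * \<phi> x)"
    using LIMSEQ_unique by simp
qed

lemma has_distr_laplacian_closed:
  assumes u: "\<And>n. u n \<in> L2 \<L>" "u0 \<in> L2 \<L>" "(\<lambda>n. L2_norm \<L> (\<lambda>x. u n x - u0 x)) \<longlonglongrightarrow> 0"
    and g: "g0 \<in> L2 \<L>" "(\<lambda>n. L2_norm \<L> (\<lambda>x. g n x - g0 x)) \<longlonglongrightarrow> 0"
    and ug: "\<And>n. has_distr_laplacian \<Omega> (u n) (g n)"
  shows "has_distr_laplacian \<Omega> u0 g0"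
  unfolding has_distr_laplacian_def
proof (intro conjI ballI g(1))
  fix \<phi> assume \<phi>: "\<phi> \<in> test_functions \<Omega>"
  let ?D = "\<lambda>x. \<Sum>j\<in>Basis. partial j (partial j \<phi>) x"
  have gn: "g n \<in> L2 \<L>" for n using ug by (simp add: has_distr_laplacian_def)
  have "(\<lambda>n. LINT x|\<L>. u n x * ?D x) \<longlonglongrightarrow> (LINT x|\<L>. u0 x * ?D x)"
    by (rule L2_inner_tendsto[OF u lap_test_L2[OF \<phi>]])
  moreover have "(\<lambda>n. LINT x|\<L>. g n x * \<phi> x) \<longlonglongrightarrow> (LINT x|\<L>. g0 x * \<phi> x)"
    by (rule L2_inner_tendsto[OF gn g test_L2[OF \<phi>]])
  moreover have "(LINT x|\<L>. u n x * ?D x) = (LINT x|\<L>. g n x * \<phi> x)" for n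
    using ug \<phi> by (simp add: has_distr_laplacian_def)
  ultimately show "(LINT x|\<L>. u0 x * ?D x) = (LINT x|\<L>. g0 x * \<phi> x)"
    using LIMSEQ_unique by simp
qed

end

section \<open>Estimates along line segments\<close>

definition gradsq :: "('a::euclidean_space \<Rightarrow> complex) \<Rightarrow> 'a \<Rightarrow> real" where
  "gradsq \<phi> x = (\<Sum>j\<in>Basis. (cmod (partial j \<phi> x))\<^sup>2)"

lemma gradsq_nonneg: "0 \<le> gradsq \<phi> x"
  by (simp add: gradsq_def sum_nonneg)

lemma gradsq_continuous: "smooth \<phi> \<Longrightarrow> continuous_on A (gradsq \<phi>)"
  unfolding gradsq_def by (intro continuous_intros smooth_continuous smooth_partial)

lemma frechet_derivative_eq_sum_partial:
  assumes "smooth \<phi>"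
  shows "frechet_derivative \<phi> (at x) v = (\<Sum>j\<in>Basis. (v \<bullet> j) *\<^sub>R partial j \<phi> x)"
proof -
  have "frechet_derivative \<phi> (at x) v = frechet_derivative \<phi> (at x) (\<Sum>j\<in>Basis. (v \<bullet> j) *\<^sub>R j)"
    by (simp add: euclidean_representation)
  then show ?thesis
    using linear_frechet_derivative[OF smooth_differentiable[OF assms, of x]] by (simp add: linear_sum linear_scale)
qed

lemma directional_derivative_bound:
  assumes "smooth \<phi>"
  shows "(cmod (frechet_derivative \<phi> (at x) v))\<^sup>2 \<le> (norm v)\<^sup>2 * gradsq \<phi> x"
proof -
  have "cmod (frechet_derivative \<phi> (at x) v) \<le> (\<Sum>j\<in>Basis. \<bar>v \<bullet> j\<bar> * cmod (partial j \<phi> x))"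
    unfolding frechet_derivative_eq_sum_partial[OF assms, of x v] by (auto intro: sum_norm_le)
  then have "(cmod (frechet_derivative \<phi> (at x) v))\<^sup>2 \<le> (\<Sum>j\<in>Basis. \<bar>v \<bullet> j\<bar> * cmod (partial j \<phi> x))\<^sup>2"
    by (intro power_mono) auto
  also have "\<dots> \<le> (\<Sum>j\<in>Basis. \<bar>v \<bullet> j\<bar>\<^sup>2) * gradsq \<phi> x"
    unfolding gradsq_def by (rule Cauchy_Schwarz_ineq_sum)
  also have "(\<Sum>j\<in>Basis. \<bar>v \<bullet> j\<bar>\<^sup>2) = (norm v)\<^sup>2"
    unfolding power2_norm_eq_inner by (subst euclidean_inner) (simp add: power2_eq_square)
  finally show ?thesis .
qed

lemma segment_derivative:
  assumes "smooth \<phi>"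
  shows "((\<lambda>t. \<phi> (x + t *\<^sub>R v)) has_vector_derivative frechet_derivative \<phi> (at (x + t *\<^sub>R v)) v) (at t within A)"
proof -
  have D: "(\<phi> has_derivative frechet_derivative \<phi> (at y)) (at y)" for y
    using assms smooth_differentiable frechet_derivative_works by blast
  have "((\<lambda>s. \<phi> (x + s *\<^sub>R v)) has_derivative (\<lambda>h. frechet_derivative \<phi> (at (x + t *\<^sub>R v)) (h *\<^sub>R v))) (at t within A)"
    by (rule has_derivative_compose[OF _ D, where f = "\<lambda>s. x + s *\<^sub>R v"]) (auto intro!: derivative_eq_intros)
  moreover have "(\<lambda>h. frechet_derivative \<phi> (at (x + t *\<^sub>R v)) (h *\<^sub>R v)) = (\<lambda>h. h *\<^sub>R frechet_derivative \<phi> (at (x + t *\<^sub>R v)) v)"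
    using linear_frechet_derivative[OF smooth_differentiable[OF assms, of "x + t *\<^sub>R v"]] by (auto simp: linear_scale)
  ultimately show ?thesis by (simp add: has_vector_derivative_def)
qed

text \<open>Expansion of the nonnegative integral of (f - m)^2, where m is the mean of f over the
  interval.\<close>

lemma square_integral_le:
  fixes f :: "real \<Rightarrow> real"
  assumes "T > 0" "continuous_on {0..T} f"
  shows "(integral {0..T} f)\<^sup>2 \<le> T * integral {0..T} (\<lambda>t. (f t)\<^sup>2)"
proof -
  define m where "m = integral {0..T} f / T"
  have i: "f integrable_on {0..T}" "(\<lambda>t. (f t)\<^sup>2) integrable_on {0..T}"
    using assms by (auto intro!: integrable_continuous_interval continuous_intros)
  have "0 \<le> integral {0..T} (\<lambda>t. (f t - m)\<^sup>2)"
    using assms by (intro integral_nonneg integrable_continuous_interval continuous_intros) auto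
  also have "(\<lambda>t. (f t - m)\<^sup>2) = (\<lambda>t. ((f t)\<^sup>2 - 2 * m * f t) + m\<^sup>2)"
    by (auto simp: power2_diff algebra_simps)
  also have "integral {0..T} \<dots> = integral {0..T} (\<lambda>t. (f t)\<^sup>2) - 2 * m * integral {0..T} f + m\<^sup>2 * T"
  proof (rule integral_unique)
    have "((\<lambda>t. m\<^sup>2) has_integral m\<^sup>2 * T) {0..T}"
      using has_integral_const_real[of "m\<^sup>2" 0 T] assms(1) by (simp add: mult.commute)
    then show "((\<lambda>t. ((f t)\<^sup>2 - 2 * m * f t) + m\<^sup>2) has_integral
        (integral {0..T} (\<lambda>t. (f t)\<^sup>2) - 2 * m * integral {0..T} f + m\<^sup>2 * T)) {0..T}"
      using i by (intro has_integral_add has_integral_diff has_integral_mult_right integrable_integral)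
  qed
  also have "\<dots> = integral {0..T} (\<lambda>t. (f t)\<^sup>2) - (integral {0..T} f)\<^sup>2 / T"
    using assms(1) by (simp add: m_def field_simps power2_eq_square)
  finally show ?thesis using assms(1) by (simp add: field_simps)
qed

text \<open>Fundamental theorem of calculus and Cauchy-Schwarz. The integral is extended from t to T
  so that the bound is the same for all t in between.\<close>

lemma segment_bound:
  assumes \<phi>: "smooth \<phi>" and T: "T > 0" and t: "0 \<le> t" "t \<le> T"
  shows "(cmod (\<phi> (x + t *\<^sub>R v) - \<phi> x))\<^sup>2 \<le> T * ((norm v)\<^sup>2 * integral {0..T} (\<lambda>s. gradsq \<phi> (x + s *\<^sub>R v)))"
proof -
  let ?g = "\<lambda>s. frechet_derivative \<phi> (at (x + s *\<^sub>R v)) v"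
  have cg: "continuous_on A ?g" for A
    unfolding frechet_derivative_eq_sum_partial[OF \<phi>, of _ v]
    by (auto intro!: continuous_on_sum continuous_on_scaleR continuous_on_const
        continuous_on_compose2[OF smooth_continuous[OF smooth_partial[OF \<phi>], of _ UNIV]] continuous_intros)
  have cG: "continuous_on A (\<lambda>s. gradsq \<phi> (x + s *\<^sub>R v))" for A
    by (intro continuous_on_compose2[OF gradsq_continuous[OF \<phi>, of UNIV]] continuous_intros) auto
  have "(?g has_integral (\<phi> (x + t *\<^sub>R v) - \<phi> (x + 0 *\<^sub>R v))) {0..t}"
    by (rule fundamental_theorem_of_calculus[OF t(1) segment_derivative[OF \<phi>]])
  then have "\<phi> (x + t *\<^sub>R v) - \<phi> x = integral {0..t} ?g" by (simp add: integral_unique)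
  then have "cmod (\<phi> (x + t *\<^sub>R v) - \<phi> x) \<le> integral {0..t} (\<lambda>s. cmod (?g s))"
    using cg by (auto intro!: Henstock_Kurzweil_Integration.integral_norm_bound_integral integrable_continuous_interval continuous_intros)
  also have "\<dots> \<le> integral {0..T} (\<lambda>s. cmod (?g s))"
    using cg t by (intro integral_subset_le) (auto intro!: integrable_continuous_interval continuous_intros)
  finally have "(cmod (\<phi> (x + t *\<^sub>R v) - \<phi> x))\<^sup>2 \<le> (integral {0..T} (\<lambda>s. cmod (?g s)))\<^sup>2"
    by (intro power_mono) auto
  also have "\<dots> \<le> T * integral {0..T} (\<lambda>s. (cmod (?g s))\<^sup>2)"
    using cg by (intro square_integral_le T continuous_intros)
  also have "\<dots> \<le> T * integral {0..T} (\<lambda>s. (norm v)\<^sup>2 * gradsq \<phi> (x + s *\<^sub>R v))"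
    using T by (intro mult_left_mono integral_le integrable_continuous_interval directional_derivative_bound[OF \<phi>]
        continuous_on_power continuous_on_norm cg continuous_on_mult continuous_on_const cG) auto
  finally show ?thesis by simp
qed

text \<open>The factors 2 come from squaring a sum. T^2 has one factor T from Cauchy-Schwarz on a
  segment of length T and one from averaging over it.\<close>

definition energy :: "real \<Rightarrow> ('a::euclidean_space \<Rightarrow> complex) \<Rightarrow> 'a \<Rightarrow> real" where
  "energy T \<phi> x = 2 * (cmod (\<phi> x))\<^sup>2 + 2 * T\<^sup>2 * gradsq \<phi> x"

lemma energy_nonneg: "0 \<le> energy T \<phi> x"
  by (simp add: energy_def gradsq_nonneg)

lemma energy_continuous: "smooth \<phi> \<Longrightarrow> continuous_on A (energy T \<phi>)"
  unfolding energy_def by (intro continuous_intros smooth_continuous gradsq_continuous)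

lemma energy_borel: "smooth \<phi> \<Longrightarrow> energy T \<phi> \<in> borel_measurable borel"
  by (intro borel_measurable_continuous_onI energy_continuous)

text \<open>A value at x differs from the value at x + t v by an integral of the gradient.
  Integrating this over t replaces the point value by an integral along the segment, which Fubini
  can handle.\<close>

lemma segment_mean_bound:
  assumes \<phi>: "smooth \<phi>" and T: "T > 0" and v: "norm v = 1"
  shows "ennreal (T * (cmod (\<phi> x))\<^sup>2) \<le> (\<integral>\<^sup>+t. ennreal (energy T \<phi> (x + t *\<^sub>R v)) * indicator {0<..<T} t \<partial>lborel)"
proof -
  let ?G = "\<lambda>s. gradsq \<phi> (x + s *\<^sub>R v)"
  have c: "continuous_on A (\<lambda>s. 2 * (cmod (\<phi> (x + s *\<^sub>R v)))\<^sup>2)" "continuous_on A (\<lambda>s. 2 * T\<^sup>2 * ?G s)" for A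
    by (intro continuous_on_mult continuous_on_const continuous_on_power continuous_on_norm
        continuous_on_compose2[OF smooth_continuous[OF \<phi>, of UNIV]]
        continuous_on_compose2[OF gradsq_continuous[OF \<phi>, of UNIV]] continuous_intros; simp)+
  define I where "I = integral {0..T} ?G"
  have le: "(cmod (\<phi> x))\<^sup>2 \<le> 2 * (cmod (\<phi> (x + t *\<^sub>R v)))\<^sup>2 + 2 * (T * I)" if "t \<in> {0..T}" for t
  proof -
    have "(cmod (\<phi> (x + t *\<^sub>R v) + (\<phi> x - \<phi> (x + t *\<^sub>R v))))\<^sup>2 \<le>
        2 * (cmod (\<phi> (x + t *\<^sub>R v)))\<^sup>2 + 2 * (cmod (\<phi> x - \<phi> (x + t *\<^sub>R v)))\<^sup>2"
      by (rule cmod_add_squared_le)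
    then show ?thesis
      using segment_bound[OF \<phi> T, of t x v] v that by (simp add: norm_minus_commute I_def)
  qed
  have "T * (cmod (\<phi> x))\<^sup>2 = integral {0..T} (\<lambda>t. (cmod (\<phi> x))\<^sup>2)"
    using T by simp
  also have "\<dots> \<le> integral {0..T} (\<lambda>t. 2 * (cmod (\<phi> (x + t *\<^sub>R v)))\<^sup>2 + 2 * (T * I))"
    using le by (intro integral_le integrable_continuous_interval c continuous_on_add continuous_on_const) auto
  also have "\<dots> = integral {0..T} (\<lambda>t. 2 * (cmod (\<phi> (x + t *\<^sub>R v)))\<^sup>2) + 2 * T\<^sup>2 * I"
    using T integral_add[OF integrable_continuous_interval[OF c(1), of 0 T] integrable_const_ivl[of "2 * (T * I)"]]
    by (simp add: power2_eq_square)
  also have "2 * T\<^sup>2 * I = integral {0..T} (\<lambda>t. 2 * T\<^sup>2 * ?G t)"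
    by (simp add: I_def)
  also have "integral {0..T} (\<lambda>t. 2 * (cmod (\<phi> (x + t *\<^sub>R v)))\<^sup>2) + integral {0..T} (\<lambda>t. 2 * T\<^sup>2 * ?G t) =
      integral {0..T} (\<lambda>t. energy T \<phi> (x + t *\<^sub>R v))"
    unfolding energy_def
    by (intro integral_add[symmetric] integrable_continuous_interval c)
  finally have main: "T * (cmod (\<phi> x))\<^sup>2 \<le> integral {0..T} (\<lambda>t. energy T \<phi> (x + t *\<^sub>R v))" .
  have "((\<lambda>t. energy T \<phi> (x + t *\<^sub>R v)) has_integral integral {0..T} (\<lambda>t. energy T \<phi> (x + t *\<^sub>R v))) {0<..<T}"
    unfolding has_integral_Icc_iff_Ioo[symmetric]
    by (intro integrable_integral integrable_continuous_interval
        continuous_on_compose2[OF energy_continuous[OF \<phi>, of UNIV]] continuous_intros) auto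
  from nn_integral_has_integral_lebesgue'[OF energy_nonneg this] main show ?thesis
    by (simp add: ennreal_leI)
qed

lemma nn_integral_translate:
  fixes f :: "'a::euclidean_space \<Rightarrow> ennreal"
  assumes "f \<in> borel_measurable borel"
  shows "(\<integral>\<^sup>+x. f (x + c) \<partial>lborel) = (\<integral>\<^sup>+x. f x \<partial>lborel)"
  using nn_integral_distr[of "(+) c" lborel borel f] assms by (simp add: lborel_distr_plus add.commute)

text \<open>For fixed t, the shift by t v preserves Lebesgue measure. Seen from the end point y, the
  weight is then integrated over t only: for indicator weights this is the length of the set of
  parameters for which a segment reaches y.\<close>

lemma nn_integral_shear:
  fixes W :: "'a::euclidean_space \<Rightarrow> real \<Rightarrow> ennreal" and F :: "'a \<Rightarrow> ennreal"
  assumes W[measurable]: "case_prod W \<in> borel_measurable (borel \<Otimes>\<^sub>M borel)" and F[measurable]: "F \<in> borel_measurable borel"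
  shows "(\<integral>\<^sup>+x. \<integral>\<^sup>+t. W x t * F (x + t *\<^sub>R v) \<partial>lborel \<partial>lborel) =
    (\<integral>\<^sup>+y. F y * (\<integral>\<^sup>+t. W (y - t *\<^sub>R v) t \<partial>lborel) \<partial>lborel)"
proof -
  have "(\<integral>\<^sup>+x. \<integral>\<^sup>+t. W x t * F (x + t *\<^sub>R v) \<partial>lborel \<partial>lborel) =
      (\<integral>\<^sup>+t. \<integral>\<^sup>+x. W x t * F (x + t *\<^sub>R v) \<partial>lborel \<partial>lborel)"
    by (rule lborel_pair.Fubini'[symmetric]) measurable
  also have "\<dots> = (\<integral>\<^sup>+t. \<integral>\<^sup>+y. F y * W (y - t *\<^sub>R v) t \<partial>lborel \<partial>lborel)"
  proof (rule nn_integral_cong)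
    fix t
    have "(\<integral>\<^sup>+x. F (x + t *\<^sub>R v) * W ((x + t *\<^sub>R v) - t *\<^sub>R v) t \<partial>lborel) = (\<integral>\<^sup>+y. F y * W (y - t *\<^sub>R v) t \<partial>lborel)"
      by (rule nn_integral_translate) measurable
    then show "(\<integral>\<^sup>+x. W x t * F (x + t *\<^sub>R v) \<partial>lborel) = (\<integral>\<^sup>+y. F y * W (y - t *\<^sub>R v) t \<partial>lborel)"
      by (simp add: mult.commute)
  qed
  also have "\<dots> = (\<integral>\<^sup>+y. \<integral>\<^sup>+t. F y * W (y - t *\<^sub>R v) t \<partial>lborel \<partial>lborel)"
    by (rule lborel_pair.Fubini') measurable
  also have "\<dots> = (\<integral>\<^sup>+y. F y * (\<integral>\<^sup>+t. W (y - t *\<^sub>R v) t \<partial>lborel) \<partial>lborel)"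
    by (intro nn_integral_cong nn_integral_cmult) measurable
  finally show ?thesis .
qed

section \<open>Hausdorff measure on the Borel sets\<close>

lemma sets_hausdorff_measure [simp, measurable_cong]:
  "sets (hausdorff_measure n :: 'a::euclidean_space measure) = sets borel"
  using sets.sigma_sets_eq[of "borel :: 'a measure"] by (simp add: hausdorff_measure_def)

lemma space_hausdorff_measure [simp]: "space (hausdorff_measure n) = UNIV"
  by (simp add: hausdorff_measure_def)

lemma measurable_hausdorff_measure [simp]: "measurable (hausdorff_measure n) N = measurable borel N"
  by (rule measurable_cong_sets) simp_all

section \<open>Charts of a Lipschitz boundary\<close>

text \<open>The double radius ensures that a segment of length R in direction \<nu> starting in
  \<open>ball p R\<close> stays inside U.\<close>

locale lipschitz_chart =
  fixes \<Omega> U :: "'a::euclidean_space set" and \<nu> p :: 'a and h :: "'a \<Rightarrow> real" and L R :: real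
  assumes open_\<Omega>: "open \<Omega>" and open_U: "open U" and \<nu>: "norm \<nu> = 1"
    and lip: "L-lipschitz_on {y. y \<bullet> \<nu> = 0} h"
    and graph: "\<Omega> \<inter> U = {x \<in> U. x \<bullet> \<nu> > h (x - (x \<bullet> \<nu>) *\<^sub>R \<nu>)}"
    and R: "R > 0" and ball_U: "ball p (2 * R) \<subseteq> U"
begin

text \<open>Signed height above the graph, measured in direction \<nu>: positive in \<Omega>, zero
  on the boundary within U, and increasing at unit speed along \<nu>.\<close>

definition s :: "'a \<Rightarrow> real" where "s x = x \<bullet> \<nu> - h (x - (x \<bullet> \<nu>) *\<^sub>R \<nu>)"

text \<open>Foot point on the graph; it is constant along each line in direction \<nu>.\<close>

definition P :: "'a \<Rightarrow> 'a" where "P x = x - s x *\<^sub>R \<nu>"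

lemma \<nu>\<nu>: "\<nu> \<bullet> \<nu> = 1"
  using \<nu> by (simp add: norm_eq_1)

lemma L_nonneg: "0 \<le> L"
  using lip by (rule lipschitz_on_nonneg)

lemma s_shift: "s (x + t *\<^sub>R \<nu>) = s x + t"
  by (simp add: s_def inner_add_left \<nu>\<nu> algebra_simps)

text \<open>1 is contributed by the coordinate along \<nu>; L by h, because the orthogonal
  projection \<open>?q\<close> is a contraction.\<close>

lemma s_lipschitz: "\<bar>s x - s y\<bar> \<le> (1 + L) * norm (x - y)"
proof -
  let ?q = "\<lambda>x. x - (x \<bullet> \<nu>) *\<^sub>R \<nu>"
  have "norm (?q z) \<le> norm z" for z
  proof -
    have "(norm (?q z))\<^sup>2 = (norm z)\<^sup>2 - (z \<bullet> \<nu>)\<^sup>2"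
      unfolding power2_norm_eq_inner
      by (simp add: inner_diff_left inner_diff_right \<nu>\<nu> inner_commute power2_eq_square)
    then have "(norm (?q z))\<^sup>2 \<le> (norm z)\<^sup>2" by simp
    then show ?thesis by (rule power2_le_imp_le) simp
  qed
  from this[of "x - y"] have q: "norm (?q x - ?q y) \<le> norm (x - y)"
    by (simp add: inner_diff_left algebra_simps)
  have "?q z \<in> {y. y \<bullet> \<nu> = 0}" for z by (simp add: inner_diff_left \<nu>\<nu>)
  then have "dist (h (?q x)) (h (?q y)) \<le> L * dist (?q x) (?q y)"
    using lipschitz_onD[OF lip] by blast
  also have "\<dots> \<le> L * norm (x - y)"
    using q L_nonneg by (simp add: dist_norm mult_left_mono)
  finally have "\<bar>h (?q x) - h (?q y)\<bar> \<le> L * norm (x - y)" by (simp add: dist_real_def)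
  moreover have "\<bar>x \<bullet> \<nu> - y \<bullet> \<nu>\<bar> \<le> norm (x - y)"
    using Cauchy_Schwarz_ineq2[of "x - y" \<nu>] \<nu> by (simp add: inner_diff_left)
  ultimately show ?thesis by (simp add: s_def algebra_simps)
qed

lemma s_continuous: "continuous_on A s"
proof -
  have "(1 + L)-lipschitz_on A s"
    using s_lipschitz L_nonneg by (auto simp: lipschitz_on_def dist_norm)
  then show ?thesis by (rule lipschitz_on_continuous_on)
qed

lemma s_measurable [measurable]: "s \<in> borel_measurable borel"
  using s_continuous by (rule borel_measurable_continuous_onI)

lemma P_measurable [measurable]: "P \<in> borel_measurable borel"
  unfolding P_def by measurable

lemma s_P: "s (P x) = 0"
  using s_shift[of x "- s x"] by (simp add: P_def)

lemma P_shift: "P (x + t *\<^sub>R \<nu>) = P x"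
  by (simp add: P_def s_shift algebra_simps)

lemma in_\<Omega>_iff: "x \<in> U \<Longrightarrow> x \<in> \<Omega> \<longleftrightarrow> s x > 0"
  using graph by (auto simp: s_def)

text \<open>A positive height would put the point into the open set \<Omega>; a negative height
  would give it a neighbourhood disjoint from \<Omega>.\<close>

lemma s_frontier:
  assumes "x \<in> frontier \<Omega>" "x \<in> U"
  shows "s x = 0"
proof -
  have "x \<notin> \<Omega>" "x \<in> closure \<Omega>" using assms(1) open_\<Omega> by (auto simp: frontier_def interior_open)
  then have "\<not> s x > 0" using in_\<Omega>_iff assms(2) by blast
  moreover have "\<not> s x < 0"
  proof
    assume "s x < 0"
    have "open (U \<inter> s -` {..<0})"
      by (intro open_Int open_U open_vimage s_continuous) simp
    moreover have "x \<in> U \<inter> s -` {..<0}" using assms(2) \<open>s x < 0\<close> by simp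
    ultimately have "(U \<inter> s -` {..<0}) \<inter> \<Omega> \<noteq> {}"
      using \<open>x \<in> closure \<Omega>\<close> by (metis closure_iff_nhds_not_empty inf_commute order_refl)
    then show False using in_\<Omega>_iff by force
  qed
  ultimately show ?thesis by simp
qed

lemma shift_in_\<Omega>:
  assumes "x \<in> ball p R" "0 < t" "t < R" "s x \<ge> 0"
  shows "x + t *\<^sub>R \<nu> \<in> \<Omega>"
proof -
  have "dist p (x + t *\<^sub>R \<nu>) \<le> dist p x + dist x (x + t *\<^sub>R \<nu>)" by (rule dist_triangle)
  also have "\<dots> < 2 * R" using assms \<nu> by (simp add: dist_norm)
  finally have "x + t *\<^sub>R \<nu> \<in> U" using ball_U by auto
  then show ?thesis using assms by (simp add: in_\<Omega>_iff s_shift)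
qed

text \<open>Each value in the strip is averaged over a segment of length R pointing into \<Omega>.
  After the shear, a point y receives contributions only from parameters in an interval of length
  \<tau>, which produces the small factor.\<close>

lemma strip_estimate:
  assumes \<phi>: "smooth \<phi>" and \<tau>: "\<tau> \<ge> 0"
    and Z: "Z \<in> sets borel" "Z \<subseteq> {x \<in> ball p R. 0 < s x \<and> s x \<le> \<tau>}"
  shows "ennreal R * (\<integral>\<^sup>+x. esq (\<phi> x) * indicator Z x \<partial>lborel) \<le>
    ennreal \<tau> * (\<integral>\<^sup>+x. ennreal (energy R \<phi> x) * indicator \<Omega> x \<partial>lborel)"
proof -
  note [measurable] = Z(1) energy_borel[OF \<phi>] borel_open[OF open_\<Omega>]
    borel_measurable_continuous_onI[OF smooth_continuous[OF \<phi>]]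
  define F where "F x = ennreal (energy R \<phi> x) * indicator \<Omega> x" for x
  define W :: "'a \<Rightarrow> real \<Rightarrow> ennreal" where "W x t = indicator Z x * indicator {0<..<R} t" for x t
  have F[measurable]: "F \<in> borel_measurable borel" unfolding F_def by measurable
  have W[measurable]: "case_prod W \<in> borel_measurable (borel \<Otimes>\<^sub>M borel)" unfolding W_def by measurable
  have "ennreal R * (\<integral>\<^sup>+x. esq (\<phi> x) * indicator Z x \<partial>lborel) =
      (\<integral>\<^sup>+x. ennreal (R * (cmod (\<phi> x))\<^sup>2) * indicator Z x \<partial>lborel)"
    using R by (subst nn_integral_cmult[symmetric]) (auto simp: ennreal_mult mult.assoc)
  also have "\<dots> \<le> (\<integral>\<^sup>+x. \<integral>\<^sup>+t. W x t * F (x + t *\<^sub>R \<nu>) \<partial>lborel \<partial>lborel)"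
  proof (rule nn_integral_mono)
    fix x
    show "ennreal (R * (cmod (\<phi> x))\<^sup>2) * indicator Z x \<le> (\<integral>\<^sup>+t. W x t * F (x + t *\<^sub>R \<nu>) \<partial>lborel)"
    proof (cases "x \<in> Z")
      case True
      then have x: "x \<in> ball p R" "0 \<le> s x" using Z(2) by auto
      have "ennreal (R * (cmod (\<phi> x))\<^sup>2) \<le> (\<integral>\<^sup>+t. ennreal (energy R \<phi> (x + t *\<^sub>R \<nu>)) * indicator {0<..<R} t \<partial>lborel)"
        using segment_mean_bound[OF \<phi> R, of \<nu> x] \<nu> by simp
      also have "\<dots> = (\<integral>\<^sup>+t. W x t * F (x + t *\<^sub>R \<nu>) \<partial>lborel)"
        using True shift_in_\<Omega>[OF x(1) _ _ x(2)] by (intro nn_integral_cong) (auto simp: W_def F_def indicator_def)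
      finally show ?thesis using True by simp
    qed simp
  qed
  also have "\<dots> = (\<integral>\<^sup>+y. F y * (\<integral>\<^sup>+t. W (y - t *\<^sub>R \<nu>) t \<partial>lborel) \<partial>lborel)"
    by (rule nn_integral_shear) measurable
  also have "\<dots> \<le> (\<integral>\<^sup>+y. F y * ennreal \<tau> \<partial>lborel)"
  proof (intro nn_integral_mono mult_left_mono)
    fix y
    \<comment> \<open>A start point y - t \<nu> has height \<open>s y - t\<close>, and heights in Z
      lie between 0 and \<tau>.\<close>
    have "(\<integral>\<^sup>+t. W (y - t *\<^sub>R \<nu>) t \<partial>lborel) \<le> (\<integral>\<^sup>+t. indicator {s y - \<tau>..s y} t \<partial>lborel)"
    proof (rule nn_integral_mono)
      fix t
      have "s y - \<tau> \<le> t \<and> t \<le> s y" if "y - t *\<^sub>R \<nu> \<in> Z"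
        using subsetD[OF Z(2) that] s_shift[of y "- t"] by auto
      then show "W (y - t *\<^sub>R \<nu>) t \<le> indicator {s y - \<tau>..s y} t"
        by (auto simp: W_def indicator_def)
    qed
    also have "\<dots> = ennreal \<tau>" using \<tau> by simp
    finally show "(\<integral>\<^sup>+t. W (y - t *\<^sub>R \<nu>) t \<partial>lborel) \<le> ennreal \<tau>" .
  qed simp
  also have "\<dots> = ennreal \<tau> * (\<integral>\<^sup>+x. F x \<partial>lborel)"
    by (subst nn_integral_multc) (simp_all add: mult.commute)
  finally show ?thesis by (simp only: F_def)
qed

section \<open>Comparison of Hausdorff measure with a collar collapsed onto the graph\<close>

definition D :: "'a set" where "D = {x \<in> ball p (2 * R). 0 < s x \<and> s x < R}"

lemma D_measurable [measurable]: "D \<in> sets borel"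
  unfolding D_def by measurable

text \<open>A finite Borel measure that plays the role of surface measure: it weighs a set on the
  graph by the Lebesgue volume of the part of the collar D lying above or below it along
  \<nu>.\<close>

definition M :: "'a measure" where "M = distr (restrict_space lborel D) borel P"

lemma M_simps [simp]: "sets M = sets borel" "space M = UNIV"
  by (simp_all add: M_def)

lemma P_measurable': "P \<in> measurable (restrict_space lborel D) borel"
  by (rule measurable_restrict_space1) simp

lemma emeasure_M: "A \<in> sets borel \<Longrightarrow> emeasure M A = emeasure lborel (D \<inter> P -` A)"
proof -
  assume A[measurable]: "A \<in> sets borel"
  have "P -` A \<in> sets borel" using measurable_sets[OF P_measurable A] by simp
  then show ?thesis
    unfolding M_def
    by (subst emeasure_distr[OF P_measurable' A], subst emeasure_restrict_space)
       (auto simp: space_restrict_space Int_commute)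
qed

lemma nn_integral_M:
  "f \<in> borel_measurable borel \<Longrightarrow> (\<integral>\<^sup>+x. f x \<partial>M) = (\<integral>\<^sup>+x. f (P x) * indicator D x \<partial>lborel)"
  unfolding M_def by (subst nn_integral_distr[OF P_measurable']) (auto simp: nn_integral_restrict_space)

lemma emeasure_M_finite: "emeasure M (space M) \<noteq> \<infinity>"
proof -
  have "emeasure M (space M) = emeasure lborel D" by (simp add: emeasure_M)
  also have "\<dots> < \<infinity>"
    by (intro emeasure_bounded_finite bounded_subset[OF bounded_ball[of p "2 * R"]]) (auto simp: D_def)
  finally show ?thesis by simp
qed

text \<open>At least R / (4 r) disjoint balls of radius r / (2 + L) fit over a boundary ball of
  radius r; this is their total volume divided by r^(d-1).\<close>

definition \<kappa> :: real where
  "\<kappa> = R / 4 * unit_ball_vol (real DIM('a)) * (1 / (2 + L)) ^ DIM('a)"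

lemma \<kappa>_pos: "\<kappa> > 0"
  unfolding \<kappa>_def using R L_nonneg by (intro mult_pos_pos zero_less_power) auto

text \<open>The part of \<open>D\<close> above the ball contains about \<open>R / 2r\<close> disjoint balls of radius
  comparable to \<open>r\<close>, stacked in direction \<open>\<nu>\<close>.\<close>

lemma emeasure_M_cball_ge:
  assumes x: "x \<in> ball p R" "s x = 0" and r: "0 < r" "r \<le> R / 4"
  shows "ennreal (\<kappa> * r ^ (DIM('a) - 1)) \<le> emeasure M (cball x r)"
proof -
  \<comment> \<open>Centres sit at heights (2 i + 1) r for i < n, so n at most R / (2 r) keeps them
    between r and R - r. For radius c r with c = 1 / (2 + L) the foot points stay within r of x,
    because displacing by z moves the foot point by at most (2 + L) times the norm of z.\<close>
  define n where "n = nat \<lfloor>R / (2 * r)\<rfloor>"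
  define c where "c = 1 / (2 + L)"
  have c: "0 < c" "c \<le> 1" using L_nonneg by (auto simp: c_def)
  have Rr: "R / (4 * r) \<ge> 1" using r by (simp add: field_simps)
  have nR: "real n * (2 * r) \<le> R"
  proof -
    have "real n \<le> R / (2 * r)" unfolding n_def using r R by (simp add: of_nat_nat)
    then show ?thesis using r by (simp add: field_simps)
  qed
  have n_ge: "real n \<ge> R / (4 * r)"
  proof -
    have "real n > R / (2 * r) - 1" unfolding n_def using r R by (simp add: of_nat_nat)
    moreover have "R / (2 * r) = R / (4 * r) + R / (4 * r)" by (simp add: field_simps)
    ultimately show ?thesis using Rr by linarith
  qed
  define b where "b i = ball (x + ((2 * real i + 1) * r) *\<^sub>R \<nu>) (c * r)" for i :: nat
  have disj: "disjoint_family_on b {..<n}"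
  proof (unfold disjoint_family_on_def, intro ballI impI)
    fix i j :: nat assume "i \<noteq> j"
    have "dist (x + ((2 * real i + 1) * r) *\<^sub>R \<nu>) (x + ((2 * real j + 1) * r) *\<^sub>R \<nu>) = \<bar>(2 * real i + 1) * r - (2 * real j + 1) * r\<bar>"
      using \<nu> by (simp add: dist_norm scaleR_diff_left[symmetric])
    also have "(2 * real i + 1) * r - (2 * real j + 1) * r = 2 * r * (real i - real j)" by (simp add: algebra_simps)
    also have "\<bar>2 * r * (real i - real j)\<bar> \<ge> 2 * r * 1"
      using \<open>i \<noteq> j\<close> r by (simp add: abs_mult)
    finally have "c * r + c * r \<le> dist (x + ((2 * real i + 1) * r) *\<^sub>R \<nu>) (x + ((2 * real j + 1) * r) *\<^sub>R \<nu>)"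
      using mult_right_mono[OF c(2), of r] r by linarith
    then show "b i \<inter> b j = {}" unfolding b_def by (rule disjoint_ballI)
  qed
  have sub: "b i \<subseteq> D \<inter> P -` cball x r" if i: "i < n" for i
  proof
    fix y assume "y \<in> b i"
    define t where "t = (2 * real i + 1) * r"
    define z where "z = y - (x + t *\<^sub>R \<nu>)"
    have z: "norm z < c * r" using \<open>y \<in> b i\<close> by (simp add: b_def t_def z_def dist_norm norm_minus_commute)
    have y: "y = (x + z) + t *\<^sub>R \<nu>" by (simp add: z_def)
    have zr: "(2 + L) * norm z < r"
    proof -
      have "(2 + L) * norm z < (2 + L) * (c * r)" using z L_nonneg by (intro mult_strict_left_mono) auto
      also have "\<dots> = r" using L_nonneg by (simp add: c_def)
      finally show ?thesis .
    qed
    have sz: "\<bar>s (x + z)\<bar> \<le> (1 + L) * norm z" using s_lipschitz[of "x + z" x] x(2) by simp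
    have sy: "s y = s (x + z) + t" unfolding y by (rule s_shift)
    have t: "r \<le> t" "t \<le> R - r"
    proof -
      show "r \<le> t" using r by (simp add: t_def)
      have "real i + 1 \<le> real n" using i by linarith
      then have "(real i + 1) * (2 * r) \<le> real n * (2 * r)" using r by (intro mult_right_mono) auto
      then show "t \<le> R - r" using nR by (simp add: t_def algebra_simps)
    qed
    have "(1 + L) * norm z \<le> (2 + L) * norm z" by (intro mult_right_mono) auto
    then have 1: "0 < s y" "s y < R" using sy sz zr t by auto
    have nz: "norm z \<le> (2 + L) * norm z" using mult_right_mono[of 1 "2 + L" "norm z"] L_nonneg by simp
    have "dist p y \<le> dist p x + dist x y" by (rule dist_triangle)
    also have "dist x y \<le> norm z + t"
      using norm_triangle_ineq[of z "t *\<^sub>R \<nu>"] \<nu> t r unfolding dist_commute[of x y] by (simp add: dist_norm y)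
    finally have 2: "dist p y < 2 * R" using x(1) nz zr t by simp
    have "P y = P (x + z)" unfolding y by (rule P_shift)
    then have "P y - x = z - s (x + z) *\<^sub>R \<nu>" by (simp only: P_def[of "x + z"]) simp
    then have "dist x (P y) = norm (z - s (x + z) *\<^sub>R \<nu>)" by (simp add: dist_norm norm_minus_commute[of x])
    also have "\<dots> \<le> norm z + \<bar>s (x + z)\<bar>" using norm_triangle_ineq4[of z "s (x + z) *\<^sub>R \<nu>"] \<nu> by simp
    also have "\<dots> \<le> (2 + L) * norm z" using sz by (simp add: algebra_simps)
    finally show "y \<in> D \<inter> P -` cball x r" using 1 2 zr by (simp add: D_def)
  qed
  have "ennreal (\<kappa> * r ^ (DIM('a) - 1)) \<le> ennreal (real n * (unit_ball_vol (real DIM('a)) * (c * r) ^ DIM('a)))"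
  proof (rule ennreal_leI)
    have "r ^ DIM('a) = r * r ^ (DIM('a) - 1)" using DIM_positive[where 'a = 'a] by (metis Suc_pred' power_Suc)
    then have "(c * r) ^ DIM('a) = c ^ DIM('a) * (r * r ^ (DIM('a) - 1))"
      by (simp only: power_mult_distrib)
    moreover have "\<kappa> = R / 4 * unit_ball_vol (real DIM('a)) * c ^ DIM('a)"
      by (simp add: \<kappa>_def c_def)
    ultimately have "\<kappa> * r ^ (DIM('a) - 1) = R / (4 * r) * (unit_ball_vol (real DIM('a)) * (c * r) ^ DIM('a))"
      using r by simp
    also have "\<dots> \<le> real n * (unit_ball_vol (real DIM('a)) * (c * r) ^ DIM('a))"
      using n_ge c r by (intro mult_right_mono) (auto intro!: mult_nonneg_nonneg less_imp_le[OF unit_ball_vol_pos])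
    finally show "\<kappa> * r ^ (DIM('a) - 1) \<le> real n * (unit_ball_vol (real DIM('a)) * (c * r) ^ DIM('a))" .
  qed
  also have "\<dots> = (\<Sum>i<n. emeasure lborel (b i))"
    using c r by (simp add: b_def emeasure_ball ennreal_mult' ennreal_of_nat_eq_real_of_nat)
  also have "\<dots> = emeasure lborel (\<Union>i<n. b i)"
    by (intro sum_emeasure disj) (auto simp: b_def)
  also have "\<dots> \<le> emeasure lborel (D \<inter> P -` cball x r)"
    using sub measurable_sets[OF P_measurable, of "cball x r"] by (intro emeasure_mono) auto
  also have "\<dots> = emeasure M (cball x r)" by (simp add: emeasure_M)
  finally show ?thesis .
qed

text \<open>Ratio of the Hausdorff weight of a ball enlarged five times by the Vitali lemma to the
  lower bound \<open>\<kappa> * r ^ (DIM('a) - 1)\<close> on the mass of the original ball.\<close>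

definition K1 :: real where
  "K1 = unit_ball_vol (real (DIM('a) - 1)) * 5 ^ (DIM('a) - 1) / \<kappa>"

lemma K1_pos: "K1 > 0"
  unfolding K1_def using \<kappa>_pos by (intro divide_pos_pos mult_pos_pos) auto

text \<open>Vitali's lemma selects disjoint closed balls inside O' whose fivefold enlargements cover
  A. Each enlarged ball costs at most K1 times the M-mass of the small one, and disjointness adds
  these masses up to at most that of O'.\<close>

lemma hausdorff_premeasure_le_open:
  assumes A: "A \<subseteq> ball p R" "\<And>x. x \<in> A \<Longrightarrow> s x = 0" and O: "open O'" "A \<subseteq> O'" and \<delta>: "\<delta> > 0"
  shows "hausdorff_premeasure (DIM('a) - 1) \<delta> A \<le> ennreal K1 * emeasure M O'"
proof -
  let ?d = "DIM('a) - 1"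
  \<comment> \<open>R / 4 is the range of the mass bound; \<delta> / 10 makes the diameter of the
    enlarged ball at most \<delta>.\<close>
  have "\<exists>r. 0 < r \<and> r \<le> R / 4 \<and> r \<le> \<delta> / 10 \<and> cball x r \<subseteq> O'" if "x \<in> A" for x
  proof -
    have "x \<in> O'" using O(2) that by (rule subsetD)
    then obtain e where "e > 0" "cball x e \<subseteq> O'" using bspec[OF O(1)[unfolded open_contains_cball] \<open>x \<in> O'\<close>] by (elim exE conjE)
    moreover have "cball x (min e (min (R / 4) (\<delta> / 10))) \<subseteq> cball x e"
      by (rule subset_cball) simp
    moreover have "min e (min (R / 4) (\<delta> / 10)) \<le> R / 4" "min e (min (R / 4) (\<delta> / 10)) \<le> \<delta> / 10"
      by linarith+
    moreover have "0 < min e (min (R / 4) (\<delta> / 10))" using R \<delta> \<open>e > 0\<close> by simp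
    ultimately show ?thesis by (meson subset_trans)
  qed
  then obtain r where r: "\<And>x. x \<in> A \<Longrightarrow> 0 < r x \<and> r x \<le> R / 4 \<and> r x \<le> \<delta> / 10 \<and> cball x (r x) \<subseteq> O'"
    by metis
  obtain C where C: "countable C" "C \<subseteq> A" "pairwise (\<lambda>i j. disjnt (cball i (r i)) (cball j (r j))) C"
    "\<And>i. i \<in> A \<Longrightarrow> \<exists>j. j \<in> C \<and> \<not> disjnt (cball i (r i)) (cball j (r j)) \<and> cball i (r i) \<subseteq> ball j (5 * r j)"
    by (rule Vitali_covering_lemma_cballs_balls[of A r "R / 4" "\<lambda>x. x"]) (use r in auto)
  \<comment> \<open>Coverings are sequences indexed by all naturals, so the countable family is
    enumerated and padded with empty sets, which have weight 0.\<close>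
  define I where "I = to_nat_on C ` C"
  define f where "f = from_nat_into C"
  have f: "f i \<in> C" if "i \<in> I" for i using that C(1) by (auto simp: I_def f_def)
  have inj: "inj_on f I" using C(1) by (auto simp: I_def f_def inj_on_def)
  have fI: "f ` I = C" using C(1) by (force simp: I_def f_def)
  define E where "E i = (if i \<in> I then ball (f i) (5 * r (f i)) else {})" for i
  define F where "F i = (if i \<in> I then cball (f i) (r (f i)) else {})" for i
  have rf: "0 < r (f i)" "r (f i) \<le> R / 4" "r (f i) \<le> \<delta> / 10" "cball (f i) (r (f i)) \<subseteq> O'" "f i \<in> A" if "i \<in> I" for i
    using r f[OF that] C(2) by blast+
  have cover: "A \<subseteq> (\<Union>i. E i)"
  proof
    fix x assume x: "x \<in> A"
    then obtain j where j: "j \<in> C" "cball x (r x) \<subseteq> ball j (5 * r j)" using C(4) by blast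
    then obtain i where "i \<in> I" "f i = j" using fI by blast
    moreover have "x \<in> cball x (r x)" using r[OF x] by simp
    ultimately have "x \<in> E i" using subsetD[OF j(2)] by (simp add: E_def)
    then show "x \<in> (\<Union>i. E i)" by blast
  qed
  have diam: "bounded (E i) \<and> diameter (E i) \<le> \<delta>" for i
    using rf[of i] by (auto simp: E_def diameter_ball \<delta> less_imp_le)
  have disj: "disjoint_family F"
    unfolding disjoint_family_on_def
  proof (intro ballI impI)
    fix i j :: nat assume ij: "i \<noteq> j"
    show "F i \<inter> F j = {}"
    proof (cases "i \<in> I \<and> j \<in> I")
      case True
      then have "f i \<noteq> f j" using ij inj by (auto simp: inj_on_def)
      then have "disjnt (cball (f i) (r (f i))) (cball (f j) (r (f j)))"
        using C(3) f True unfolding pairwise_def by blast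
      then show ?thesis using True by (simp add: F_def disjnt_def)
    qed (auto simp: F_def)
  qed
  have "hausdorff_premeasure ?d \<delta> A \<le> (\<Sum>i. if E i = {} then 0
             else ennreal (unit_ball_vol (real ?d) * (diameter (E i) / 2) ^ ?d))"
    unfolding hausdorff_premeasure_def using cover diam by (intro INF_lower) auto
  also have "\<dots> \<le> (\<Sum>i. ennreal K1 * emeasure M (F i))"
  proof (intro suminf_le summableI)
    fix i
    show "(if E i = {} then 0 else ennreal (unit_ball_vol (real ?d) * (diameter (E i) / 2) ^ ?d)) \<le> ennreal K1 * emeasure M (F i)"
    proof (cases "i \<in> I")
      case True
      have "unit_ball_vol (real ?d) * (diameter (E i) / 2) ^ ?d = K1 * (\<kappa> * r (f i) ^ ?d)"
        using True rf(1)[OF True] \<kappa>_pos by (simp add: E_def diameter_ball K1_def power_mult_distrib)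
      moreover have "ennreal (\<kappa> * r (f i) ^ ?d) \<le> emeasure M (cball (f i) (r (f i)))"
        by (rule emeasure_M_cball_ge) (use rf[OF True] A in auto)
      then have "ennreal (\<kappa> * r (f i) ^ ?d) \<le> emeasure M (F i)"
        using True by (simp add: F_def)
      ultimately show ?thesis
        using K1_pos by (simp add: ennreal_mult' mult_left_mono)
    qed (simp add: E_def)
  qed
  also have "\<dots> = ennreal K1 * (\<Sum>i. emeasure M (F i))" by simp
  also have "(\<Sum>i. emeasure M (F i)) = emeasure M (\<Union>i. F i)"
    by (rule suminf_emeasure[OF _ disj]) (auto simp: F_def)
  also have "ennreal K1 * emeasure M (\<Union>i. F i) \<le> ennreal K1 * emeasure M O'"
  proof (intro mult_left_mono emeasure_mono UN_least)
    show "F i \<subseteq> O'" for i by (cases "i \<in> I") (use rf(4) in \<open>simp_all add: F_def\<close>)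
  qed (use O in auto)
  finally show ?thesis .
qed

text \<open>M is a finite Borel measure and hence outer regular, so the open superset shrinks to A;
  the constant is independent of \<delta>.\<close>

lemma hausdorff_outer_le:
  assumes A: "A \<in> sets borel" "A \<subseteq> ball p R" "\<And>x. x \<in> A \<Longrightarrow> s x = 0"
  shows "hausdorff_outer (DIM('a) - 1) A \<le> ennreal K1 * emeasure M A"
  unfolding hausdorff_outer_def
proof (rule SUP_least)
  fix \<delta> :: real assume "\<delta> \<in> {0<..}"
  let ?H = "hausdorff_premeasure (DIM('a) - 1) \<delta> A"
  \<comment> \<open>K1 is cancelled so that the infimum over open supersets is taken of the bare
    measure, as outer regularity requires.\<close>
  have inv: "ennreal (1 / K1) * (ennreal K1 * y) = y" for y
    using K1_pos by (simp add: mult.assoc[symmetric] ennreal_mult[symmetric])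
  have "ennreal (1 / K1) * ?H \<le> (INF O'\<in>{O'. A \<subseteq> O' \<and> open O'}. emeasure M O')"
  proof (rule INF_greatest)
    fix O' assume "O' \<in> {O'. A \<subseteq> O' \<and> open O'}"
    then have "?H \<le> ennreal K1 * emeasure M O'"
      using hausdorff_premeasure_le_open[of A O' \<delta>] A \<open>\<delta> \<in> {0<..}\<close> by auto
    then have "ennreal (1 / K1) * ?H \<le> ennreal (1 / K1) * (ennreal K1 * emeasure M O')"
      by (rule mult_left_mono) simp
    then show "ennreal (1 / K1) * ?H \<le> emeasure M O'" by (simp only: inv)
  qed
  also have "\<dots> = emeasure M A"
    using outer_regular[OF M_simps(1) emeasure_M_finite A(1)] by simp
  finally have "ennreal K1 * (ennreal (1 / K1) * ?H) \<le> ennreal K1 * emeasure M A"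
    by (rule mult_left_mono) simp
  then show "?H \<le> ennreal K1 * emeasure M A" using inv[of ?H] by (simp add: mult.left_commute)
qed

text \<open>Surface measure in the chart is at most K1 M, and an M-integral is an integral over the
  collar of values at foot points. Averaging each of these along \<nu> yields a factor R on the
  left; the shear yields the same R on the right.\<close>

lemma trace_estimate:
  assumes \<phi>: "smooth \<phi>"
  shows "(\<integral>\<^sup>+x. esq (\<phi> x) * indicator (frontier \<Omega> \<inter> ball p R) x \<partial>hausdorff_measure (DIM('a) - 1)) \<le>
    ennreal K1 * (\<integral>\<^sup>+x. ennreal (energy R \<phi> x) * indicator \<Omega> x \<partial>lborel)"
proof -
  let ?H = "hausdorff_measure (DIM('a) - 1) :: 'a measure"
  let ?A = "frontier \<Omega> \<inter> ball p R"
  have A[measurable]: "?A \<in> sets borel" by auto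
  have mM[simp]: "borel_measurable M = (borel_measurable borel :: ('a \<Rightarrow> ennreal) set)"
    by (rule measurable_cong_sets) simp_all
  note [measurable] = energy_borel[OF \<phi>] borel_open[OF open_\<Omega>]
    borel_measurable_continuous_onI[OF smooth_continuous[OF \<phi>]] borel_open[OF open_ball[of p R]]
  define g where "g x = esq (\<phi> x) * indicator (ball p R) x" for x
  have g[measurable]: "g \<in> borel_measurable borel" unfolding g_def by measurable
  \<comment> \<open>Domination on sets is expressed as an order relation between measures, so that
    it carries over to integrals of g.\<close>
  have "density ?H (indicator ?A) \<le> density M (\<lambda>_. ennreal K1)"
  proof (subst le_measure)
    show "\<forall>B\<in>sets (density ?H (indicator ?A)). emeasure (density ?H (indicator ?A)) B \<le> emeasure (density M (\<lambda>_. ennreal K1)) B"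
    proof
      fix B assume "B \<in> sets (density ?H (indicator ?A))"
      then have B[measurable]: "B \<in> sets borel" by simp
      have "emeasure (density ?H (indicator ?A)) B = emeasure ?H (?A \<inter> B)"
        using A B by (simp add: emeasure_density indicator_inter_arith[symmetric])
      also have "\<dots> \<le> hausdorff_outer (DIM('a) - 1) (?A \<inter> B)"
        by (simp add: hausdorff_measure_def emeasure_measure_of_conv)
      also have "\<dots> \<le> ennreal K1 * emeasure M (?A \<inter> B)"
      proof (rule hausdorff_outer_le)
        fix x assume "x \<in> ?A \<inter> B"
        moreover have "ball p R \<subseteq> ball p (2 * R)" using R by (intro subset_ball) simp
        ultimately show "s x = 0" using s_frontier ball_U by blast
      qed auto
      also have "\<dots> \<le> ennreal K1 * emeasure M B"
        by (intro mult_left_mono emeasure_mono) auto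
      finally show "emeasure (density ?H (indicator ?A)) B \<le> emeasure (density M (\<lambda>_. ennreal K1)) B"
        by (simp add: emeasure_density_const)
    qed
  qed simp
  then have "(\<integral>\<^sup>+x. g x \<partial>density ?H (indicator ?A)) \<le> (\<integral>\<^sup>+x. g x \<partial>density M (\<lambda>_. ennreal K1))"
    by (intro nn_integral_mono_measure) simp_all
  also have "(\<integral>\<^sup>+x. g x \<partial>density ?H (indicator ?A)) = (\<integral>\<^sup>+x. esq (\<phi> x) * indicator ?A x \<partial>?H)"
    using g A by (subst nn_integral_density) (auto simp: g_def indicator_def intro!: nn_integral_cong)
  also have "(\<integral>\<^sup>+x. g x \<partial>density M (\<lambda>_. ennreal K1)) = ennreal K1 * (\<integral>\<^sup>+x. g x \<partial>M)"
    using g by (subst nn_integral_density) (auto simp: nn_integral_cmult)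
  also have "(\<integral>\<^sup>+x. g x \<partial>M) = (\<integral>\<^sup>+x. g (P x) * indicator D x \<partial>lborel)"
    by (rule nn_integral_M[OF g])
  also have "ennreal K1 * (\<integral>\<^sup>+x. g (P x) * indicator D x \<partial>lborel) \<le>
      ennreal K1 * (\<integral>\<^sup>+x. ennreal (energy R \<phi> x) * indicator \<Omega> x \<partial>lborel)"
  proof (rule mult_left_mono)
    define F where "F x = ennreal (energy R \<phi> x) * indicator \<Omega> x" for x
    \<comment> \<open>Both ends of the segment have height in (0, R). The parameter t may be
      negative: it is counted from x, while the averaging starts at the foot point of x.\<close>
    define W :: "'a \<Rightarrow> real \<Rightarrow> ennreal" where "W x t = indicator {0<..<R} (s x) * indicator {0<..<R} (s x + t)" for x t
    have F[measurable]: "F \<in> borel_measurable borel" unfolding F_def by measurable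
    have W[measurable]: "case_prod W \<in> borel_measurable (borel \<Otimes>\<^sub>M borel)" unfolding W_def by measurable
    have "ennreal R * (\<integral>\<^sup>+x. g (P x) * indicator D x \<partial>lborel) = (\<integral>\<^sup>+x. ennreal R * (g (P x) * indicator D x) \<partial>lborel)"
      by (intro nn_integral_cmult[symmetric]) measurable
    also have "\<dots> \<le> (\<integral>\<^sup>+x. \<integral>\<^sup>+t. W x t * F (x + t *\<^sub>R \<nu>) \<partial>lborel \<partial>lborel)"
    proof (rule nn_integral_mono)
      fix x
      show "ennreal R * (g (P x) * indicator D x) \<le> (\<integral>\<^sup>+t. W x t * F (x + t *\<^sub>R \<nu>) \<partial>lborel)"
      proof (cases "x \<in> D \<and> P x \<in> ball p R")
        case True
        have "ennreal R * (g (P x) * indicator D x) = ennreal (R * (cmod (\<phi> (P x)))\<^sup>2)"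
          using True R by (simp add: g_def ennreal_mult)
        also have "\<dots> \<le> (\<integral>\<^sup>+t. ennreal (energy R \<phi> (P x + t *\<^sub>R \<nu>)) * indicator {0<..<R} t \<partial>lborel)"
          using segment_mean_bound[OF \<phi> R, of \<nu> "P x"] \<nu> by simp
        also have "\<dots> = (\<integral>\<^sup>+t. F (P x + t *\<^sub>R \<nu>) * indicator {0<..<R} t \<partial>lborel)"
          using True shift_in_\<Omega>[of "P x"] by (intro nn_integral_cong) (auto simp: F_def indicator_def s_P)
        \<comment> \<open>The parameter is shifted by \<open>s x\<close>, since P x + (t + s x)
          \<nu> = x + t \<nu>.\<close>
        also have "\<dots> = (\<integral>\<^sup>+t. F (P x + (t + s x) *\<^sub>R \<nu>) * indicator {0<..<R} (t + s x) \<partial>lborel)"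
          by (rule nn_integral_translate[symmetric]) measurable
        also have "\<dots> = (\<integral>\<^sup>+t. W x t * F (x + t *\<^sub>R \<nu>) \<partial>lborel)"
          using True by (intro nn_integral_cong) (auto simp: W_def D_def P_def algebra_simps)
        finally show ?thesis .
      qed (auto simp: g_def)
    qed
    also have "\<dots> = (\<integral>\<^sup>+y. F y * (\<integral>\<^sup>+t. W (y - t *\<^sub>R \<nu>) t \<partial>lborel) \<partial>lborel)"
      by (rule nn_integral_shear) measurable
    also have "\<dots> \<le> (\<integral>\<^sup>+y. F y * ennreal R \<partial>lborel)"
    proof (intro nn_integral_mono mult_left_mono)
      fix y
      have "(\<integral>\<^sup>+t. W (y - t *\<^sub>R \<nu>) t \<partial>lborel) \<le> (\<integral>\<^sup>+t. indicator {s y - R..s y} t \<partial>lborel)"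
      proof (rule nn_integral_mono)
        fix t
        show "W (y - t *\<^sub>R \<nu>) t \<le> indicator {s y - R..s y} t"
          using s_shift[of y "- t"] by (auto simp: W_def indicator_def)
      qed
      also have "\<dots> = ennreal R" using R by simp
      finally show "(\<integral>\<^sup>+t. W (y - t *\<^sub>R \<nu>) t \<partial>lborel) \<le> ennreal R" .
    qed simp
    also have "\<dots> = ennreal R * (\<integral>\<^sup>+x. F x \<partial>lborel)"
      by (subst nn_integral_multc) (simp_all add: mult.commute)
    finally show "(\<integral>\<^sup>+x. g (P x) * indicator D x \<partial>lborel) \<le> (\<integral>\<^sup>+x. ennreal (energy R \<phi> x) * indicator \<Omega> x \<partial>lborel)"
      using R unfolding F_def by (subst (asm) ennreal_mult_le_mult_iff) auto
  qed simp
  finally show ?thesis .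
qed

end

abbreviation cellint :: "'a::euclidean_space set \<Rightarrow> ('a \<Rightarrow> complex) \<Rightarrow> complex" where
  "cellint Q f \<equiv> (LINT y|restrict_space lborel Q. f y)"

section \<open>A Poincare inequality on convex cells\<close>

lemma norm_integral_squared_le:
  fixes \<psi> :: "'a::euclidean_space \<Rightarrow> complex"
  assumes Q: "Q \<in> sets borel" "bounded Q" and \<psi>: "continuous_on UNIV \<psi>"
  shows "integrable (restrict_space lborel Q) \<psi>"
    "esq (cellint Q \<psi>) \<le>
      ennreal (measure lborel Q) * (\<integral>\<^sup>+y. esq (\<psi> y) * indicator Q y \<partial>lborel)"
proof -
  let ?M = "restrict_space lborel Q"
  interpret finite_measure ?M
    using emeasure_bounded_finite[OF Q(2)] Q(1) by (intro finite_measureI) (auto simp: emeasure_restrict_space space_restrict_space)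
  have \<psi>m: "\<psi> \<in> borel_measurable ?M"
    using \<psi> by (intro measurable_restrict_space1) (simp add: borel_measurable_continuous_onI)
  have "compact (\<psi> ` closure Q)"
    using \<psi> Q(2) by (intro compact_continuous_image) (auto intro: continuous_on_subset)
  then obtain B where B: "\<And>x. x \<in> closure Q \<Longrightarrow> cmod (\<psi> x) \<le> B"
    using compact_imp_bounded by (fastforce simp: bounded_iff)
  have L2: "\<psi> \<in> L2 ?M"
  proof (rule L2_bound[OF \<psi>m])
    show "integrable ?M (\<lambda>x. B\<^sup>2)" by simp
    show "AE x in ?M. (cmod (\<psi> x))\<^sup>2 \<le> B\<^sup>2"
      using B closure_subset[of Q] by (intro AE_I2) (auto intro!: power_mono simp: space_restrict_space)
  qed
  show "integrable ?M \<psi>" by (rule L1_le_L2(1)[OF L2])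
  have "cmod (LINT y|?M. \<psi> y) \<le> (LINT y|?M. cmod (\<psi> y))" by (rule integral_norm_bound)
  also have "\<dots> \<le> sqrt (measure ?M (space ?M)) * L2_norm ?M \<psi>" by (rule L1_le_L2(2)[OF L2])
  finally have "(cmod (LINT y|?M. \<psi> y))\<^sup>2 \<le> (sqrt (measure ?M (space ?M)) * L2_norm ?M \<psi>)\<^sup>2"
    by (intro power_mono) auto
  also have "\<dots> = measure lborel Q * (LINT y|?M. (cmod (\<psi> y))\<^sup>2)"
    using Q(1) by (simp add: power_mult_distrib L2_norm_sq space_restrict_space measure_restrict_space)
  finally have "esq (LINT y|?M. \<psi> y) \<le> ennreal (measure lborel Q) * ennreal (LINT y|?M. (cmod (\<psi> y))\<^sup>2)"
    by (simp add: ennreal_mult'[symmetric] ennreal_leI)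
  also have "ennreal (LINT y|?M. (cmod (\<psi> y))\<^sup>2) = (\<integral>\<^sup>+y. esq (\<psi> y) \<partial>?M)"
    by (rule nn_integral_eq_integral[symmetric]) (auto intro: L2_integrable[OF L2])
  also have "\<dots> = (\<integral>\<^sup>+y. esq (\<psi> y) * indicator Q y \<partial>lborel)"
    using Q(1) by (simp add: nn_integral_restrict_space)
  finally show "esq (cellint Q \<psi>) \<le>
      ennreal (measure lborel Q) * (\<integral>\<^sup>+y. esq (\<psi> y) * indicator Q y \<partial>lborel)" .
qed

lemma segment_gradsq_bound:
  assumes \<phi>: "smooth \<phi>"
  shows "esq (\<phi> (x + z) - \<phi> x) \<le>
    ennreal ((norm z)\<^sup>2) * (\<integral>\<^sup>+s. ennreal (gradsq \<phi> (x + s *\<^sub>R z)) * indicator {0..1} s \<partial>lborel)"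
proof -
  have "((\<lambda>s. gradsq \<phi> (x + s *\<^sub>R z)) has_integral integral {0..1} (\<lambda>s. gradsq \<phi> (x + s *\<^sub>R z))) {0..1}"
    by (intro integrable_integral integrable_continuous_interval
        continuous_on_compose2[OF gradsq_continuous[OF \<phi>, of UNIV]] continuous_intros) auto
  from nn_integral_has_integral_lebesgue'[OF gradsq_nonneg this] segment_bound[OF \<phi>, of 1 1 x z] show ?thesis
    by (simp add: ennreal_mult'[symmetric] ennreal_leI)
qed

text \<open>Put y = x + z. By convexity the segment stays in Q, and for fixed z and fixed position
  on the segment the shift in x preserves Lebesgue measure. The gradient integral therefore factors
  out, leaving the volume of the set W of differences.\<close>

lemma double_difference_integral_le:
  assumes \<psi>: "smooth \<psi>" and Q: "Q \<in> sets borel" "convex Q"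
    and W: "W \<in> sets borel" "\<And>x y. x \<in> Q \<Longrightarrow> y \<in> Q \<Longrightarrow> y - x \<in> W" "\<And>z. z \<in> W \<Longrightarrow> norm z \<le> \<rho>"
    and \<rho>: "\<rho> \<ge> 0"
  shows "(\<integral>\<^sup>+x. \<integral>\<^sup>+y. esq (\<psi> y - \<psi> x) * (indicator Q x * indicator Q y) \<partial>lborel \<partial>lborel) \<le>
    ennreal (\<rho>\<^sup>2) * emeasure lborel W * (\<integral>\<^sup>+x. ennreal (gradsq \<psi> x) * indicator Q x \<partial>lborel)"
proof -
  note [measurable] = Q(1) W(1) borel_measurable_continuous_onI[OF smooth_continuous[OF \<psi>]]
    borel_measurable_continuous_onI[OF gradsq_continuous[OF \<psi>]]
  define G where "G x = ennreal (gradsq \<psi> x) * indicator Q x" for x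
  have G[measurable]: "G \<in> borel_measurable borel" unfolding G_def by measurable
  have "(\<integral>\<^sup>+x. \<integral>\<^sup>+y. esq (\<psi> y - \<psi> x) * (indicator Q x * indicator Q y) \<partial>lborel \<partial>lborel) =
      (\<integral>\<^sup>+x. \<integral>\<^sup>+z. esq (\<psi> (x + z) - \<psi> x) * (indicator Q x * indicator Q (x + z)) \<partial>lborel \<partial>lborel)"
  proof (rule nn_integral_cong)
    fix x
    have "(\<integral>\<^sup>+z. esq (\<psi> (z + x) - \<psi> x) * (indicator Q x * indicator Q (z + x)) \<partial>lborel) =
        (\<integral>\<^sup>+y. esq (\<psi> y - \<psi> x) * (indicator Q x * indicator Q y) \<partial>lborel)"
      by (rule nn_integral_translate) measurable
    then show "(\<integral>\<^sup>+y. esq (\<psi> y - \<psi> x) * (indicator Q x * indicator Q y) \<partial>lborel) =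
        (\<integral>\<^sup>+z. esq (\<psi> (x + z) - \<psi> x) * (indicator Q x * indicator Q (x + z)) \<partial>lborel)"
      by (simp add: add.commute)
  qed
  also have "\<dots> \<le> (\<integral>\<^sup>+x. \<integral>\<^sup>+z. (ennreal (\<rho>\<^sup>2) * indicator W z) * (\<integral>\<^sup>+s. indicator {0..1} s * G (x + s *\<^sub>R z) \<partial>lborel) \<partial>lborel \<partial>lborel)"
  proof (intro nn_integral_mono)
    fix x z
    show "esq (\<psi> (x + z) - \<psi> x) * (indicator Q x * indicator Q (x + z)) \<le>
      (ennreal (\<rho>\<^sup>2) * indicator W z) * (\<integral>\<^sup>+s. indicator {0..1} s * G (x + s *\<^sub>R z) \<partial>lborel)"
    proof (cases "x \<in> Q \<and> x + z \<in> Q")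
      case True
      then have z: "z \<in> W" using W(2)[of x "x + z"] by simp
      have seg: "x + s *\<^sub>R z \<in> Q" if "s \<in> {0..1}" for s
      proof -
        have "(1 - s) *\<^sub>R x + s *\<^sub>R (x + z) \<in> Q"
          using True that by (intro convexD_alt[OF Q(2)]) auto
        then show ?thesis by (simp add: algebra_simps)
      qed
      have "esq (\<psi> (x + z) - \<psi> x) \<le>
          ennreal ((norm z)\<^sup>2) * (\<integral>\<^sup>+s. ennreal (gradsq \<psi> (x + s *\<^sub>R z)) * indicator {0..1} s \<partial>lborel)"
        by (rule segment_gradsq_bound[OF \<psi>])
      also have "\<dots> \<le> ennreal (\<rho>\<^sup>2) * (\<integral>\<^sup>+s. ennreal (gradsq \<psi> (x + s *\<^sub>R z)) * indicator {0..1} s \<partial>lborel)"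
        using W(3)[OF z] by (intro mult_right_mono ennreal_leI power_mono) auto
      also have "(\<integral>\<^sup>+s. ennreal (gradsq \<psi> (x + s *\<^sub>R z)) * indicator {0..1} s \<partial>lborel) = (\<integral>\<^sup>+s. indicator {0..1} s * G (x + s *\<^sub>R z) \<partial>lborel)"
        using seg by (intro nn_integral_cong) (auto simp: G_def indicator_def)
      finally show ?thesis using True z by simp
    qed auto
  qed
  also have "\<dots> = (\<integral>\<^sup>+z. \<integral>\<^sup>+x. (ennreal (\<rho>\<^sup>2) * indicator W z) * (\<integral>\<^sup>+s. indicator {0..1} s * G (x + s *\<^sub>R z) \<partial>lborel) \<partial>lborel \<partial>lborel)"
    by (rule lborel_pair.Fubini'[symmetric]) measurable
  also have "\<dots> = (\<integral>\<^sup>+z. (ennreal (\<rho>\<^sup>2) * indicator W z) * integral\<^sup>N lborel G \<partial>lborel)"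
  proof (rule nn_integral_cong)
    fix z
    have "(\<integral>\<^sup>+x. \<integral>\<^sup>+s. indicator {0..1::real} s * G (x + s *\<^sub>R z) \<partial>lborel \<partial>lborel) = (\<integral>\<^sup>+s. \<integral>\<^sup>+x. indicator {0..1::real} s * G (x + s *\<^sub>R z) \<partial>lborel \<partial>lborel)"
      by (rule lborel_pair.Fubini'[symmetric]) measurable
    also have "\<dots> = (\<integral>\<^sup>+s. indicator {0..1::real} s * integral\<^sup>N lborel G \<partial>lborel)"
      by (intro nn_integral_cong) (simp add: nn_integral_cmult nn_integral_translate)
    also have "\<dots> = integral\<^sup>N lborel G"
      by (subst nn_integral_multc) auto
    finally show "(\<integral>\<^sup>+x. (ennreal (\<rho>\<^sup>2) * indicator W z) * (\<integral>\<^sup>+s. indicator {0..1} s * G (x + s *\<^sub>R z) \<partial>lborel) \<partial>lborel) =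
        (ennreal (\<rho>\<^sup>2) * indicator W z) * integral\<^sup>N lborel G"
      by (subst nn_integral_cmult) auto
  qed
  also have "\<dots> = ennreal (\<rho>\<^sup>2) * emeasure lborel W * integral\<^sup>N lborel G"
    by (subst nn_integral_multc) (auto simp: nn_integral_cmult)
  finally show ?thesis unfolding G_def[abs_def] .
qed

text \<open>The mean is kept as a separate term instead of being subtracted: the cell integrals are
  the finitely many functionals along which compactness will be extracted.\<close>

lemma poincare_cell:
  assumes \<psi>: "smooth \<psi>" and Q: "Q \<in> sets borel" "convex Q" "bounded Q"
    and W: "W \<in> sets borel" "\<And>x y. x \<in> Q \<Longrightarrow> y \<in> Q \<Longrightarrow> y - x \<in> W" "\<And>z. z \<in> W \<Longrightarrow> norm z \<le> \<rho>"
    and \<rho>: "\<rho> \<ge> 0" and m: "measure lborel Q > 0" and c: "emeasure lborel W \<le> ennreal (c * measure lborel Q)" "c \<ge> 0"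
  shows "(\<integral>\<^sup>+x. esq (\<psi> x) * indicator Q x \<partial>lborel) \<le>
    ennreal (2 / measure lborel Q * (cmod (cellint Q \<psi>))\<^sup>2) +
    ennreal (2 * c * \<rho>\<^sup>2) * (\<integral>\<^sup>+x. ennreal (gradsq \<psi> x) * indicator Q x \<partial>lborel)"
proof -
  note [measurable] = Q(1) W(1) borel_measurable_continuous_onI[OF smooth_continuous[OF \<psi>]]
    borel_measurable_continuous_onI[OF gradsq_continuous[OF \<psi>]]
  define \<mu> where "\<mu> = measure lborel Q"
  define A where "A = (cellint Q \<psi>)"
  define Gr where "Gr = (\<integral>\<^sup>+x. ennreal (gradsq \<psi> x) * indicator Q x \<partial>lborel)"
  have \<mu>: "\<mu> > 0" using m by (simp add: \<mu>_def)
  have em: "emeasure lborel Q = ennreal \<mu>"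
    using emeasure_bounded_finite[OF Q(3)] by (simp add: \<mu>_def emeasure_eq_ennreal_measure)
  \<comment> \<open>Integrating g = \<psi> - \<psi> x over Q gives \<mu> \<psi>(x) = A -
    \<open>cellint Q g\<close>; the square of the last integral is bounded by
    Cauchy-Schwarz.\<close>
  have pt: "ennreal (\<mu>\<^sup>2 * (cmod (\<psi> x))\<^sup>2) \<le> ennreal (2 * (cmod A)\<^sup>2) +
      ennreal (2 * \<mu>) * (\<integral>\<^sup>+y. esq (\<psi> y - \<psi> x) * indicator Q y \<partial>lborel)" for x
  proof -
    define g where "g y = \<psi> y - \<psi> x" for y
    have cg: "continuous_on UNIV g" unfolding g_def by (intro continuous_intros smooth_continuous[OF \<psi>])
    have i: "integrable (restrict_space lborel Q) \<psi>"
      by (rule norm_integral_squared_le(1)[OF Q(1,3) smooth_continuous[OF \<psi>]])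
    interpret finite_measure "restrict_space lborel Q"
      using em Q(1) by (intro finite_measureI) (simp add: emeasure_restrict_space space_restrict_space)
    have "(cellint Q g) = A - \<mu> *\<^sub>R \<psi> x"
      unfolding g_def A_def using i Q(1) by (simp add: space_restrict_space measure_restrict_space \<mu>_def)
    then have "\<mu> *\<^sub>R \<psi> x = A + - (cellint Q g)" by simp
    then have "(cmod (\<mu> *\<^sub>R \<psi> x))\<^sup>2 \<le> 2 * (cmod A)\<^sup>2 + 2 * (cmod (cellint Q g))\<^sup>2"
      using cmod_add_squared_le[of A "- (cellint Q g)"] by simp
    then have "ennreal (\<mu>\<^sup>2 * (cmod (\<psi> x))\<^sup>2) \<le> ennreal (2 * (cmod A)\<^sup>2 + 2 * (cmod (cellint Q g))\<^sup>2)"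
      by (intro ennreal_leI) (simp add: power_mult_distrib)
    also have "\<dots> = ennreal (2 * (cmod A)\<^sup>2) + 2 * esq (cellint Q g)"
      by (simp add: ennreal_mult')
    also have "\<dots> \<le> ennreal (2 * (cmod A)\<^sup>2) + 2 * (ennreal \<mu> * (\<integral>\<^sup>+y. esq (g y) * indicator Q y \<partial>lborel))"
      using norm_integral_squared_le(2)[OF Q(1,3) cg] by (intro add_left_mono mult_left_mono) (simp_all add: \<mu>_def)
    finally show ?thesis using \<mu> by (simp add: ennreal_mult' g_def mult.assoc)
  qed
  define X where "X = (\<integral>\<^sup>+x. esq (\<psi> x) * indicator Q x \<partial>lborel)"
  have "ennreal (\<mu>\<^sup>2) * X = (\<integral>\<^sup>+x. ennreal (\<mu>\<^sup>2 * (cmod (\<psi> x))\<^sup>2) * indicator Q x \<partial>lborel)"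
    unfolding X_def by (subst nn_integral_cmult[symmetric]) (auto simp: ennreal_mult' mult.assoc)
  also have "\<dots> \<le> (\<integral>\<^sup>+x. (ennreal (2 * (cmod A)\<^sup>2) +
      ennreal (2 * \<mu>) * (\<integral>\<^sup>+y. esq (\<psi> y - \<psi> x) * indicator Q y \<partial>lborel)) * indicator Q x \<partial>lborel)"
    by (intro nn_integral_mono mult_right_mono pt) simp
  also have "\<dots> = (\<integral>\<^sup>+x. ennreal (2 * (cmod A)\<^sup>2) * indicator Q x +
      ennreal (2 * \<mu>) * (\<integral>\<^sup>+y. esq (\<psi> y - \<psi> x) * (indicator Q x * indicator Q y) \<partial>lborel) \<partial>lborel)"
    by (intro nn_integral_cong) (auto simp: indicator_def)
  also have "\<dots> = ennreal (2 * (cmod A)\<^sup>2) * ennreal \<mu> + ennreal (2 * \<mu>) *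
      (\<integral>\<^sup>+x. \<integral>\<^sup>+y. esq (\<psi> y - \<psi> x) * (indicator Q x * indicator Q y) \<partial>lborel \<partial>lborel)"
    by (subst nn_integral_add) (auto simp: nn_integral_cmult em)
  also have "\<dots> \<le> ennreal (2 * (cmod A)\<^sup>2) * ennreal \<mu> + ennreal (2 * \<mu>) * (ennreal (\<rho>\<^sup>2) * emeasure lborel W * Gr)"
    unfolding Gr_def by (intro add_left_mono mult_left_mono double_difference_integral_le[OF \<psi> Q(1,2) W \<rho>]) simp_all
  also have "\<dots> \<le> ennreal (2 * (cmod A)\<^sup>2) * ennreal \<mu> + ennreal (2 * \<mu>) * (ennreal (\<rho>\<^sup>2) * ennreal (c * \<mu>) * Gr)"
    using c(1) by (intro add_left_mono mult_left_mono mult_right_mono) (simp_all add: \<mu>_def)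
  also have "\<dots> = ennreal (\<mu>\<^sup>2) * (ennreal (2 / \<mu> * (cmod A)\<^sup>2) + ennreal (2 * c * \<rho>\<^sup>2) * Gr)"
  proof -
    have 1: "ennreal (2 * (cmod A)\<^sup>2) * ennreal \<mu> = ennreal (\<mu>\<^sup>2) * ennreal (2 / \<mu> * (cmod A)\<^sup>2)"
      using \<mu> by (simp add: ennreal_mult'[symmetric] power2_eq_square field_simps)
    have 2: "ennreal (2 * \<mu>) * (ennreal (\<rho>\<^sup>2) * ennreal (c * \<mu>)) = ennreal (\<mu>\<^sup>2) * ennreal (2 * c * \<rho>\<^sup>2)"
      using \<mu> c(2) by (simp add: ennreal_mult'[symmetric] ennreal_mult[symmetric] power2_eq_square field_simps)
    show ?thesis unfolding distrib_left 1 using 2 by (simp only: mult.assoc[symmetric])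
  qed
  finally have "X \<le> ennreal (2 / \<mu> * (cmod A)\<^sup>2) + ennreal (2 * c * \<rho>\<^sup>2) * Gr"
    using \<mu> by (subst (asm) ennreal_mult_le_mult_iff) auto
  then show ?thesis by (simp only: X_def Gr_def \<mu>_def A_def)
qed

section \<open>Grid cells\<close>

text \<open>The half-open cube of the grid of mesh \<epsilon> that contains z. Comparing floors
  makes cells the classes of an equivalence relation, so two of them are equal or disjoint.\<close>

definition cell :: "real \<Rightarrow> 'a::euclidean_space \<Rightarrow> 'a set" where
  "cell \<epsilon> z = {x. \<forall>b\<in>Basis. \<lfloor>x \<bullet> b / \<epsilon>\<rfloor> = \<lfloor>z \<bullet> b / \<epsilon>\<rfloor>}"

lemma cell_self: "z \<in> cell \<epsilon> z"
  by (simp add: cell_def)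

lemma cell_eq: "x \<in> cell \<epsilon> z \<Longrightarrow> cell \<epsilon> x = cell \<epsilon> z"
  by (auto simp: cell_def)

lemma cell_borel [measurable]: "cell \<epsilon> z \<in> sets borel"
  unfolding cell_def by measurable

lemma cell_alt:
  assumes "\<epsilon> > 0"
  shows "cell \<epsilon> z = {x. \<forall>b\<in>Basis. \<epsilon> * \<lfloor>z \<bullet> b / \<epsilon>\<rfloor> \<le> x \<bullet> b \<and> x \<bullet> b < \<epsilon> * \<lfloor>z \<bullet> b / \<epsilon>\<rfloor> + \<epsilon>}"
  using assms by (auto simp: cell_def floor_eq_iff field_simps)

lemma cell_convex: 
  assumes "\<epsilon> > 0" shows "convex (cell \<epsilon> z)"
proof -
  have "cell \<epsilon> z = (\<Inter>b\<in>Basis. {x. b \<bullet> x \<ge> \<epsilon> * \<lfloor>z \<bullet> b / \<epsilon>\<rfloor>} \<inter> {x. b \<bullet> x < \<epsilon> * \<lfloor>z \<bullet> b / \<epsilon>\<rfloor> + \<epsilon>})"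
    unfolding cell_alt[OF assms] by (auto simp: inner_commute)
  then show ?thesis
    by (auto intro!: convex_INT convex_Int convex_halfspace_ge convex_halfspace_lt)
qed

lemma cell_diff_box:
  assumes "\<epsilon> > 0" "x \<in> cell \<epsilon> z" "y \<in> cell \<epsilon> z"
  shows "y - x \<in> box (- \<epsilon> *\<^sub>R One) (\<epsilon> *\<^sub>R One)"
  using assms(2,3) unfolding cell_alt[OF assms(1)] by (fastforce simp: box_def inner_diff_left)

lemma box_norm_le:
  fixes z :: "'a::euclidean_space"
  assumes "z \<in> box (- \<epsilon> *\<^sub>R One) (\<epsilon> *\<^sub>R One)"
  shows "norm z \<le> real DIM('a) * \<epsilon>"
proof -
  have "norm z \<le> (\<Sum>b\<in>Basis. \<bar>z \<bullet> b\<bar>)" by (rule norm_le_l1)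
  also have "\<dots> \<le> (\<Sum>b\<in>(Basis::'a set). \<epsilon>)"
    using assms by (intro sum_mono) (force simp: box_def)
  finally show ?thesis by simp
qed

lemma cell_bounded:
  assumes "\<epsilon> > 0" shows "bounded (cell \<epsilon> z)"
proof -
  have "cell \<epsilon> z \<subseteq> cball z (real DIM('a) * \<epsilon>)" for z :: 'a
  proof
    fix x assume "x \<in> cell \<epsilon> z"
    then have "norm (x - z) \<le> real DIM('a) * \<epsilon>"
      using box_norm_le[OF cell_diff_box[OF assms cell_self]] by blast
    then show "x \<in> cball z (real DIM('a) * \<epsilon>)" by (simp add: dist_norm norm_minus_commute)
  qed
  then show ?thesis using bounded_cball bounded_subset by blast
qed

lemma cell_measure:
  fixes z :: "'a::euclidean_space"
  assumes "\<epsilon> > 0"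
  shows "measure lborel (cell \<epsilon> z) \<ge> \<epsilon> ^ DIM('a)"
proof -
  define a where "a = (\<Sum>b\<in>Basis. (\<epsilon> * \<lfloor>z \<bullet> b / \<epsilon>\<rfloor>) *\<^sub>R b)"
  have a: "a \<bullet> b = \<epsilon> * \<lfloor>z \<bullet> b / \<epsilon>\<rfloor>" if "b \<in> Basis" for b
    using that by (simp add: a_def)
  have sub: "box a (a + \<epsilon> *\<^sub>R One) \<subseteq> cell \<epsilon> z"
    unfolding cell_alt[OF assms] by (auto simp: box_def a inner_add_left less_imp_le)
  have "\<epsilon> ^ DIM('a) = measure lborel (box a (a + \<epsilon> *\<^sub>R One))"
    using assms by (subst measure_lborel_box) (auto simp: inner_add_left)
  also have "\<dots> \<le> measure lborel (cell \<epsilon> z)"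
    using emeasure_bounded_finite[OF cell_bounded[OF assms, of z]]
    by (intro measure_mono_fmeasurable sub fmeasurableI) auto
  finally show ?thesis .
qed

text \<open>A cell is determined by its vector of floors, and boundedness confines these to a finite
  product of integer intervals. Restricting the vectors to \<open>Basis\<close> makes that product a
  finite set of functions.\<close>

lemma finite_cells:
  fixes A :: "'a::euclidean_space set"
  assumes "\<epsilon> > 0" "bounded A"
  shows "finite (cell \<epsilon> ` A)"
proof -
  obtain B where B: "\<And>x. x \<in> A \<Longrightarrow> norm x \<le> B" using assms(2) by (auto simp: bounded_iff)
  define k where "k x = restrict (\<lambda>b. \<lfloor>x \<bullet> b / \<epsilon>\<rfloor>) Basis" for x :: 'a
  define N where "N = \<lceil>B / \<epsilon>\<rceil> + 1"
  have "k x \<in> Pi\<^sub>E Basis (\<lambda>_. {- N..N})" if "x \<in> A" for x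
  proof -
    have "\<lfloor>x \<bullet> b / \<epsilon>\<rfloor> \<in> {- N..N}" if b: "b \<in> Basis" for b
    proof -
      have "\<bar>x \<bullet> b\<bar> \<le> B" using Basis_le_norm[OF b, of x] B[OF \<open>x \<in> A\<close>] by linarith
      then have "\<bar>x \<bullet> b / \<epsilon>\<bar> \<le> B / \<epsilon>" using assms(1) by (simp add: abs_divide divide_right_mono)
      then show ?thesis unfolding N_def by (auto, linarith+)
    qed
    then show ?thesis by (auto simp: k_def)
  qed
  then have "finite (k ` A)"
    by (intro finite_subset[OF _ finite_PiE[of "Basis :: 'a set" "\<lambda>_. {- N..N}"]]) auto
  moreover have "cell \<epsilon> ` A = (\<lambda>f. {x. \<forall>b\<in>Basis. \<lfloor>x \<bullet> b / \<epsilon>\<rfloor> = f b}) ` k ` A"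
    by (force simp: cell_def k_def image_image)
  ultimately show ?thesis by simp
qed

section \<open>Trace and Rellich estimates on Lipschitz domains\<close>

locale lipschitz_domain =
  fixes \<Omega> :: "'a::euclidean_space set"
  assumes lipschitz: "bounded_lipschitz_domain \<Omega>"

sublocale lipschitz_domain \<subseteq> bounded_open \<Omega>
  using lipschitz by unfold_locales (auto simp: bounded_lipschitz_domain_def)

context lipschitz_domain
begin

text \<open>Carries the norm from Bochner integrals over \<open>lebesgue_on\<close> to nonnegative
  integrals over \<open>lborel\<close>, where the segment and cell estimates are stated.\<close>

lemma nn_integral_H1_norm:
  assumes \<phi>: "smooth \<phi>"
  shows "(\<integral>\<^sup>+x. ennreal ((cmod (\<phi> x))\<^sup>2 + gradsq \<phi> x) * indicator \<Omega> x \<partial>lborel) = ennreal ((H1_norm \<Omega> \<phi>)\<^sup>2)"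
proof -
  let ?f = "\<lambda>x. (cmod (\<phi> x))\<^sup>2 + gradsq \<phi> x"
  have i: "integrable \<L> ?f"
    unfolding gradsq_def using \<phi>
    by (intro Bochner_Integration.integrable_add Bochner_Integration.integrable_sum L2_integrable continuous_L2 smooth_continuous smooth_partial)
  have m: "?f \<in> borel_measurable borel"
    by (intro borel_measurable_continuous_onI continuous_intros smooth_continuous gradsq_continuous \<phi>)
  have "ennreal ((H1_norm \<Omega> \<phi>)\<^sup>2) = ennreal (LINT x|\<L>. ?f x)"
    by (simp add: H1_norm_smooth_sq[OF \<phi>] gradsq_def)
  also have "\<dots> = (\<integral>\<^sup>+x. ennreal (?f x) \<partial>\<L>)"
    using i by (intro nn_integral_eq_integral[symmetric]) (auto simp: gradsq_nonneg)
  also have "\<dots> = (\<integral>\<^sup>+x. ennreal (?f x) * indicator \<Omega> x \<partial>lebesgue)"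
    using sets_\<Omega> by (simp add: nn_integral_restrict_space)
  also have "\<dots> = (\<integral>\<^sup>+x. ennreal (?f x) * indicator \<Omega> x \<partial>lborel)"
    by (rule nn_integral_completion)
  finally show ?thesis by simp
qed

lemma energy_le:
  assumes \<phi>: "smooth \<phi>"
  shows "(\<integral>\<^sup>+x. ennreal (energy T \<phi> x) * indicator \<Omega> x \<partial>lborel) \<le> ennreal ((2 + 2 * T\<^sup>2) * (H1_norm \<Omega> \<phi>)\<^sup>2)"
proof -
  have m: "(\<lambda>x. ennreal ((cmod (\<phi> x))\<^sup>2 + gradsq \<phi> x) * indicator \<Omega> x) \<in> borel_measurable borel"
  proof -
    have [measurable]: "(\<lambda>x. (cmod (\<phi> x))\<^sup>2 + gradsq \<phi> x) \<in> borel_measurable borel" "\<Omega> \<in> sets borel"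
      using open_\<Omega> by (auto intro!: borel_measurable_continuous_onI continuous_intros smooth_continuous gradsq_continuous \<phi>)
    show ?thesis by measurable
  qed
  have "energy T \<phi> x \<le> (2 + 2 * T\<^sup>2) * ((cmod (\<phi> x))\<^sup>2 + gradsq \<phi> x)" for x
    using gradsq_nonneg[of \<phi> x] by (simp add: energy_def distrib_left distrib_right)
  then have "ennreal (energy T \<phi> x) \<le> ennreal (2 + 2 * T\<^sup>2) * ennreal ((cmod (\<phi> x))\<^sup>2 + gradsq \<phi> x)" for x
    by (subst ennreal_mult[symmetric]) (auto intro: ennreal_leI simp: gradsq_nonneg simp del: ennreal_plus)
  then have "ennreal (energy T \<phi> x) * indicator \<Omega> x \<le> ennreal (2 + 2 * T\<^sup>2) * (ennreal ((cmod (\<phi> x))\<^sup>2 + gradsq \<phi> x) * indicator \<Omega> x)" for x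
    by (cases "x \<in> \<Omega>") (simp_all del: ennreal_plus)
  then have "(\<integral>\<^sup>+x. ennreal (energy T \<phi> x) * indicator \<Omega> x \<partial>lborel) \<le>
      (\<integral>\<^sup>+x. ennreal (2 + 2 * T\<^sup>2) * (ennreal ((cmod (\<phi> x))\<^sup>2 + gradsq \<phi> x) * indicator \<Omega> x) \<partial>lborel)"
    by (intro nn_integral_mono)
  also have "\<dots> = ennreal (2 + 2 * T\<^sup>2) * ennreal ((H1_norm \<Omega> \<phi>)\<^sup>2)"
    using m by (simp add: nn_integral_cmult nn_integral_H1_norm[OF \<phi>])
  finally show ?thesis by (simp add: ennreal_mult)
qed

lemma compact_frontier: "compact (frontier \<Omega>)"
  using bounded_\<Omega> compact_frontier_bounded by blast

lemma chart_exists: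
  assumes p: "p \<in> frontier \<Omega>"
  obtains U \<nu> h L R where "lipschitz_chart \<Omega> U \<nu> p h L R"
proof -
  obtain U \<nu> h L where c: "open U" "p \<in> U" "norm \<nu> = 1" "L-lipschitz_on {y. y \<bullet> \<nu> = 0} (h :: 'a \<Rightarrow> real)"
      "\<Omega> \<inter> U = {x \<in> U. x \<bullet> \<nu> > h (x - (x \<bullet> \<nu>) *\<^sub>R \<nu>)}"
    using lipschitz[unfolded bounded_lipschitz_domain_def, THEN conjunct2, THEN conjunct2, THEN conjunct2, THEN conjunct2, THEN bspec, OF p]
    by (elim exE conjE)
  obtain e where "e > 0" "ball p e \<subseteq> U" using c(1,2) by (rule openE)
  \<comment> \<open>Half of e, since the chart asks for the ball of twice its radius to lie in
    U.\<close>
  then have "lipschitz_chart \<Omega> U \<nu> p h L (e / 2)"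
    using c open_\<Omega> by unfold_locales auto
  then show thesis by (rule that)
qed

text \<open>Named predicates allow radii and constants to be chosen for all boundary points at once
  before compactness is applied.\<close>

definition local_trace_bound :: "'a \<Rightarrow> real \<Rightarrow> real \<Rightarrow> bool" where
  "local_trace_bound p R K \<longleftrightarrow> (\<forall>\<phi>. smooth \<phi> \<longrightarrow>
    (\<integral>\<^sup>+x. esq (\<phi> x) * indicator (frontier \<Omega> \<inter> ball p R) x \<partial>hausdorff_measure (DIM('a) - 1)) \<le>
    ennreal (K * (H1_norm \<Omega> \<phi>)\<^sup>2))"

text \<open>The nearby boundary point has to lie in the same ball, where the chart knows its height
  to be 0.\<close>

definition local_strip_bound :: "'a \<Rightarrow> real \<Rightarrow> real \<Rightarrow> bool" where
  "local_strip_bound p R K \<longleftrightarrow> (\<forall>\<phi> \<tau> Z. smooth \<phi> \<longrightarrow> \<tau> \<ge> 0 \<longrightarrow> Z \<in> sets borel \<longrightarrow>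
    Z \<subseteq> {x \<in> \<Omega> \<inter> ball p R. \<exists>y\<in>frontier \<Omega> \<inter> ball p R. dist x y \<le> \<tau>} \<longrightarrow>
    (\<integral>\<^sup>+x. esq (\<phi> x) * indicator Z x \<partial>lborel) \<le> ennreal (K * \<tau> * (H1_norm \<Omega> \<phi>)\<^sup>2))"

definition trace_bound :: "real \<Rightarrow> bool" where
  "trace_bound K \<longleftrightarrow> (\<forall>\<phi>. smooth \<phi> \<longrightarrow>
    (\<integral>\<^sup>+x. esq (\<phi> x) \<partial>surface_measure \<Omega>) \<le> ennreal (K * (H1_norm \<Omega> \<phi>)\<^sup>2))"

definition strip_bound :: "real \<Rightarrow> real \<Rightarrow> bool" where
  "strip_bound \<rho> K \<longleftrightarrow> (\<forall>\<phi> \<tau> Z. smooth \<phi> \<longrightarrow> \<tau> \<ge> 0 \<longrightarrow> \<tau> < \<rho> \<longrightarrow> Z \<in> sets borel \<longrightarrow>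
    Z \<subseteq> {x \<in> \<Omega>. \<exists>y\<in>frontier \<Omega>. dist x y \<le> \<tau>} \<longrightarrow>
    (\<integral>\<^sup>+x. esq (\<phi> x) * indicator Z x \<partial>lborel) \<le> ennreal (K * \<tau> * (H1_norm \<Omega> \<phi>)\<^sup>2))"

lemma local_estimates:
  assumes p: "p \<in> frontier \<Omega>"
  shows "\<exists>R K. R > 0 \<and> K \<ge> 0 \<and> local_trace_bound p R K \<and> local_strip_bound p R K"
proof -
  obtain U \<nu> h L R where "lipschitz_chart \<Omega> U \<nu> p h L R" using chart_exists[OF p] .
  then interpret C: lipschitz_chart \<Omega> U \<nu> p h L R .
  define c where "c = 2 + 2 * R\<^sup>2"
  have c: "c > 0" unfolding c_def by (simp add: add_pos_nonneg)
  define K where "K = max (C.K1 * c) ((1 + L) * c / R)"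
  have sub: "ball p R \<subseteq> U"
    using C.ball_U subset_ball[of R "2 * R" p] C.R by auto
  show ?thesis
    unfolding local_trace_bound_def local_strip_bound_def
  proof (intro exI conjI allI impI)
    show "R > 0" by (rule C.R)
    show K: "K \<ge> 0" using C.K1_pos c by (simp add: K_def le_max_iff_disj)
    show "(\<integral>\<^sup>+x. esq (\<phi> x) * indicator (frontier \<Omega> \<inter> ball p R) x \<partial>hausdorff_measure (DIM('a) - 1)) \<le>
      ennreal (K * (H1_norm \<Omega> \<phi>)\<^sup>2)" if \<phi>: "smooth \<phi>" for \<phi>
    proof -
      have "(\<integral>\<^sup>+x. esq (\<phi> x) * indicator (frontier \<Omega> \<inter> ball p R) x \<partial>hausdorff_measure (DIM('a) - 1)) \<le>
          ennreal C.K1 * (\<integral>\<^sup>+x. ennreal (energy R \<phi> x) * indicator \<Omega> x \<partial>lborel)"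
        by (rule C.trace_estimate[OF \<phi>])
      also have "\<dots> \<le> ennreal C.K1 * ennreal (c * (H1_norm \<Omega> \<phi>)\<^sup>2)"
        unfolding c_def by (intro mult_left_mono energy_le[OF \<phi>]) simp
      also have "\<dots> = ennreal (C.K1 * c * (H1_norm \<Omega> \<phi>)\<^sup>2)"
        using C.K1_pos c by (simp add: ennreal_mult'[symmetric] mult.assoc)
      also have "\<dots> \<le> ennreal (K * (H1_norm \<Omega> \<phi>)\<^sup>2)"
        by (intro ennreal_leI mult_right_mono) (auto simp: K_def)
      finally show ?thesis .
    qed
    fix \<phi> :: "'a \<Rightarrow> complex" and \<tau> :: real and Z :: "'a set"
    assume \<phi>: "smooth \<phi>" and \<tau>: "\<tau> \<ge> 0" and Z: "Z \<in> sets borel"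
      "Z \<subseteq> {x \<in> \<Omega> \<inter> ball p R. \<exists>y\<in>frontier \<Omega> \<inter> ball p R. dist x y \<le> \<tau>}"
    \<comment> \<open>The height is Lipschitz with constant 1 + L and vanishes at the nearby
      boundary point, so distance at most \<tau> means height at most this.\<close>
    define \<tau>' where "\<tau>' = (1 + L) * \<tau>"
    have \<tau>': "\<tau>' \<ge> 0" using \<tau> C.L_nonneg by (simp add: \<tau>'_def)
    have Z': "Z \<subseteq> {x \<in> ball p R. 0 < C.s x \<and> C.s x \<le> \<tau>'}"
    proof
      fix x assume "x \<in> Z"
      then obtain y where x: "x \<in> \<Omega>" "x \<in> ball p R" and y: "y \<in> frontier \<Omega>" "y \<in> ball p R" "dist x y \<le> \<tau>"
        using Z(2) by blast
      have "C.s y = 0" using C.s_frontier y sub by blast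
      then have "\<bar>C.s x\<bar> \<le> (1 + L) * norm (x - y)" using C.s_lipschitz[of x y] by simp
      also have "\<dots> \<le> \<tau>'" unfolding \<tau>'_def using y(3) C.L_nonneg by (intro mult_left_mono) (auto simp: dist_norm)
      finally have "C.s x \<le> \<tau>'" by simp
      moreover have "0 < C.s x" using C.in_\<Omega>_iff x sub by blast
      ultimately show "x \<in> {x \<in> ball p R. 0 < C.s x \<and> C.s x \<le> \<tau>'}" using x by simp
    qed
    let ?I = "\<integral>\<^sup>+x. esq (\<phi> x) * indicator Z x \<partial>lborel"
    have "ennreal R * ?I \<le> ennreal \<tau>' * (\<integral>\<^sup>+x. ennreal (energy R \<phi> x) * indicator \<Omega> x \<partial>lborel)"
      by (rule C.strip_estimate[OF \<phi> \<tau>' Z(1) Z'])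
    also have "\<dots> \<le> ennreal \<tau>' * ennreal (c * (H1_norm \<Omega> \<phi>)\<^sup>2)"
      unfolding c_def by (intro mult_left_mono energy_le[OF \<phi>]) simp
    also have "\<dots> = ennreal R * ennreal ((1 + L) * c / R * \<tau> * (H1_norm \<Omega> \<phi>)\<^sup>2)"
    proof -
      have "\<tau>' * (c * (H1_norm \<Omega> \<phi>)\<^sup>2) = R * ((1 + L) * c / R * \<tau> * (H1_norm \<Omega> \<phi>)\<^sup>2)"
        using C.R by (simp add: \<tau>'_def)
      then show ?thesis using \<tau>' C.R by (simp only: ennreal_mult'[symmetric] less_imp_le)
    qed
    finally have "?I \<le> ennreal ((1 + L) * c / R * \<tau> * (H1_norm \<Omega> \<phi>)\<^sup>2)"
      using C.R by (subst (asm) ennreal_mult_le_mult_iff) auto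
    also have "\<dots> \<le> ennreal (K * \<tau> * (H1_norm \<Omega> \<phi>)\<^sup>2)"
      using \<tau> by (intro ennreal_leI mult_right_mono) (auto simp: K_def)
    finally show "?I \<le> ennreal (K * \<tau> * (H1_norm \<Omega> \<phi>)\<^sup>2)" .
  qed
qed

text \<open>The boundary is covered by finitely many balls of half the chart radius. The other half
  leaves room for points of \<Omega> that are merely close to such a ball; the local constants are
  summed.\<close>

lemma global_estimates:
  obtains K \<rho> where "K \<ge> 0" "\<rho> > 0" "trace_bound K" "strip_bound \<rho> K"
proof -
  obtain R K where RK: "\<And>p. p \<in> frontier \<Omega> \<Longrightarrow>
      R p > 0 \<and> K p \<ge> 0 \<and> local_trace_bound p (R p) (K p) \<and> local_strip_bound p (R p) (K p)"
    using local_estimates by metis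
  then have R: "R p > 0" and K: "K p \<ge> 0" if "p \<in> frontier \<Omega>" for p
    using that by auto
  obtain F where F: "F \<subseteq> frontier \<Omega>" "finite F" "frontier \<Omega> \<subseteq> (\<Union>p\<in>F. ball p (R p / 2))"
  proof (rule compactE_image[OF compact_frontier, of "frontier \<Omega>" "\<lambda>p. ball p (R p / 2)"])
    show "frontier \<Omega> \<subseteq> (\<Union>p\<in>frontier \<Omega>. ball p (R p / 2))"
      using R by force
  qed auto
  \<comment> \<open>The element 1 keeps the minimum over a nonempty set.\<close>
  define \<rho> where "\<rho> = Min (insert 1 ((\<lambda>p. R p / 2) ` F))"
  have \<rho>: "\<rho> > 0" "\<And>p. p \<in> F \<Longrightarrow> \<rho> \<le> R p / 2"
  proof -
    show "\<rho> > 0" using F R by (auto simp: \<rho>_def)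
    show "\<rho> \<le> R p / 2" if "p \<in> F" for p unfolding \<rho>_def by (rule Min_le) (use F that in auto)
  qed
  show thesis
  proof
    show "\<rho> > 0" by (rule \<rho>(1))
    show "(\<Sum>p\<in>F. K p) \<ge> 0" using K F by (intro sum_nonneg) auto
  next
    show "trace_bound (\<Sum>p\<in>F. K p)"
      unfolding trace_bound_def
    proof (intro allI impI)
      fix \<phi> :: "'a \<Rightarrow> complex" assume \<phi>: "smooth \<phi>"
      let ?H = "hausdorff_measure (DIM('a) - 1) :: 'a measure"
      show "(\<integral>\<^sup>+x. esq (\<phi> x) \<partial>surface_measure \<Omega>) \<le> ennreal ((\<Sum>p\<in>F. K p) * (H1_norm \<Omega> \<phi>)\<^sup>2)"
      proof -
        have m: "(\<lambda>x. esq (\<phi> x)) \<in> borel_measurable borel"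
          by (intro measurable_compose[OF _ measurable_ennreal] borel_measurable_continuous_onI continuous_intros smooth_continuous \<phi>)
        have "(\<integral>\<^sup>+x. esq (\<phi> x) \<partial>surface_measure \<Omega>) = (\<integral>\<^sup>+x. esq (\<phi> x) * indicator (frontier \<Omega>) x \<partial>?H)"
          unfolding surface_measure_def by (intro nn_integral_restrict_space) simp
        also have "\<dots> \<le> (\<integral>\<^sup>+x. (\<Sum>p\<in>F. esq (\<phi> x) * indicator (frontier \<Omega> \<inter> ball p (R p)) x) \<partial>?H)"
        proof (rule nn_integral_mono)
          fix x
          show "esq (\<phi> x) * indicator (frontier \<Omega>) x \<le> (\<Sum>p\<in>F. esq (\<phi> x) * indicator (frontier \<Omega> \<inter> ball p (R p)) x)"
          proof (cases "x \<in> frontier \<Omega>")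
            case True
            then obtain p where p: "p \<in> F" "x \<in> ball p (R p / 2)" using F(3) by blast
            then have "x \<in> ball p (R p)" using subset_ball[of "R p / 2" "R p" p] R[of p] F(1) by auto
            then have "esq (\<phi> x) * indicator (frontier \<Omega>) x = esq (\<phi> x) * indicator (frontier \<Omega> \<inter> ball p (R p)) x"
              using True by simp
            also have "\<dots> \<le> (\<Sum>p\<in>F. esq (\<phi> x) * indicator (frontier \<Omega> \<inter> ball p (R p)) x)"
              using F(2) p(1) by (intro member_le_sum) auto
            finally show ?thesis .
          qed simp
        qed
        also have "\<dots> = (\<Sum>p\<in>F. \<integral>\<^sup>+x. esq (\<phi> x) * indicator (frontier \<Omega> \<inter> ball p (R p)) x \<partial>?H)"
          using m by (intro nn_integral_sum) (auto intro!: borel_measurable_times_ennreal borel_measurable_indicator)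
        also have "\<dots> \<le> (\<Sum>p\<in>F. ennreal (K p * (H1_norm \<Omega> \<phi>)\<^sup>2))"
          using RK F(1) \<phi> unfolding local_trace_bound_def by (intro sum_mono) blast
        also have "\<dots> = ennreal ((\<Sum>p\<in>F. K p) * (H1_norm \<Omega> \<phi>)\<^sup>2)"
          using K F(1) by (subst sum_ennreal) (auto simp: sum_distrib_right)
        finally show ?thesis .
      qed
    qed
  next
    show "strip_bound \<rho> (\<Sum>p\<in>F. K p)"
      unfolding strip_bound_def
    proof (intro allI impI)
      fix \<phi> :: "'a \<Rightarrow> complex" and \<tau> :: real and Z :: "'a set"
      assume \<phi>: "smooth \<phi>" and \<tau>: "\<tau> \<ge> 0" "\<tau> < \<rho>" and Z: "Z \<in> sets borel"
        "Z \<subseteq> {x \<in> \<Omega>. \<exists>y\<in>frontier \<Omega>. dist x y \<le> \<tau>}"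
      \<comment> \<open>Closed half balls and \<open>infdist\<close> split the strip into Borel
        pieces: the sublevel set of a distance is closed, and on a closed set the distance is
        attained at a boundary point.\<close>
      define C where "C p = frontier \<Omega> \<inter> cball p (R p / 2)" for p
      define S where "S p = Z \<inter> {x. infdist x (C p) \<le> \<tau>}" for p
      have Cc: "closed (C p)" for p unfolding C_def by (intro closed_Int frontier_closed closed_cball)
      have Cn: "p \<in> C p" if "p \<in> F" for p using that F(1) R[of p] by (auto simp: C_def)
      have Sb: "S p \<in> sets borel" for p
      proof -
        have "closed {x. infdist x (C p) \<le> \<tau>}"
          by (intro closed_Collect_le continuous_intros)
        then show ?thesis using Z(1) by (auto simp: S_def)
      qed
      have Ssub: "S p \<subseteq> {x \<in> \<Omega> \<inter> ball p (R p). \<exists>y\<in>frontier \<Omega> \<inter> ball p (R p). dist x y \<le> \<tau>}" if p: "p \<in> F" for p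
      proof
        fix x assume x: "x \<in> S p"
        obtain y where y: "y \<in> C p" "infdist x (C p) = dist x y"
          using infdist_attains_inf[OF Cc, of p x] Cn[OF p] by blast
        have d: "dist x y \<le> \<tau>" using x y by (simp add: S_def)
        have yb: "dist p y \<le> R p / 2" "y \<in> frontier \<Omega>" using y(1) by (auto simp: C_def)
        have "dist p x \<le> dist p y + dist y x" by (rule dist_triangle)
        then have "dist p x < R p" using d yb \<tau>(2) \<rho>(2)[OF p] by (simp add: dist_commute)
        moreover have "dist p y < R p" using yb R[of p] F(1) p by auto
        ultimately show "x \<in> {x \<in> \<Omega> \<inter> ball p (R p). \<exists>y\<in>frontier \<Omega> \<inter> ball p (R p). dist x y \<le> \<tau>}"
          using x d yb Z(2) by (auto simp: S_def)
      qed
      have cover: "\<exists>p\<in>F. x \<in> S p" if x: "x \<in> Z" for x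
      proof -
        obtain y where y: "y \<in> frontier \<Omega>" "dist x y \<le> \<tau>" using Z(2) x by blast
        then obtain p where p: "p \<in> F" "y \<in> ball p (R p / 2)" using F(3) by blast
        then have "y \<in> C p" using y by (simp add: C_def)
        then have "infdist x (C p) \<le> \<tau>" using y(2) infdist_le order_trans by blast
        then show ?thesis using p x by (auto simp: S_def)
      qed
      have m: "(\<lambda>x. esq (\<phi> x)) \<in> borel_measurable borel"
        by (intro measurable_compose[OF _ measurable_ennreal] borel_measurable_continuous_onI continuous_intros smooth_continuous \<phi>)
      have "(\<integral>\<^sup>+x. esq (\<phi> x) * indicator Z x \<partial>lborel) \<le> (\<integral>\<^sup>+x. (\<Sum>p\<in>F. esq (\<phi> x) * indicator (S p) x) \<partial>lborel)"
      proof (rule nn_integral_mono)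
        fix x
        show "esq (\<phi> x) * indicator Z x \<le> (\<Sum>p\<in>F. esq (\<phi> x) * indicator (S p) x)"
        proof (cases "x \<in> Z")
          case True
          then obtain p where p: "p \<in> F" "x \<in> S p" using cover by blast
          then have "esq (\<phi> x) * indicator Z x = esq (\<phi> x) * indicator (S p) x"
            using True by simp
          also have "\<dots> \<le> (\<Sum>p\<in>F. esq (\<phi> x) * indicator (S p) x)"
            using F(2) p(1) by (intro member_le_sum) auto
          finally show ?thesis .
        qed simp
      qed
      also have "\<dots> = (\<Sum>p\<in>F. \<integral>\<^sup>+x. esq (\<phi> x) * indicator (S p) x \<partial>lborel)"
        using m Sb by (intro nn_integral_sum) (auto intro!: borel_measurable_times_ennreal borel_measurable_indicator)
      also have "\<dots> \<le> (\<Sum>p\<in>F. ennreal (K p * \<tau> * (H1_norm \<Omega> \<phi>)\<^sup>2))"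
      proof (rule sum_mono)
        fix p assume p: "p \<in> F"
        show "(\<integral>\<^sup>+x. esq (\<phi> x) * indicator (S p) x \<partial>lborel) \<le> ennreal (K p * \<tau> * (H1_norm \<Omega> \<phi>)\<^sup>2)"
          using RK[of p] F(1) p \<phi> \<tau>(1) Sb Ssub[OF p] unfolding local_strip_bound_def by blast
      qed
      also have "\<dots> = ennreal ((\<Sum>p\<in>F. K p) * \<tau> * (H1_norm \<Omega> \<phi>)\<^sup>2)"
        using K F(1) \<tau>(1) by (subst sum_ennreal) (auto simp: sum_distrib_right)
      finally show "(\<integral>\<^sup>+x. esq (\<phi> x) * indicator Z x \<partial>lborel) \<le> ennreal ((\<Sum>p\<in>F. K p) * \<tau> * (H1_norm \<Omega> \<phi>)\<^sup>2)" .
    qed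
  qed
qed

lemma sets_surface: "f \<in> borel_measurable borel \<Longrightarrow> f \<in> borel_measurable (surface_measure \<Omega>)"
  unfolding surface_measure_def by (rule measurable_restrict_space1) simp

text \<open>The trace bound is applied to the constant function 1.\<close>

lemma finite_surface_measure: "finite_measure (surface_measure \<Omega>)"
proof (rule finite_measureI)
  obtain K \<rho> where K0: "K \<ge> 0" "\<rho> > 0" "trace_bound K" "strip_bound \<rho> K"
    by (rule global_estimates)
  note K = K0(3)[unfolded trace_bound_def, rule_format]
  have "emeasure (surface_measure \<Omega>) (space (surface_measure \<Omega>)) \<le> ennreal (K * (H1_norm \<Omega> (\<lambda>x. 1))\<^sup>2)"
    using K[OF smooth_const[of 1]] by simp
  also have "\<dots> < \<infinity>" by simp
  finally show "emeasure (surface_measure \<Omega>) (space (surface_measure \<Omega>)) \<noteq> \<infinity>" by simp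
qed

lemma smooth_L2_surface:
  assumes "smooth \<phi>" shows "\<phi> \<in> L2 (surface_measure \<Omega>)"
proof -
  obtain K \<rho> where K0: "K \<ge> 0" "\<rho> > 0" "trace_bound K" "strip_bound \<rho> K"
    by (rule global_estimates)
  note K = K0(3)[unfolded trace_bound_def, rule_format]
  have m: "\<phi> \<in> borel_measurable (surface_measure \<Omega>)"
    by (intro sets_surface borel_measurable_continuous_onI smooth_continuous assms)
  show ?thesis
    unfolding L2_def mem_Collect_eq
  proof (intro conjI m integrableI_bounded)
    show "(\<lambda>x. (cmod (\<phi> x))\<^sup>2) \<in> borel_measurable (surface_measure \<Omega>)" using m by measurable
    show "(\<integral>\<^sup>+x. ennreal (norm ((cmod (\<phi> x))\<^sup>2)) \<partial>surface_measure \<Omega>) < \<infinity>"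
      using le_less_trans[OF K[OF assms], of \<infinity>] by simp
  qed
qed

lemma trace_inequality:
  obtains K where "K \<ge> 0" "\<And>\<phi>. smooth \<phi> \<Longrightarrow> L2_norm (surface_measure \<Omega>) \<phi> \<le> K * H1_norm \<Omega> \<phi>"
proof -
  obtain K \<rho> where K0: "K \<ge> 0" "\<rho> > 0" "trace_bound K" "strip_bound \<rho> K"
    by (rule global_estimates)
  note K = K0(3)[unfolded trace_bound_def, rule_format]
  show thesis
  proof
    show "sqrt K \<ge> 0" using K0 by simp
    fix \<phi> :: "'a \<Rightarrow> complex" assume \<phi>: "smooth \<phi>"
    have "ennreal (LINT x|surface_measure \<Omega>. (cmod (\<phi> x))\<^sup>2) = (\<integral>\<^sup>+x. esq (\<phi> x) \<partial>surface_measure \<Omega>)"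
      by (rule nn_integral_eq_integral[symmetric]) (auto intro: L2_integrable smooth_L2_surface \<phi>)
    also have "\<dots> \<le> ennreal (K * (H1_norm \<Omega> \<phi>)\<^sup>2)" by (rule K[OF \<phi>])
    finally have "(LINT x|surface_measure \<Omega>. (cmod (\<phi> x))\<^sup>2) \<le> K * (H1_norm \<Omega> \<phi>)\<^sup>2"
      using K0(1) by (subst (asm) ennreal_le_iff) auto
    then have "sqrt (LINT x|surface_measure \<Omega>. (cmod (\<phi> x))\<^sup>2) \<le> sqrt (K * (H1_norm \<Omega> \<phi>)\<^sup>2)"
      by (rule real_sqrt_le_mono)
    then show "L2_norm (surface_measure \<Omega>) \<phi> \<le> sqrt K * H1_norm \<Omega> \<phi>"
      unfolding L2_norm_def using H1_norm_nonneg[OF smooth_H1[OF \<phi>]] by (simp add: real_sqrt_mult)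
  qed
qed

section \<open>From grid cells to Rellich's theorem\<close>

lemma L2_norm_le_H1_norm:
  assumes u: "u \<in> H1 \<Omega>"
  shows "L2_norm \<L> u \<le> H1_norm \<Omega> u"
proof (rule power2_le_imp_le[OF _ H1_norm_nonneg[OF u]])
  show "(L2_norm \<L> u)\<^sup>2 \<le> (H1_norm \<Omega> u)\<^sup>2"
    unfolding H1_norm_sq[OF u] by (simp add: sum_nonneg)
qed

lemma nn_integral_L2_norm:
  assumes \<phi>: "smooth \<phi>"
  shows "(\<integral>\<^sup>+x. esq (\<phi> x) * indicator \<Omega> x \<partial>lborel) = ennreal ((L2_norm \<L> \<phi>)\<^sup>2)"
proof -
  have m: "(\<lambda>x. (cmod (\<phi> x))\<^sup>2) \<in> borel_measurable borel"
    by (intro borel_measurable_continuous_onI continuous_intros smooth_continuous \<phi>)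
  have "ennreal ((L2_norm \<L> \<phi>)\<^sup>2) = (\<integral>\<^sup>+x. esq (\<phi> x) \<partial>\<L>)"
    unfolding L2_norm_sq by (intro nn_integral_eq_integral[symmetric]) (auto intro: L2_integrable continuous_L2 smooth_continuous \<phi>)
  also have "\<dots> = (\<integral>\<^sup>+x. esq (\<phi> x) * indicator \<Omega> x \<partial>lebesgue)"
    using sets_\<Omega> by (simp add: nn_integral_restrict_space)
  also have "\<dots> = (\<integral>\<^sup>+x. esq (\<phi> x) * indicator \<Omega> x \<partial>lborel)"
    by (rule nn_integral_completion)
  finally show ?thesis by simp
qed

text \<open>The Poincare inequality handles the grid cells contained in \<open>\<Omega>\<close>, the strip estimate those
  meeting the boundary.\<close>

lemma L2_norm_le_cell_integrals:
  assumes e: "e > 0"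
  obtains C c where "finite C" "\<And>Q. Q \<in> C \<Longrightarrow> Q \<in> sets borel \<and> bounded Q \<and> Q \<subseteq> \<Omega>" "c \<ge> 0"
    "\<And>\<psi>. smooth \<psi> \<Longrightarrow> (L2_norm \<L> \<psi>)\<^sup>2 \<le>
      c * (\<Sum>Q\<in>C. (cmod (cellint Q \<psi>))\<^sup>2) + e * (H1_norm \<Omega> \<psi>)\<^sup>2"
proof -
  let ?d = "real DIM('a)"
  obtain K \<rho> where K: "K \<ge> 0" "\<rho> > 0" "trace_bound K" "strip_bound \<rho> K"
    by (rule global_estimates)
  \<comment> \<open>Volume ratio of the box of differences, of side 2 \<epsilon>, to a cell of side
    \<epsilon>.\<close>
  define w :: real where "w = 2 ^ DIM('a)"
  \<comment> \<open>The first summand is the Poincare constant of a cell of diameter at most d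
    \<epsilon>, the second the strip constant at width d \<epsilon>. Both vanish with the mesh, so
    some mesh makes the sum smaller than e.\<close>
  have "((\<lambda>\<epsilon>. 2 * w * (?d * \<epsilon>)\<^sup>2 + K * (?d * \<epsilon>)) \<longlongrightarrow> 2 * w * (?d * 0)\<^sup>2 + K * (?d * 0)) (at_right 0)"
    by (intro tendsto_intros)
  then have ev1: "\<forall>\<^sub>F \<epsilon> in at_right 0. 2 * w * (?d * \<epsilon>)\<^sup>2 + K * (?d * \<epsilon>) < e"
    using e by (intro order_tendstoD) auto
  have "((\<lambda>\<epsilon>. ?d * \<epsilon>) \<longlongrightarrow> ?d * 0) (at_right 0)" by (intro tendsto_intros)
  then have ev2: "\<forall>\<^sub>F \<epsilon> in at_right 0. ?d * \<epsilon> < \<rho>"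
    using K(2) by (intro order_tendstoD) auto
  have ev3: "\<forall>\<^sub>F \<epsilon> in at_right 0. (0::real) < \<epsilon>" by (rule eventually_at_right_less)
  obtain \<epsilon> where \<epsilon>: "2 * w * (?d * \<epsilon>)\<^sup>2 + K * (?d * \<epsilon>) < e" "?d * \<epsilon> < \<rho>" "0 < \<epsilon>"
    using eventually_happens'[OF trivial_limit_at_right_real[of 0] eventually_conj[OF ev1 eventually_conj[OF ev2 ev3]]] by blast
  define C where "C = {Q \<in> cell \<epsilon> ` \<Omega>. Q \<subseteq> \<Omega>}"
  have fin: "finite C" unfolding C_def using finite_cells[OF \<epsilon>(3) bounded_\<Omega>] by simp
  have C: "Q \<in> sets borel" "bounded Q" "Q \<subseteq> \<Omega>" "convex Q" "measure lborel Q \<ge> \<epsilon> ^ DIM('a)"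
      "\<And>x y. x \<in> Q \<Longrightarrow> y \<in> Q \<Longrightarrow> y - x \<in> box (- \<epsilon> *\<^sub>R One) (\<epsilon> *\<^sub>R One)" if "Q \<in> C" for Q
  proof -
    obtain z where z: "Q = cell \<epsilon> z" using \<open>Q \<in> C\<close> by (auto simp: C_def)
    show "Q \<in> sets borel" "bounded Q" "Q \<subseteq> \<Omega>" "convex Q" "measure lborel Q \<ge> \<epsilon> ^ DIM('a)"
      using that cell_bounded[OF \<epsilon>(3)] cell_convex[OF \<epsilon>(3)] cell_measure[OF \<epsilon>(3)] by (auto simp: z C_def)
    show "y - x \<in> box (- \<epsilon> *\<^sub>R One) (\<epsilon> *\<^sub>R One)" if "x \<in> Q" "y \<in> Q" for x y
      using that cell_diff_box[OF \<epsilon>(3)] unfolding z by blast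
  qed
  define Z where "Z = \<Omega> - \<Union>C"
  have Zb: "Z \<in> sets borel"
    unfolding Z_def using fin C(1) open_\<Omega> by (intro sets.Diff sets.finite_Union) auto
  have Zsub: "Z \<subseteq> {x \<in> \<Omega>. \<exists>y\<in>frontier \<Omega>. dist x y \<le> ?d * \<epsilon>}"
  proof
    fix x assume x: "x \<in> Z"
    then have "x \<in> \<Omega>" by (simp add: Z_def)
    have "\<not> cell \<epsilon> x \<subseteq> \<Omega>"
      using x \<open>x \<in> \<Omega>\<close> cell_self[of x \<epsilon>] by (auto simp: Z_def C_def)
    \<comment> \<open>A convex, hence connected, set that meets \<Omega> without being contained in
      it meets the boundary.\<close>
    then have "cell \<epsilon> x \<inter> frontier \<Omega> \<noteq> {}"
      using \<open>x \<in> \<Omega>\<close> cell_self[of x \<epsilon>]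
      by (intro connected_Int_frontier convex_connected cell_convex \<epsilon>(3)) auto
    then obtain y where y: "y \<in> cell \<epsilon> x" "y \<in> frontier \<Omega>" by blast
    have "norm (x - y) \<le> ?d * \<epsilon>"
      by (rule box_norm_le[OF cell_diff_box[OF \<epsilon>(3) y(1) cell_self]])
    then show "x \<in> {x \<in> \<Omega>. \<exists>y\<in>frontier \<Omega>. dist x y \<le> ?d * \<epsilon>}"
      using \<open>x \<in> \<Omega>\<close> y(2) by (auto simp: dist_norm)
  qed
  have disj: "Q = Q'" if a: "Q \<in> C" "Q' \<in> C" "x \<in> Q" "x \<in> Q'" for Q Q' x
  proof -
    obtain z z' where "Q = cell \<epsilon> z" "Q' = cell \<epsilon> z'" using a(1,2) by (auto simp: C_def)
    then show ?thesis using cell_eq[of x \<epsilon> z] cell_eq[of x \<epsilon> z'] a(3,4) by simp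
  qed
  \<comment> \<open>Upper bound for the Poincare factor 2 / |Q|, as each cell has volume at least
    \<epsilon>^d.\<close>
  define c where "c = 2 / \<epsilon> ^ DIM('a)"
  show thesis
  proof
    show "finite C" by (rule fin)
    show "Q \<in> sets borel \<and> bounded Q \<and> Q \<subseteq> \<Omega>" if "Q \<in> C" for Q using C[OF that] by blast
    show "c \<ge> 0" using \<epsilon>(3) by (simp add: c_def)
    fix \<psi> :: "'a \<Rightarrow> complex" assume \<psi>: "smooth \<psi>"
    define I where "I Q = (cmod (cellint Q \<psi>))\<^sup>2" for Q
    define N where "N = (H1_norm \<Omega> \<psi>)\<^sup>2"
    have [measurable]: "(\<lambda>x. esq (\<psi> x)) \<in> borel_measurable borel"
      "(\<lambda>x. ennreal (gradsq \<psi> x)) \<in> borel_measurable borel"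
      by (intro measurable_compose[OF _ measurable_ennreal] borel_measurable_continuous_onI continuous_intros smooth_continuous gradsq_continuous \<psi>)+
    have ind: "indicator \<Omega> x = (\<Sum>Q\<in>C. indicator Q x) + (indicator Z x :: ennreal)" for x
    proof (cases "\<exists>Q\<in>C. x \<in> Q")
      case True
      then obtain Q where Q: "Q \<in> C" "x \<in> Q" by blast
      have "(\<Sum>Q\<in>C. indicator Q x) = (\<Sum>Q'\<in>C. if Q' = Q then 1 else (0::ennreal))"
      proof (rule sum.cong[OF refl])
        fix Q' assume "Q' \<in> C"
        then have "x \<in> Q' \<longleftrightarrow> Q' = Q" using disj[OF _ Q(1) _ Q(2)] Q(2) by blast
        then show "indicator Q' x = (if Q' = Q then 1 else (0::ennreal))" by (simp add: indicator_def)
      qed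
      also have "\<dots> = 1" using fin Q(1) by simp
      finally show ?thesis using Q C(3)[OF Q(1)] by (auto simp: Z_def indicator_def)
    next
      case False
      then show ?thesis by (auto simp: Z_def indicator_def)
    qed
    have cellle: "(\<integral>\<^sup>+x. esq (\<psi> x) * indicator Q x \<partial>lborel) \<le>
        ennreal (c * I Q) + ennreal (2 * w * (?d * \<epsilon>)\<^sup>2) * (\<integral>\<^sup>+x. ennreal (gradsq \<psi> x) * indicator Q x \<partial>lborel)"
      if Q: "Q \<in> C" for Q
    proof -
      have pos: "\<epsilon> ^ DIM('a) > 0" using \<epsilon>(3) by simp
      have "(\<integral>\<^sup>+x. esq (\<psi> x) * indicator Q x \<partial>lborel) \<le>
        ennreal (2 / measure lborel Q * I Q) + ennreal (2 * w * (?d * \<epsilon>)\<^sup>2) * (\<integral>\<^sup>+x. ennreal (gradsq \<psi> x) * indicator Q x \<partial>lborel)"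
        unfolding I_def
      proof (rule poincare_cell[OF \<psi> C(1)[OF Q] C(4)[OF Q] C(2)[OF Q] _ C(6)[OF Q]])
        show "box (- \<epsilon> *\<^sub>R One) (\<epsilon> *\<^sub>R One) \<in> sets (borel :: 'a measure)" by simp
        show "norm z \<le> ?d * \<epsilon>" if "z \<in> box (- \<epsilon> *\<^sub>R One) (\<epsilon> *\<^sub>R One)" for z :: 'a
          by (rule box_norm_le[OF that])
        show "0 \<le> ?d * \<epsilon>" "0 \<le> w" using \<epsilon>(3) by (simp_all add: w_def)
        show "measure lborel Q > 0" using pos C(5)[OF Q] by linarith
        have "emeasure lborel (box (- \<epsilon> *\<^sub>R One) (\<epsilon> *\<^sub>R One) :: 'a set) = ennreal ((2 * \<epsilon>) ^ DIM('a))"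
        proof -
          have "(\<Prod>b\<in>(Basis :: 'a set). (\<epsilon> *\<^sub>R One - - \<epsilon> *\<^sub>R One) \<bullet> b) = (\<Prod>b\<in>(Basis :: 'a set). 2 * \<epsilon>)"
            by (intro prod.cong) (auto simp: inner_diff_left inner_add_left)
          then show ?thesis using \<epsilon>(3) by (subst emeasure_lborel_box) auto
        qed
        also have "\<dots> \<le> ennreal (w * measure lborel Q)"
          using C(5)[OF Q] by (intro ennreal_leI) (simp add: w_def power_mult_distrib)
        finally show "emeasure lborel (box (- \<epsilon> *\<^sub>R One) (\<epsilon> *\<^sub>R One) :: 'a set) \<le> ennreal (w * measure lborel Q)" .
      qed
      also have "\<dots> \<le> ennreal (c * I Q) + ennreal (2 * w * (?d * \<epsilon>)\<^sup>2) * (\<integral>\<^sup>+x. ennreal (gradsq \<psi> x) * indicator Q x \<partial>lborel)"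
        unfolding c_def using C(5)[OF Q] pos
        by (intro add_right_mono ennreal_leI mult_right_mono divide_left_mono) (auto simp: I_def)
      finally show ?thesis .
    qed
    have "ennreal ((L2_norm \<L> \<psi>)\<^sup>2) = (\<integral>\<^sup>+x. (\<Sum>Q\<in>C. esq (\<psi> x) * indicator Q x) + esq (\<psi> x) * indicator Z x \<partial>lborel)"
      unfolding nn_integral_L2_norm[OF \<psi>, symmetric]
      by (intro nn_integral_cong) (simp add: ind distrib_left sum_distrib_left)
    also have "\<dots> = (\<Sum>Q\<in>C. \<integral>\<^sup>+x. esq (\<psi> x) * indicator Q x \<partial>lborel) + (\<integral>\<^sup>+x. esq (\<psi> x) * indicator Z x \<partial>lborel)"
      using C(1) Zb by (subst nn_integral_add) (auto intro!: arg_cong2[where f = "(+)"] nn_integral_sum)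
    also have "\<dots> \<le> (\<Sum>Q\<in>C. ennreal (c * I Q) + ennreal (2 * w * (?d * \<epsilon>)\<^sup>2) * (\<integral>\<^sup>+x. ennreal (gradsq \<psi> x) * indicator Q x \<partial>lborel)) + ennreal (K * (?d * \<epsilon>) * N)"
      unfolding N_def using \<epsilon> by (intro add_mono sum_mono cellle K(4)[unfolded strip_bound_def, rule_format, OF \<psi> _ _ Zb Zsub]) auto
    also have "(\<Sum>Q\<in>C. ennreal (c * I Q) + ennreal (2 * w * (?d * \<epsilon>)\<^sup>2) * (\<integral>\<^sup>+x. ennreal (gradsq \<psi> x) * indicator Q x \<partial>lborel)) =
        ennreal (c * (\<Sum>Q\<in>C. I Q)) + ennreal (2 * w * (?d * \<epsilon>)\<^sup>2) * (\<Sum>Q\<in>C. \<integral>\<^sup>+x. ennreal (gradsq \<psi> x) * indicator Q x \<partial>lborel)"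
      using \<open>c \<ge> 0\<close> by (simp add: sum.distrib sum_distrib_left I_def)
    also have "(\<Sum>Q\<in>C. \<integral>\<^sup>+x. ennreal (gradsq \<psi> x) * indicator Q x \<partial>lborel) \<le> ennreal N"
    proof -
      have "(\<Sum>Q\<in>C. \<integral>\<^sup>+x. ennreal (gradsq \<psi> x) * indicator Q x \<partial>lborel) = (\<integral>\<^sup>+x. (\<Sum>Q\<in>C. ennreal (gradsq \<psi> x) * indicator Q x) \<partial>lborel)"
        using C(1) by (intro nn_integral_sum[symmetric]) auto
      also have "\<dots> \<le> (\<integral>\<^sup>+x. ennreal ((cmod (\<psi> x))\<^sup>2 + gradsq \<psi> x) * indicator \<Omega> x \<partial>lborel)"
      proof (rule nn_integral_mono)
        fix x
        have "(\<Sum>Q\<in>C. ennreal (gradsq \<psi> x) * indicator Q x) = ennreal (gradsq \<psi> x) * (\<Sum>Q\<in>C. indicator Q x)"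
          by (simp add: sum_distrib_left)
        also have "\<dots> \<le> ennreal ((cmod (\<psi> x))\<^sup>2 + gradsq \<psi> x) * indicator \<Omega> x"
          unfolding ind by (intro mult_mono ennreal_leI) auto
        finally show "(\<Sum>Q\<in>C. ennreal (gradsq \<psi> x) * indicator Q x) \<le> ennreal ((cmod (\<psi> x))\<^sup>2 + gradsq \<psi> x) * indicator \<Omega> x" .
      qed
      also have "\<dots> = ennreal N" unfolding N_def by (rule nn_integral_H1_norm[OF \<psi>])
      finally show ?thesis .
    qed
    also have "ennreal (c * (\<Sum>Q\<in>C. I Q)) + ennreal (2 * w * (?d * \<epsilon>)\<^sup>2) * ennreal N + ennreal (K * (?d * \<epsilon>) * N) =
        ennreal (c * (\<Sum>Q\<in>C. I Q) + (2 * w * (?d * \<epsilon>)\<^sup>2 + K * (?d * \<epsilon>)) * N)"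
      using \<open>c \<ge> 0\<close> K(1) \<epsilon>(3)
      by (simp add: ennreal_plus[symmetric] ennreal_mult[symmetric] I_def N_def w_def sum_nonneg distrib_right add.assoc del: ennreal_plus)
    also have "\<dots> \<le> ennreal (c * (\<Sum>Q\<in>C. I Q) + e * N)"
      using \<epsilon>(1) by (intro ennreal_leI add_left_mono mult_right_mono) (auto simp: N_def)
    finally have "ennreal ((L2_norm \<L> \<psi>)\<^sup>2) \<le> ennreal (c * (\<Sum>Q\<in>C. I Q) + e * N)"
      by (simp add: add_mono mult_left_mono)
    then show "(L2_norm \<L> \<psi>)\<^sup>2 \<le> c * (\<Sum>Q\<in>C. (cmod (cellint Q \<psi>))\<^sup>2) + e * (H1_norm \<Omega> \<psi>)\<^sup>2"
      using \<open>c \<ge> 0\<close> e by (subst (asm) ennreal_le_iff) (auto simp: I_def N_def intro!: add_nonneg_nonneg mult_nonneg_nonneg sum_nonneg)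
  qed
qed

text \<open>A bound uniform in the cell, as the diagonal argument for the cell integrals
  requires.\<close>

lemma cell_integral_bound:
  assumes \<phi>: "smooth \<phi>" and Q: "Q \<in> sets borel" "bounded Q" "Q \<subseteq> \<Omega>"
  shows "cmod (cellint Q \<phi>) \<le> sqrt (measure lborel \<Omega>) * H1_norm \<Omega> \<phi>"
proof -
  have "esq (cellint Q \<phi>) \<le>
      ennreal (measure lborel Q) * (\<integral>\<^sup>+y. esq (\<phi> y) * indicator Q y \<partial>lborel)"
    by (rule norm_integral_squared_le(2)[OF Q(1,2) smooth_continuous[OF \<phi>]])
  also have "\<dots> \<le> ennreal (measure lborel \<Omega>) * (\<integral>\<^sup>+y. esq (\<phi> y) * indicator \<Omega> y \<partial>lborel)"
  proof (intro mult_mono ennreal_leI nn_integral_mono)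
    show "measure lborel Q \<le> measure lborel \<Omega>"
      using Q open_\<Omega> emeasure_bounded_finite[OF bounded_\<Omega>] by (intro measure_mono_fmeasurable fmeasurableI) auto
    show "indicator Q x \<le> (indicator \<Omega> x :: ennreal)" for x
      using Q(3) by (auto simp: indicator_def)
  qed auto
  also have "\<dots> = ennreal (measure lborel \<Omega> * (L2_norm \<L> \<phi>)\<^sup>2)"
    by (simp add: nn_integral_L2_norm[OF \<phi>] ennreal_mult)
  finally have "(cmod (cellint Q \<phi>))\<^sup>2 \<le> measure lborel \<Omega> * (L2_norm \<L> \<phi>)\<^sup>2"
    by (subst (asm) ennreal_le_iff) auto
  also have "\<dots> \<le> measure lborel \<Omega> * (H1_norm \<Omega> \<phi>)\<^sup>2"
    by (intro mult_left_mono power_mono L2_norm_le_H1_norm smooth_H1 \<phi>) auto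
  finally have "(cmod (cellint Q \<phi>))\<^sup>2 \<le> (sqrt (measure lborel \<Omega>) * H1_norm \<Omega> \<phi>)\<^sup>2"
    by (simp add: power_mult_distrib)
  then show ?thesis
    by (rule power2_le_imp_le) (auto intro!: mult_nonneg_nonneg H1_norm_nonneg smooth_H1 \<phi>)
qed

text \<open>For each accuracy 1 / (m + 1) finitely many cell integrals control the L2 norm up to
  that fraction of the H1 norm. All cells together are countable, so a diagonal subsequence makes
  every cell integral converge, and the estimate is applied to differences.\<close>

lemma rellich:
  assumes \<phi>: "\<And>n. smooth (\<phi> n)" and B: "\<And>n. H1_norm \<Omega> (\<phi> n) \<le> B"
  obtains r where "strict_mono (r :: nat \<Rightarrow> nat)"
    "\<And>e. e > 0 \<Longrightarrow> \<exists>N. \<forall>i\<ge>N. \<forall>j\<ge>N. L2_norm \<L> (\<lambda>x. \<phi> (r i) x - \<phi> (r j) x) < e"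
proof -
  define \<Phi> where "\<Phi> m C \<longleftrightarrow> finite C \<and> (\<forall>Q\<in>C. Q \<in> sets borel \<and> bounded Q \<and> Q \<subseteq> \<Omega>) \<and>
    (\<exists>c\<ge>0. \<forall>\<psi>. smooth \<psi> \<longrightarrow> (L2_norm \<L> \<psi>)\<^sup>2 \<le>
      c * (\<Sum>Q\<in>C. (cmod (cellint Q \<psi>))\<^sup>2) + 1 / real (Suc m) * (H1_norm \<Omega> \<psi>)\<^sup>2)" for m C
  have "\<exists>C. \<Phi> m C" for m
  proof (rule L2_norm_le_cell_integrals[of "1 / real (Suc m)"])
    fix C c
    assume "finite C" "\<And>Q. Q \<in> C \<Longrightarrow> Q \<in> sets borel \<and> bounded Q \<and> Q \<subseteq> \<Omega>" "c \<ge> 0"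
      "\<And>\<psi>. smooth \<psi> \<Longrightarrow> (L2_norm \<L> \<psi>)\<^sup>2 \<le>
      c * (\<Sum>Q\<in>C. (cmod (cellint Q \<psi>))\<^sup>2) + 1 / real (Suc m) * (H1_norm \<Omega> \<psi>)\<^sup>2"
    then have "\<Phi> m C" unfolding \<Phi>_def by blast
    then show "\<exists>C. \<Phi> m C" ..
  qed simp
  then obtain C where C: "\<And>m. \<Phi> m (C m)" by metis
  define S where "S = (\<Union>m. C m)"
  have S: "countable S" unfolding S_def using C by (auto simp: \<Phi>_def countable_finite)
  have Sb: "cmod (cellint Q (\<phi> n)) \<le> sqrt (measure lborel \<Omega>) * B" if "Q \<in> S" for Q n
  proof -
    have "Q \<in> sets borel" "bounded Q" "Q \<subseteq> \<Omega>" using that C by (auto simp: S_def \<Phi>_def)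
    from cell_integral_bound[OF \<phi> this, of n] show ?thesis
      by (rule order_trans) (intro mult_left_mono B, simp)
  qed
  have "\<exists>r. strict_mono (r :: nat \<Rightarrow> nat) \<and> (\<forall>Q\<in>S. \<exists>l. (\<lambda>n. cellint Q (\<phi> (r n))) \<longlonglongrightarrow> l)"
  proof (rule function_convergent_subsequence[OF S, of "\<lambda>n Q. cellint Q (\<phi> n)" "sqrt (measure lborel \<Omega>) * B"])
    fix r :: "nat \<Rightarrow> nat"
    assume "strict_mono r" "\<And>Q. Q \<in> S \<Longrightarrow> \<exists>l. (\<lambda>n. cellint Q (\<phi> (r n))) \<longlonglongrightarrow> l"
    then show "\<exists>r. strict_mono (r :: nat \<Rightarrow> nat) \<and> (\<forall>Q\<in>S. \<exists>l. (\<lambda>n. cellint Q (\<phi> (r n))) \<longlonglongrightarrow> l)"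
      by (intro exI[of _ r] conjI ballI) simp_all
  qed (rule Sb)
  then obtain r :: "nat \<Rightarrow> nat" where r: "strict_mono r" "\<forall>Q\<in>S. \<exists>l. (\<lambda>n. cellint Q (\<phi> (r n))) \<longlonglongrightarrow> l"
    by (elim exE conjE)
  show thesis
  proof (rule that[OF r(1)])
    fix e :: real assume e: "e > 0"
    \<comment> \<open>Half of e^2 is reserved for the H1 remainder, differences having norm at most
      2 B, and half for the cell integrals. The added 1 keeps denominators positive, here and in
      \<delta>.\<close>
    obtain m where m: "1 / real (Suc m) < e\<^sup>2 / 2 / ((2 * B)\<^sup>2 + 1)"
      using nat_approx_posE[of "e\<^sup>2 / 2 / ((2 * B)\<^sup>2 + 1)"] e by (auto simp: add_nonneg_pos)
    obtain c where c: "c \<ge> 0" "\<And>\<psi>. smooth \<psi> \<Longrightarrow> (L2_norm \<L> \<psi>)\<^sup>2 \<le>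
      c * (\<Sum>Q\<in>C m. (cmod (cellint Q \<psi>))\<^sup>2) + 1 / real (Suc m) * (H1_norm \<Omega> \<psi>)\<^sup>2"
      using C[of m] unfolding \<Phi>_def by blast
    have fin: "finite (C m)" using C[of m] by (simp add: \<Phi>_def)
    define \<delta> where "\<delta> = sqrt (e\<^sup>2 / 2 / (c * card (C m) + 1))"
    have cpos: "c * card (C m) + 1 > 0" using c(1) by (simp add: add_nonneg_pos)
    have \<delta>: "\<delta> > 0" "\<delta>\<^sup>2 = e\<^sup>2 / 2 / (c * card (C m) + 1)" using e cpos by (simp_all add: \<delta>_def)
    have "\<exists>N. \<forall>i\<ge>N. \<forall>j\<ge>N. cmod ((cellint Q (\<phi> (r i))) - (cellint Q (\<phi> (r j)))) < \<delta>"
      if "Q \<in> C m" for Q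
    proof -
      have "Q \<in> S" using that by (auto simp: S_def)
      then have "Cauchy (\<lambda>n. cellint Q (\<phi> (r n)))"
        using r(2) LIMSEQ_imp_Cauchy by blast
      then show ?thesis using CauchyD[OF _ \<delta>(1)] by blast
    qed
    then obtain N where N: "\<And>Q i j. Q \<in> C m \<Longrightarrow> i \<ge> N Q \<Longrightarrow> j \<ge> N Q \<Longrightarrow>
        cmod ((cellint Q (\<phi> (r i))) - (cellint Q (\<phi> (r j)))) < \<delta>"
      by metis
    define M where "M = Max (insert 0 (N ` C m))"
    have M: "N Q \<le> M" if "Q \<in> C m" for Q using that fin by (auto simp: M_def)
    have "L2_norm \<L> (\<lambda>x. \<phi> (r i) x - \<phi> (r j) x) < e" if ij: "i \<ge> M" "j \<ge> M" for i j
    proof -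
      let ?\<psi> = "\<lambda>x. \<phi> (r i) x - \<phi> (r j) x"
      have \<psi>: "smooth ?\<psi>" by (intro smooth_diff \<phi>)
      have "(cmod (cellint Q ?\<psi>))\<^sup>2 \<le> \<delta>\<^sup>2" if Q: "Q \<in> C m" for Q
      proof -
        have Qb: "Q \<in> sets borel" "bounded Q" using Q C[of m] by (auto simp: \<Phi>_def)
        have "(cellint Q ?\<psi>) = (cellint Q (\<phi> (r i))) - (cellint Q (\<phi> (r j)))"
          by (intro Bochner_Integration.integral_diff norm_integral_squared_le(1)[OF Qb] smooth_continuous \<phi>)
        then have "cmod (cellint Q ?\<psi>) < \<delta>"
          using N[OF Q, of i j] M[OF Q] ij by simp
        then show ?thesis by (intro power_mono) auto
      qed
      then have "(\<Sum>Q\<in>C m. (cmod (cellint Q ?\<psi>))\<^sup>2) \<le> real (card (C m)) * \<delta>\<^sup>2"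
        by (rule sum_bounded_above)
      then have 1: "c * (\<Sum>Q\<in>C m. (cmod (cellint Q ?\<psi>))\<^sup>2) \<le> c * (real (card (C m)) * \<delta>\<^sup>2)"
        by (rule mult_left_mono[OF _ c(1)])
      also have "\<dots> \<le> (c * card (C m) + 1) * \<delta>\<^sup>2" by (simp add: algebra_simps)
      also have "\<dots> = e\<^sup>2 / 2"
        unfolding \<delta>(2) using cpos by (intro nonzero_mult_div_cancel_left[of _ "e\<^sup>2 / 2", unfolded times_divide_eq_right[symmetric]]) simp
      finally have 1: "c * (\<Sum>Q\<in>C m. (cmod (cellint Q ?\<psi>))\<^sup>2) \<le> e\<^sup>2 / 2" .
      have "H1_norm \<Omega> ?\<psi> \<le> 2 * B"
        using H1_triangle[OF smooth_H1[OF \<phi>[of "r i"]] smooth_H1[OF \<phi>[of "r j"]], of "-1"] B[of "r i"] B[of "r j"] by simp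
      then have "(H1_norm \<Omega> ?\<psi>)\<^sup>2 \<le> (2 * B)\<^sup>2"
        by (intro power_mono H1_norm_nonneg smooth_H1 \<psi>)
      then have "1 / real (Suc m) * (H1_norm \<Omega> ?\<psi>)\<^sup>2 \<le> 1 / real (Suc m) * ((2 * B)\<^sup>2 + 1)"
        by (intro mult_left_mono) auto
      also have "\<dots> < e\<^sup>2 / 2 / ((2 * B)\<^sup>2 + 1) * ((2 * B)\<^sup>2 + 1)"
        using m by (intro mult_strict_right_mono) (simp_all add: add_nonneg_pos)
      also have "\<dots> = e\<^sup>2 / 2"
      proof -
        have "x / a * a = x" if "a > 0" for a x :: real using that by simp
        then show ?thesis by (simp only: add_nonneg_pos[OF zero_le_power2 zero_less_one])
      qed
      finally have 2: "1 / real (Suc m) * (H1_norm \<Omega> ?\<psi>)\<^sup>2 < e\<^sup>2 / 2" .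
      have "(L2_norm \<L> ?\<psi>)\<^sup>2 < e\<^sup>2" using c(2)[OF \<psi>] 1 2 by linarith
      then show ?thesis by (rule power_less_imp_less_base) (use e in simp)
    qed
    then show "\<exists>N. \<forall>i\<ge>N. \<forall>j\<ge>N. L2_norm \<L> (\<lambda>x. \<phi> (r i) x - \<phi> (r j) x) < e" by blast
  qed
qed

end

section \<open>The form and its operator\<close>

lemma L2_inner_real_weight:
  "L2_inner M (\<lambda>x. of_real (a x) * f x) g = cnj (L2_inner M (\<lambda>x. of_real (a x) * g x) f)"
  unfolding L2_inner_def by (subst Bochner_Integration.integral_cnj[symmetric]) (simp add: ac_simps)

lemma Re_L2_inner_weight_eq:
  "Re (L2_inner M (\<lambda>x. of_real (a x) * f x) f) = (LINT x|M. a x * (cmod (f x))\<^sup>2)"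
proof -
  have "L2_inner M (\<lambda>x. of_real (a x) * f x) f = (LINT x|M. of_real (a x * (cmod (f x))\<^sup>2))"
    unfolding L2_inner_def by (simp only: of_real_mult complex_norm_square mult.assoc)
  then show ?thesis
    by (simp only: integral_complex_of_real Re_complex_of_real)
qed

lemma Re_L2_inner_weight:
  assumes f: "f \<in> L2 M" and a: "a \<in> borel_measurable M" "AE x in M. \<bar>a x\<bar> \<le> C"
  shows "Re (L2_inner M (\<lambda>x. of_real (a x) * f x) f) \<le> C * (L2_norm M f)\<^sup>2"
    "(AE x in M. c \<le> a x) \<Longrightarrow> c * (L2_norm M f)\<^sup>2 \<le> Re (L2_inner M (\<lambda>x. of_real (a x) * f x) f)"
proof -
  have i: "integrable M (\<lambda>x. (cmod (f x))\<^sup>2)" using f by (rule L2_integrable)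
  have ia: "integrable M (\<lambda>x. a x * (cmod (f x))\<^sup>2)"
  proof (rule Bochner_Integration.integrable_bound)
    show "integrable M (\<lambda>x. C * (cmod (f x))\<^sup>2)" using i by simp
    show "(\<lambda>x. a x * (cmod (f x))\<^sup>2) \<in> borel_measurable M" using a(1) f by measurable
    show "AE x in M. norm (a x * (cmod (f x))\<^sup>2) \<le> norm (C * (cmod (f x))\<^sup>2)"
      using a(2) by eventually_elim (simp add: abs_mult mult_right_mono)
  qed
  note eq = Re_L2_inner_weight_eq[of M a f]
  have "(LINT x|M. a x * (cmod (f x))\<^sup>2) \<le> (LINT x|M. C * (cmod (f x))\<^sup>2)"
  proof (rule integral_mono_AE[OF ia])
    show "AE x in M. a x * (cmod (f x))\<^sup>2 \<le> C * (cmod (f x))\<^sup>2"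
      using a(2) by eventually_elim (auto intro!: mult_right_mono)
  qed (use i in simp)
  then show "Re (L2_inner M (\<lambda>x. of_real (a x) * f x) f) \<le> C * (L2_norm M f)\<^sup>2"
    by (simp add: eq L2_norm_sq)
  assume c: "AE x in M. c \<le> a x"
  have "(LINT x|M. c * (cmod (f x))\<^sup>2) \<le> (LINT x|M. a x * (cmod (f x))\<^sup>2)"
  proof (rule integral_mono_AE[OF _ ia])
    show "AE x in M. c * (cmod (f x))\<^sup>2 \<le> a x * (cmod (f x))\<^sup>2"
      using c by eventually_elim (auto intro!: mult_right_mono)
  qed (use i in simp)
  then show "c * (L2_norm M f)\<^sup>2 \<le> Re (L2_inner M (\<lambda>x. of_real (a x) * f x) f)"
    by (simp add: eq L2_norm_sq)
qed

lemma add_scaled_simps [simp]: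
  "fst (add_scaled f c u) = (\<lambda>x. fst f x + c * fst u x)" "snd (add_scaled f c u) = (\<lambda>x. snd f x + c * snd u x)"
  by (simp_all add: add_scaled_def)

section \<open>The Neumann Laplacian: gradient bound, linearity, closedness\<close>

context bounded_open
begin

text \<open>The Neumann identity tested with v = d, and Cauchy-Schwarz. The product matters: the H1
  norm becomes small if d is small in L2 while \<Delta> d is merely bounded.\<close>

lemma H1_norm_sq_neumann_le:
  assumes d: "d \<in> dom_neumann_laplacian \<Omega>"
  shows "(H1_norm \<Omega> d)\<^sup>2 \<le> (L2_norm \<L> d)\<^sup>2 + L2_norm \<L> (\<Delta> d) * L2_norm \<L> d"
proof -
  have dd: "d \<in> H1_Delta \<Omega>" "d \<in> H1 \<Omega>" using d by (auto simp: dom_neumann_laplacian_def H1_Delta_def)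
  have "(H1_norm \<Omega> d)\<^sup>2 = (L2_norm \<L> d)\<^sup>2 + Re (grad_inner \<Omega> d d)"
    using H1_norm_sq[OF dd(2)] grad_inner_self[OF dd(2)] by simp
  also have "grad_inner \<Omega> d d = - L2_inner \<L> (\<Delta> d) d"
    using d dd by (simp add: dom_neumann_laplacian_def)
  also have "Re (- L2_inner \<L> (\<Delta> d) d) \<le> cmod (L2_inner \<L> (\<Delta> d) d)"
    using abs_Re_le_cmod[of "L2_inner \<L> (\<Delta> d) d"] by simp
  also have "\<dots> \<le> L2_norm \<L> (\<Delta> d) * L2_norm \<L> d"
    by (intro L2_CS laplacian_L2 H1_L2 dd)
  finally show ?thesis by simp
qed

lemma L2_inner_laplacian_comb:
  assumes "u \<in> H1_Delta \<Omega>" "v \<in> H1_Delta \<Omega>" "w \<in> L2 \<L>"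
  shows "L2_inner \<L> (\<Delta> (\<lambda>x. u x + c * v x)) w = L2_inner \<L> (\<Delta> u) w + c * L2_inner \<L> (\<Delta> v) w"
proof -
  note L = laplacian_L2[OF assms(1)] laplacian_L2[OF assms(2)] laplacian_L2[OF H1_Delta_comb[OF assms(1,2), of c]]
  have "L2_inner \<L> (\<Delta> (\<lambda>x. u x + c * v x)) w = L2_inner \<L> (\<lambda>x. \<Delta> u x + c * \<Delta> v x) w"
    by (rule L2_inner_cong_AE[OF laplacian_comb[OF assms(1,2)]]) (auto intro: L2_measurable L assms L2_comb)
  then show ?thesis by (simp add: L2_inner_linear L assms)
qed

lemma laplacian_diff_norm:
  assumes "u \<in> H1_Delta \<Omega>" "v \<in> H1_Delta \<Omega>"
  shows "L2_norm \<L> (\<Delta> (\<lambda>x. u x - v x)) = L2_norm \<L> (\<lambda>x. \<Delta> u x - \<Delta> v x)"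
proof -
  have "AE x in \<L>. \<Delta> (\<lambda>x. u x - v x) x = \<Delta> u x - \<Delta> v x"
    using laplacian_comb[OF assms, of "-1"] by simp
  then show ?thesis
    using H1_Delta_comb[OF assms, of "-1"]
    by (intro L2_norm_cong_AE) (auto intro: L2_measurable laplacian_L2 assms L2_diff)
qed

lemma dom_neumann_comb:
  assumes u: "u \<in> dom_neumann_laplacian \<Omega>" and v: "v \<in> dom_neumann_laplacian \<Omega>"
  shows "(\<lambda>x. u x + c * v x) \<in> dom_neumann_laplacian \<Omega>"
  unfolding dom_neumann_laplacian_def
proof (intro CollectI conjI ballI)
  have d: "u \<in> H1_Delta \<Omega>" "v \<in> H1_Delta \<Omega>" "u \<in> H1 \<Omega>" "v \<in> H1 \<Omega>"
    using u v by (auto simp: dom_neumann_laplacian_def H1_Delta_def)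
  then show "(\<lambda>x. u x + c * v x) \<in> H1_Delta \<Omega>" by (intro H1_Delta_comb)
  fix w assume w: "w \<in> H1 \<Omega>"
  show "grad_inner \<Omega> (\<lambda>x. u x + c * v x) w = - L2_inner \<L> (\<Delta> (\<lambda>x. u x + c * v x)) w"
    using u v w d by (simp add: grad_inner_linear L2_inner_laplacian_comb H1_L2 dom_neumann_laplacian_def)
qed

lemma dom_neumann_zero: "(\<lambda>x. 0) \<in> dom_neumann_laplacian \<Omega>"
  unfolding dom_neumann_laplacian_def
proof (intro CollectI conjI ballI)
  have z: "(\<lambda>x. 0) \<in> H1 \<Omega>" by (rule smooth_H1[OF smooth_const])
  have l: "has_distr_laplacian \<Omega> (\<lambda>x. 0) (\<lambda>x. 0)" by (simp add: has_distr_laplacian_def L2_zero)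
  then show "(\<lambda>x. 0) \<in> H1_Delta \<Omega>" using z by (auto simp: H1_Delta_def)
  then have lz: "\<Delta> (\<lambda>x. 0) \<in> L2 \<L>" by (rule laplacian_L2)
  fix v assume v: "v \<in> H1 \<Omega>"
  have "grad_inner \<Omega> (\<lambda>x. 0) v = 0"
    using grad_inner_linear[OF z z v, of "-1"] by simp
  moreover have "L2_inner \<L> (\<Delta> (\<lambda>x. 0)) v = L2_inner \<L> (\<lambda>x. 0) v"
    by (rule L2_inner_cong_AE[OF laplacian_eq[OF l]]) (auto intro: L2_measurable lz L2_zero H1_L2 v)
  ultimately show "grad_inner \<Omega> (\<lambda>x. 0) v = - L2_inner \<L> (\<Delta> (\<lambda>x. 0)) v"
    by (simp add: L2_inner_def)
qed

text \<open>On the domain of the Neumann Laplacian, convergence of \<open>u\<close> and \<open>\<Delta>u\<close> implies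
  convergence of the gradients, by \<open>H1_norm_sq_neumann_le\<close>.\<close>

lemma dom_neumann_closed:
  assumes s: "\<And>n. s n \<in> dom_neumann_laplacian \<Omega>"
    and u: "u \<in> L2 \<L>" "(\<lambda>n. L2_norm \<L> (\<lambda>x. s n x - u x)) \<longlonglongrightarrow> 0"
    and w: "w \<in> L2 \<L>" "(\<lambda>n. L2_norm \<L> (\<lambda>x. \<Delta> (s n) x - w x)) \<longlonglongrightarrow> 0"
  shows "u \<in> dom_neumann_laplacian \<Omega>" "has_distr_laplacian \<Omega> u w"
    "(\<lambda>n. H1_norm \<Omega> (\<lambda>x. s n x - u x)) \<longlonglongrightarrow> 0"
proof -
  have sD: "s n \<in> H1_Delta \<Omega>" and s1: "s n \<in> H1 \<Omega>" and s2: "s n \<in> L2 \<L>" for n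
    using s[of n] by (auto simp: dom_neumann_laplacian_def H1_Delta_def H1_def)
  have ls: "\<Delta> (s n) \<in> L2 \<L>" for n by (rule laplacian_L2[OF sD])
  have "\<exists>g. g \<in> L2 \<L> \<and> (\<lambda>n. L2_norm \<L> (\<lambda>x. wd j (s n) x - g x)) \<longlonglongrightarrow> 0" if j: "j \<in> Basis" for j
  proof -
    have jL: "wd j (s n) \<in> L2 \<L>" for n by (rule weak_partial_L2[OF s1 j])
    have cau: "\<exists>N. \<forall>m\<ge>N. \<forall>n\<ge>N. L2_norm \<L> (\<lambda>x. wd j (s m) x - wd j (s n) x) < e"
      if e: "e > 0" for e
    proof -
      define a where "a n = L2_norm \<L> (\<lambda>x. s n x - u x)" for n
      define b where "b n = L2_norm \<L> (\<lambda>x. \<Delta> (s n) x - w x)" for n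
      \<comment> \<open>Differences of u and of \<Delta> u are then at most 2 \<delta>, hence the
        gradient difference is at most sqrt((2 \<delta>)(2 \<delta>)) = e / 2.\<close>
      define \<delta> where "\<delta> = e / 4"
      have \<delta>: "\<delta> > 0" using e by (simp add: \<delta>_def)
      have ev: "\<forall>\<^sub>F n in sequentially. a n < \<delta> \<and> b n < \<delta>"
        using order_tendstoD(2)[OF u(2) \<delta>] order_tendstoD(2)[OF w(2) \<delta>] unfolding a_def b_def
        by (rule eventually_conj)
      then obtain N where N: "\<And>n. n \<ge> N \<Longrightarrow> a n < \<delta> \<and> b n < \<delta>" unfolding eventually_sequentially by blast
      have "L2_norm \<L> (\<lambda>x. wd j (s m) x - wd j (s n) x) < e" if mn: "m \<ge> N" "n \<ge> N" for m n
      proof -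
        let ?d = "\<lambda>x. s m x - s n x"
        have d: "?d \<in> dom_neumann_laplacian \<Omega>" using dom_neumann_comb[OF s[of m] s[of n], of "-1"] by simp
        have d1: "?d \<in> H1 \<Omega>" by (rule H1_diff[OF s1 s1])
        have A: "L2_norm \<L> ?d \<le> 2 * \<delta>"
          using L2_triangle3[OF s2[of m] u(1) s2[of n]] L2_norm_minus_commute[of \<L> u "s n"] N[OF mn(1)] N[OF mn(2)]
          by (simp add: a_def)
        have "L2_norm \<L> (\<Delta> ?d) = L2_norm \<L> (\<lambda>x. \<Delta> (s m) x - \<Delta> (s n) x)"
          by (rule laplacian_diff_norm[OF sD sD])
        also have "\<dots> \<le> 2 * \<delta>"
          using L2_triangle3[OF ls[of m] w(1) ls[of n]] L2_norm_minus_commute[of \<L> w "\<Delta> (s n)"] N[OF mn(1)] N[OF mn(2)]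
          by (simp add: b_def)
        finally have B: "L2_norm \<L> (\<Delta> ?d) \<le> 2 * \<delta>" .
        have "(L2_norm \<L> (wd j ?d))\<^sup>2 \<le> (\<Sum>j\<in>Basis. (L2_norm \<L> (wd j ?d))\<^sup>2)"
          using j by (intro member_le_sum) auto
        also have "\<dots> \<le> (H1_norm \<Omega> ?d)\<^sup>2 - (L2_norm \<L> ?d)\<^sup>2" using H1_norm_sq[OF d1] by simp
        also have "\<dots> \<le> L2_norm \<L> (\<Delta> ?d) * L2_norm \<L> ?d" using H1_norm_sq_neumann_le[OF d] by simp
        also have "\<dots> \<le> (2 * \<delta>) * (2 * \<delta>)" using A B \<delta> by (intro mult_mono) auto
        also have "\<dots> = (2 * \<delta>)\<^sup>2" by (rule power2_eq_square[symmetric])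
        finally have "L2_norm \<L> (wd j ?d) \<le> 2 * \<delta>"
          by (rule power2_le_imp_le) (use \<delta> in simp)
        moreover have "AE x in \<L>. wd j ?d x = wd j (s m) x - wd j (s n) x"
          using weak_partial_comb[OF s1[of m] s1[of n] j, of "-1"] by simp
        then have "L2_norm \<L> (wd j ?d) = L2_norm \<L> (\<lambda>x. wd j (s m) x - wd j (s n) x)"
          by (rule L2_norm_cong_AE) (auto intro: L2_measurable weak_partial_L2 d1 j L2_diff jL)
        ultimately show ?thesis using e by (simp add: \<delta>_def)
      qed
      then show ?thesis by blast
    qed
    show ?thesis by (rule L2_complete[OF jL cau]) blast+
  qed
  then obtain g where g: "\<And>j. j \<in> Basis \<Longrightarrow> g j \<in> L2 \<L>"
      "\<And>j. j \<in> Basis \<Longrightarrow> (\<lambda>n. L2_norm \<L> (\<lambda>x. wd j (s n) x - g j x)) \<longlonglongrightarrow> 0"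
    by metis
  have wp: "has_weak_partial \<Omega> j u (g j)" if j: "j \<in> Basis" for j
    by (rule has_weak_partial_closed[OF s2 u g(1)[OF j] g(2)[OF j] weak_partial_works[OF s1 j] j])
  have u1: "u \<in> H1 \<Omega>" using u(1) wp by (auto simp: H1_def)
  show lap: "has_distr_laplacian \<Omega> u w"
    by (rule has_distr_laplacian_closed[OF s2 u w laplacian_works[OF sD]])
  then have uD: "u \<in> H1_Delta \<Omega>" using u1 by (auto simp: H1_Delta_def)
  have gu: "AE x in \<L>. wd j u x = g j x" if "j \<in> Basis" for j
    by (rule weak_partial_eq[OF wp[OF that]])
  have dj: "L2_norm \<L> (wd j (\<lambda>x. s n x - u x)) = L2_norm \<L> (\<lambda>x. wd j (s n) x - g j x)"
    if j: "j \<in> Basis" for j n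
  proof (rule L2_norm_cong_AE)
    have "AE x in \<L>. wd j (\<lambda>x. s n x - u x) x = wd j (s n) x - wd j u x"
      using weak_partial_comb[OF s1[of n] u1 j, of "-1"] by simp
    with gu[OF j] show "AE x in \<L>. wd j (\<lambda>x. s n x - u x) x = wd j (s n) x - g j x"
      by eventually_elim simp
  qed (auto intro: L2_measurable weak_partial_L2 H1_diff s1 u1 j L2_diff g)
  have "(\<lambda>n. (L2_norm \<L> (\<lambda>x. s n x - u x))\<^sup>2 + (\<Sum>j\<in>Basis. (L2_norm \<L> (\<lambda>x. wd j (s n) x - g j x))\<^sup>2)) \<longlonglongrightarrow> 0\<^sup>2 + (\<Sum>j\<in>(Basis::'a set). 0\<^sup>2)"
    by (intro tendsto_intros u g)
  then have "(\<lambda>n. (H1_norm \<Omega> (\<lambda>x. s n x - u x))\<^sup>2) \<longlonglongrightarrow> 0"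
    by (simp add: H1_norm_sq[OF H1_diff[OF s1 u1]] dj)
  from tendsto_real_sqrt[OF this] show "(\<lambda>n. H1_norm \<Omega> (\<lambda>x. s n x - u x)) \<longlonglongrightarrow> 0"
    using H1_norm_nonneg[OF H1_diff[OF s1 u1]] by simp
  show "u \<in> dom_neumann_laplacian \<Omega>"
    unfolding dom_neumann_laplacian_def
  proof (intro CollectI conjI ballI uD)
    fix v assume v: "v \<in> H1 \<Omega>"
    have "(\<lambda>n. \<Sum>j\<in>Basis. LINT x|\<L>. wd j (s n) x * cnj (wd j v x)) \<longlonglongrightarrow>
        (\<Sum>j\<in>Basis. LINT x|\<L>. g j x * cnj (wd j v x))"
      by (intro tendsto_sum L2_inner_tendsto weak_partial_L2 s1 g L2_cnj v)
    then have 1: "(\<lambda>n. grad_inner \<Omega> (s n) v) \<longlonglongrightarrow> (\<Sum>j\<in>Basis. L2_inner \<L> (g j) (wd j v))"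
      by (simp add: grad_inner_eq[OF s1 v] L2_inner_def)
    have "(\<Sum>j\<in>Basis. L2_inner \<L> (g j) (wd j v)) = (\<Sum>j\<in>Basis. L2_inner \<L> (wd j u) (wd j v))"
    proof (rule sum.cong[OF refl])
      fix j :: 'a assume j: "j \<in> Basis"
      show "L2_inner \<L> (g j) (wd j v) = L2_inner \<L> (wd j u) (wd j v)"
        by (rule L2_inner_cong_AE) (use gu[OF j] in \<open>auto intro: L2_measurable weak_partial_L2 u1 v j g\<close>)
    qed
    then have 2: "(\<Sum>j\<in>Basis. L2_inner \<L> (g j) (wd j v)) = grad_inner \<Omega> u v"
      by (simp add: grad_inner_eq[OF u1 v])
    have "(\<lambda>n. - L2_inner \<L> (\<Delta> (s n)) v) \<longlonglongrightarrow> - L2_inner \<L> w v"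
      unfolding L2_inner_def by (intro tendsto_minus L2_inner_tendsto ls w L2_cnj H1_L2 v)
    moreover have "grad_inner \<Omega> (s n) v = - L2_inner \<L> (\<Delta> (s n)) v" for n
      using s[of n] v by (simp add: dom_neumann_laplacian_def)
    ultimately have "grad_inner \<Omega> u v = - L2_inner \<L> w v"
      using 1 unfolding 2 by (simp add: LIMSEQ_unique)
    also have "L2_inner \<L> w v = L2_inner \<L> (\<Delta> u) v"
      by (rule L2_inner_cong_AE) (use laplacian_eq[OF lap] in \<open>auto intro: L2_measurable w laplacian_L2 uD H1_L2 v\<close>)
    finally show "grad_inner \<Omega> u v = - L2_inner \<L> (\<Delta> u) v" .
  qed
qed

end

section \<open>The trace relation: linearity and closedness\<close>

context lipschitz_domain
begin

abbreviation "\<S> \<equiv> surface_measure \<Omega>"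

lemma has_trace_comb:
  assumes u: "has_trace \<Omega> u g" and v: "has_trace \<Omega> v k"
  shows "has_trace \<Omega> (\<lambda>x. u x + c * v x) (\<lambda>x. g x + c * k x)"
proof -
  obtain \<phi> \<psi> where \<phi>: "\<And>n. smooth (\<phi> n)" "(\<lambda>n. H1_norm \<Omega> (\<lambda>x. \<phi> n x - u x)) \<longlonglongrightarrow> 0"
      "(\<lambda>n. L2_norm \<S> (\<lambda>x. \<phi> n x - g x)) \<longlonglongrightarrow> 0"
    and \<psi>: "\<And>n. smooth (\<psi> n)" "(\<lambda>n. H1_norm \<Omega> (\<lambda>x. \<psi> n x - v x)) \<longlonglongrightarrow> 0"
      "(\<lambda>n. L2_norm \<S> (\<lambda>x. \<psi> n x - k x)) \<longlonglongrightarrow> 0"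
    using u v unfolding has_trace_def by blast
  have uv: "u \<in> H1 \<Omega>" "v \<in> H1 \<Omega>" "g \<in> L2 \<S>" "k \<in> L2 \<S>" using u v by (auto simp: has_trace_def)
  let ?c = "\<lambda>n x. \<phi> n x + c * \<psi> n x"
  have 1: "(\<lambda>n. H1_norm \<Omega> (\<lambda>x. ?c n x - (u x + c * v x))) \<longlonglongrightarrow> 0"
  proof (rule tendsto_zero_if_le)
    show "(\<lambda>n. H1_norm \<Omega> (\<lambda>x. \<phi> n x - u x) + cmod c * H1_norm \<Omega> (\<lambda>x. \<psi> n x - v x)) \<longlonglongrightarrow> 0"
      using tendsto_add[OF \<phi>(2) tendsto_mult_left[OF \<psi>(2), of "cmod c"]] by simp
    show "H1_norm \<Omega> (\<lambda>x. ?c n x - (u x + c * v x)) \<le> H1_norm \<Omega> (\<lambda>x. \<phi> n x - u x) + cmod c * H1_norm \<Omega> (\<lambda>x. \<psi> n x - v x)" for n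
      using H1_triangle[OF H1_diff[OF smooth_H1[OF \<phi>(1)[of n]] uv(1)] H1_diff[OF smooth_H1[OF \<psi>(1)[of n]] uv(2)], of c]
      by (simp add: algebra_simps)
  qed (intro H1_norm_nonneg H1_diff H1_comb smooth_H1 \<phi>(1) \<psi>(1) uv)
  have 2: "(\<lambda>n. L2_norm \<S> (\<lambda>x. ?c n x - (g x + c * k x))) \<longlonglongrightarrow> 0"
  proof (rule tendsto_zero_if_le)
    show "(\<lambda>n. L2_norm \<S> (\<lambda>x. \<phi> n x - g x) + cmod c * L2_norm \<S> (\<lambda>x. \<psi> n x - k x)) \<longlonglongrightarrow> 0"
      using tendsto_add[OF \<phi>(3) tendsto_mult_left[OF \<psi>(3), of "cmod c"]] by simp
    show "L2_norm \<S> (\<lambda>x. ?c n x - (g x + c * k x)) \<le> L2_norm \<S> (\<lambda>x. \<phi> n x - g x) + cmod c * L2_norm \<S> (\<lambda>x. \<psi> n x - k x)" for n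
      using L2_triangle[OF L2_diff[OF smooth_L2_surface[OF \<phi>(1)[of n]] uv(3)] L2_diff[OF smooth_L2_surface[OF \<psi>(1)[of n]] uv(4)], of c]
      by (simp add: algebra_simps)
  qed simp
  show ?thesis
    unfolding has_trace_def
    by (intro conjI exI[of _ ?c] allI H1_comb uv L2_comb smooth_comb \<phi>(1) \<psi>(1) 1 2)
qed

lemma has_trace_zero: "has_trace \<Omega> (\<lambda>x. 0) (\<lambda>x. 0)"
proof -
  have z: "(\<lambda>x. 0) \<in> H1 \<Omega>" by (rule smooth_H1[OF smooth_const])
  have "(H1_norm \<Omega> (\<lambda>x. 0))\<^sup>2 \<le> 0"
    using H1_norm_sq_neumann_le[OF dom_neumann_zero] by (simp add: L2_norm_def)
  then have "H1_norm \<Omega> (\<lambda>x. 0) = 0" by simp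
  then show ?thesis
    unfolding has_trace_def using z smooth_const[of 0]
    by (auto simp: L2_zero L2_norm_def intro!: exI[of _ "\<lambda>n x. 0"])
qed

lemma has_trace_approx:
  assumes "has_trace \<Omega> u g" "e > 0"
  shows "\<exists>\<phi>. smooth \<phi> \<and> H1_norm \<Omega> (\<lambda>x. \<phi> x - u x) < e \<and> L2_norm \<S> (\<lambda>x. \<phi> x - g x) < e"
proof -
  obtain \<phi> where \<phi>: "\<And>n. smooth (\<phi> n)" "(\<lambda>n. H1_norm \<Omega> (\<lambda>x. \<phi> n x - u x)) \<longlonglongrightarrow> 0"
      "(\<lambda>n. L2_norm \<S> (\<lambda>x. \<phi> n x - g x)) \<longlonglongrightarrow> 0"
    using assms(1) unfolding has_trace_def by blast
  have "\<forall>\<^sub>F n in sequentially. H1_norm \<Omega> (\<lambda>x. \<phi> n x - u x) < e \<and> L2_norm \<S> (\<lambda>x. \<phi> n x - g x) < e"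
    using order_tendstoD(2)[OF \<phi>(2) assms(2)] order_tendstoD(2)[OF \<phi>(3) assms(2)] by (rule eventually_conj)
  then obtain n where "H1_norm \<Omega> (\<lambda>x. \<phi> n x - u x) < e \<and> L2_norm \<S> (\<lambda>x. \<phi> n x - g x) < e"
    using eventually_happens' sequentially_bot by blast
  then show ?thesis using \<phi>(1) by (intro exI[of _ "\<phi> n"]) simp
qed

lemma has_trace_approx_seq:
  assumes "\<And>n. has_trace \<Omega> (u n) (g n)"
  shows "\<exists>\<phi>. \<forall>n. smooth (\<phi> n) \<and> H1_norm \<Omega> (\<lambda>x. \<phi> n x - u n x) < 1 / real (Suc n) \<and>
    L2_norm \<S> (\<lambda>x. \<phi> n x - g n x) < 1 / real (Suc n)"
  by (intro choice allI has_trace_approx assms) simp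

text \<open>Diagonal choice: an approximant of each \<open>s n\<close> with error below 1 / (n + 1)
  in both norms also approximates the limit pair.\<close>

lemma has_trace_closed:
  assumes t: "\<And>n. has_trace \<Omega> (s n) (g n)" and u: "u \<in> H1 \<Omega>" "(\<lambda>n. H1_norm \<Omega> (\<lambda>x. s n x - u x)) \<longlonglongrightarrow> 0"
    and k: "k \<in> L2 \<S>" "(\<lambda>n. L2_norm \<S> (\<lambda>x. g n x - k x)) \<longlonglongrightarrow> 0"
  shows "has_trace \<Omega> u k"
proof -
  obtain \<phi> where \<phi>': "\<forall>n. smooth (\<phi> n) \<and> H1_norm \<Omega> (\<lambda>x. \<phi> n x - s n x) < 1 / real (Suc n) \<and>
    L2_norm \<S> (\<lambda>x. \<phi> n x - g n x) < 1 / real (Suc n)"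
    using has_trace_approx_seq[of s g, OF t] by (elim exE)
  then have \<phi>: "smooth (\<phi> n)" "H1_norm \<Omega> (\<lambda>x. \<phi> n x - s n x) < 1 / real (Suc n)"
    "L2_norm \<S> (\<lambda>x. \<phi> n x - g n x) < 1 / real (Suc n)" for n by simp_all
  have d: "(\<lambda>n. 1 / real (Suc n)) \<longlonglongrightarrow> 0" using LIMSEQ_Suc[OF lim_1_over_n] .
  have sg: "s n \<in> H1 \<Omega>" "g n \<in> L2 \<S>" for n using t[of n] by (auto simp: has_trace_def)
  have 1: "(\<lambda>n. H1_norm \<Omega> (\<lambda>x. \<phi> n x - u x)) \<longlonglongrightarrow> 0"
  proof (rule tendsto_zero_if_le)
    show "(\<lambda>n. 1 / real (Suc n) + H1_norm \<Omega> (\<lambda>x. s n x - u x)) \<longlonglongrightarrow> 0" using tendsto_add[OF d u(2)] by simp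
    show "H1_norm \<Omega> (\<lambda>x. \<phi> n x - u x) \<le> 1 / real (Suc n) + H1_norm \<Omega> (\<lambda>x. s n x - u x)" for n
      using H1_triangle3[OF smooth_H1[OF \<phi>(1)[of n]] sg(1)[of n] u(1)] \<phi>(2)[of n] by linarith
  qed (intro H1_norm_nonneg H1_diff smooth_H1 \<phi>(1) u)
  have 2: "(\<lambda>n. L2_norm \<S> (\<lambda>x. \<phi> n x - k x)) \<longlonglongrightarrow> 0"
  proof (rule tendsto_zero_if_le)
    show "(\<lambda>n. 1 / real (Suc n) + L2_norm \<S> (\<lambda>x. g n x - k x)) \<longlonglongrightarrow> 0" using tendsto_add[OF d k(2)] by simp
    show "L2_norm \<S> (\<lambda>x. \<phi> n x - k x) \<le> 1 / real (Suc n) + L2_norm \<S> (\<lambda>x. g n x - k x)" for n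
      using L2_triangle3[OF smooth_L2_surface[OF \<phi>(1)[of n]] sg(2)[of n] k(1)] \<phi>(3)[of n] by linarith
  qed simp
  show ?thesis unfolding has_trace_def using u(1) k(1) \<phi>(1) 1 2 by blast
qed

end

section \<open>The weighted Hilbert space and the form\<close>

locale bulk_surface = lipschitz_domain \<Omega> for \<Omega> :: "'a::euclidean_space set" +
  fixes \<alpha> \<beta> \<gamma> :: "'a \<Rightarrow> real" and \<eta> :: real
  assumes \<alpha>: "\<alpha> \<in> Linfty (lebesgue_on \<Omega>)" and \<beta>: "\<beta> \<in> Linfty (surface_measure \<Omega>)"
    and \<gamma>: "\<gamma> \<in> Linfty (surface_measure \<Omega>)" and \<eta>: "\<eta> > 0"
    and \<alpha>_ge: "AE x in lebesgue_on \<Omega>. \<alpha> x \<ge> \<eta>" and \<beta>_ge: "AE x in surface_measure \<Omega>. \<beta> x \<ge> \<eta>"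
begin

abbreviation "\<W> \<equiv> weighted_surface \<Omega> \<beta>"
abbreviation "\<H> \<equiv> Hsp \<Omega> \<beta>"
abbreviation "\<N> \<equiv> Hsp_norm \<Omega> \<beta>"
abbreviation "\<I> \<equiv> Hsp_inner \<Omega> \<beta>"
abbreviation "\<aa> \<equiv> form \<Omega> \<alpha> \<beta> \<gamma>"
abbreviation "\<A> \<equiv> op_A \<Omega> \<alpha> \<beta> \<gamma>"
abbreviation "\<D> \<equiv> form_dom \<Omega> \<beta>"

definition "C\<alpha> = (SOME C. AE x in \<L>. \<bar>\<alpha> x\<bar> \<le> C)"
text \<open>A bound picked by \<open>SOME\<close> need not be positive if the surface measure is
  trivial. The maximum with \<eta> makes this one positive; for \<gamma> the absolute value of the
  bound is used where the sign matters.\<close>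

definition "C\<beta> = max (SOME C. AE x in \<S>. \<bar>\<beta> x\<bar> \<le> C) \<eta>"
definition "C\<gamma> = (SOME C. AE x in \<S>. \<bar>\<gamma> x\<bar> \<le> C)"

lemma \<alpha>_le: "AE x in \<L>. \<bar>\<alpha> x\<bar> \<le> C\<alpha>"
  using \<alpha> unfolding Linfty_def C\<alpha>_def by (intro someI_ex[of "\<lambda>C. AE x in \<L>. \<bar>\<alpha> x\<bar> \<le> C"]) simp

lemma \<gamma>_le: "AE x in \<S>. \<bar>\<gamma> x\<bar> \<le> C\<gamma>"
  using \<gamma> unfolding Linfty_def C\<gamma>_def by (intro someI_ex[of "\<lambda>C. AE x in \<S>. \<bar>\<gamma> x\<bar> \<le> C"]) simp

lemma \<beta>_le: "AE x in \<S>. \<beta> x \<le> C\<beta>"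
proof -
  have "AE x in \<S>. \<bar>\<beta> x\<bar> \<le> (SOME C. AE x in \<S>. \<bar>\<beta> x\<bar> \<le> C)"
    using \<beta> unfolding Linfty_def by (intro someI_ex[of "\<lambda>C. AE x in \<S>. \<bar>\<beta> x\<bar> \<le> C"]) simp
  then show ?thesis by eventually_elim (simp add: C\<beta>_def)
qed

lemma C\<beta>_pos: "C\<beta> > 0"
  using \<eta> by (simp add: C\<beta>_def)

lemma measurable_coeffs: "\<alpha> \<in> borel_measurable \<L>" "\<beta> \<in> borel_measurable \<S>" "\<gamma> \<in> borel_measurable \<S>"
  using \<alpha> \<beta> \<gamma> by (simp_all add: Linfty_def)

lemma inverse_\<beta>:
  shows "AE x in \<S>. 0 \<le> inverse (\<beta> x)" "AE x in \<S>. \<bar>inverse (\<beta> x)\<bar> \<le> inverse \<eta>"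
    "AE x in \<S>. inverse C\<beta> \<le> inverse (\<beta> x)" "(\<lambda>x. inverse (\<beta> x)) \<in> borel_measurable \<S>"
proof -
  show "AE x in \<S>. 0 \<le> inverse (\<beta> x)" using \<beta>_ge by eventually_elim (use \<eta> in auto)
  show "AE x in \<S>. \<bar>inverse (\<beta> x)\<bar> \<le> inverse \<eta>"
    using \<beta>_ge by eventually_elim (use \<eta> in \<open>auto intro!: le_imp_inverse_le\<close>)
  show "AE x in \<S>. inverse C\<beta> \<le> inverse (\<beta> x)"
    using \<beta>_ge \<beta>_le by eventually_elim (use \<eta> in \<open>auto intro!: le_imp_inverse_le\<close>)
  show "(\<lambda>x. inverse (\<beta> x)) \<in> borel_measurable \<S>" using measurable_coeffs(2) by measurable
qed

lemma measurable_\<W> [simp]: "measurable \<W> N = measurable \<S> N"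
  unfolding weighted_surface_def by (rule measurable_cong_sets) simp_all

lemma AE_\<W>: "AE x in \<S>. Q x \<Longrightarrow> AE x in \<W>. Q x"
  unfolding weighted_surface_def using inverse_\<beta>(4) by (subst AE_density) (auto elim: AE_mp)

text \<open>The weight lies between the positive constants \<open>inverse C\<beta>\<close> and
  \<open>inverse \<eta>\<close> almost everywhere, so weighted and unweighted norms are
  equivalent.\<close>

lemma L2_\<W>: "L2 \<W> = L2 \<S>"
proof -
  have "integrable \<W> (\<lambda>x. (cmod (f x))\<^sup>2) \<longleftrightarrow> integrable \<S> (\<lambda>x. (cmod (f x))\<^sup>2)"
    if f: "f \<in> borel_measurable \<S>" for f :: "'a \<Rightarrow> complex"
  proof -
    have f2: "(\<lambda>x. (cmod (f x))\<^sup>2) \<in> borel_measurable \<S>" using f by measurable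
    have "integrable \<W> (\<lambda>x. (cmod (f x))\<^sup>2) \<longleftrightarrow> integrable \<S> (\<lambda>x. inverse (\<beta> x) *\<^sub>R (cmod (f x))\<^sup>2)"
      unfolding weighted_surface_def by (rule integrable_density[OF f2 inverse_\<beta>(4,1)])
    also have "\<dots> \<longleftrightarrow> integrable \<S> (\<lambda>x. (cmod (f x))\<^sup>2)"
    proof
      assume i: "integrable \<S> (\<lambda>x. inverse (\<beta> x) *\<^sub>R (cmod (f x))\<^sup>2)"
      show "integrable \<S> (\<lambda>x. (cmod (f x))\<^sup>2)"
      proof (rule Bochner_Integration.integrable_bound)
        show "integrable \<S> (\<lambda>x. C\<beta> * (inverse (\<beta> x) *\<^sub>R (cmod (f x))\<^sup>2))" using i by (rule integrable_mult_right)
        show "AE x in \<S>. norm ((cmod (f x))\<^sup>2) \<le> norm (C\<beta> * (inverse (\<beta> x) *\<^sub>R (cmod (f x))\<^sup>2))"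
          using inverse_\<beta>(3)
        proof eventually_elim
          case (elim x)
          then have "1 \<le> C\<beta> * inverse (\<beta> x)" using C\<beta>_pos by (simp add: field_simps)
          from mult_right_mono[OF this zero_le_power2[of "cmod (f x)"]]
          show ?case by simp
        qed
      qed (rule f2)
    next
      assume i: "integrable \<S> (\<lambda>x. (cmod (f x))\<^sup>2)"
      show "integrable \<S> (\<lambda>x. inverse (\<beta> x) *\<^sub>R (cmod (f x))\<^sup>2)"
      proof (rule Bochner_Integration.integrable_bound)
        show "integrable \<S> (\<lambda>x. inverse \<eta> * (cmod (f x))\<^sup>2)" using i by simp
        show "(\<lambda>x. inverse (\<beta> x) *\<^sub>R (cmod (f x))\<^sup>2) \<in> borel_measurable \<S>"
          using f2 inverse_\<beta>(4) by measurable
        show "AE x in \<S>. norm (inverse (\<beta> x) *\<^sub>R (cmod (f x))\<^sup>2) \<le> norm (inverse \<eta> * (cmod (f x))\<^sup>2)"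
          using inverse_\<beta>(2)
        proof eventually_elim
          case (elim x)
          from mult_right_mono[OF this zero_le_power2[of "cmod (f x)"]]
          show ?case using \<eta> by (simp add: abs_mult)
        qed
      qed
    qed
    finally show ?thesis .
  qed
  then show ?thesis unfolding L2_def by auto
qed

lemma L2_norm_\<W>_sq:
  assumes "f \<in> L2 \<S>"
  shows "(L2_norm \<W> f)\<^sup>2 = Re (L2_inner \<S> (\<lambda>x. of_real (inverse (\<beta> x)) * f x) f)"
proof -
  have f2: "(\<lambda>x. (cmod (f x))\<^sup>2) \<in> borel_measurable \<S>" using L2_measurable[OF assms] by measurable
  have "(L2_norm \<W> f)\<^sup>2 = (LINT x|\<S>. inverse (\<beta> x) *\<^sub>R (cmod (f x))\<^sup>2)"
    unfolding L2_norm_sq weighted_surface_def by (rule integral_density[OF f2 inverse_\<beta>(4,1)])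
  then show ?thesis by (simp only: Re_L2_inner_weight_eq real_scaleR_def)
qed

lemma L2_norm_\<W>_le:
  assumes f: "f \<in> L2 \<S>"
  shows "L2_norm \<W> f \<le> sqrt (inverse \<eta>) * L2_norm \<S> f"
proof (rule power2_le_imp_le)
  have "(L2_norm \<W> f)\<^sup>2 \<le> inverse \<eta> * (L2_norm \<S> f)\<^sup>2"
    unfolding L2_norm_\<W>_sq[OF f] by (rule Re_L2_inner_weight(1)[OF f inverse_\<beta>(4,2)])
  then show "(L2_norm \<W> f)\<^sup>2 \<le> (sqrt (inverse \<eta>) * L2_norm \<S> f)\<^sup>2"
    using \<eta> by (simp add: power_mult_distrib)
qed (use \<eta> in simp)

lemma L2_norm_\<S>_le:
  assumes f: "f \<in> L2 \<S>"
  shows "L2_norm \<S> f \<le> sqrt C\<beta> * L2_norm \<W> f"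
proof (rule power2_le_imp_le)
  have "inverse C\<beta> * (L2_norm \<S> f)\<^sup>2 \<le> (L2_norm \<W> f)\<^sup>2"
    unfolding L2_norm_\<W>_sq[OF f] by (rule Re_L2_inner_weight(2)[OF f inverse_\<beta>(4,2,3)])
  then show "(L2_norm \<S> f)\<^sup>2 \<le> (sqrt C\<beta> * L2_norm \<W> f)\<^sup>2"
    using C\<beta>_pos by (simp add: power_mult_distrib field_simps)
qed (use C\<beta>_pos in simp)

lemma L2_norm_\<W>_tendsto:
  assumes "\<And>n. g n \<in> L2 \<S>" "k \<in> L2 \<S>" "(\<lambda>n. L2_norm \<S> (\<lambda>x. g n x - k x)) \<longlonglongrightarrow> 0"
  shows "(\<lambda>n. L2_norm \<W> (\<lambda>x. g n x - k x)) \<longlonglongrightarrow> 0"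
proof (rule tendsto_zero_if_le)
  show "(\<lambda>n. sqrt (inverse \<eta>) * L2_norm \<S> (\<lambda>x. g n x - k x)) \<longlonglongrightarrow> 0"
    using tendsto_mult_left[OF assms(3)] by simp
qed (auto intro: L2_norm_\<W>_le L2_diff assms)

lemma Hsp_iff: "u \<in> \<H> \<longleftrightarrow> fst u \<in> L2 \<L> \<and> snd u \<in> L2 \<S>"
  by (simp add: Hsp_def L2_\<W> mem_Times_iff)

lemma Hsp_norm_sq: "(\<N> u)\<^sup>2 = (L2_norm \<L> (fst u))\<^sup>2 + (L2_norm \<W> (snd u))\<^sup>2"
  by (simp add: Hsp_norm_def Hsp_inner_def L2_inner_self L2_norm_sq)

lemma Hsp_norm_nonneg: "0 \<le> \<N> u"
  by (simp add: Hsp_norm_def Hsp_inner_def L2_inner_self)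

sublocale Hs: semi_inner \<H> add_scaled "\<I>"
proof
  fix u v w :: "'a state" and c
  show "0 \<le> Re (\<I> u u)" by (simp add: Hsp_inner_def L2_inner_self)
  show "\<I> u v = cnj (\<I> v u)"
    unfolding Hsp_inner_def using L2_inner_cnj[of \<L> "fst u" "fst v"] L2_inner_cnj[of \<W> "snd u" "snd v"] by simp
  assume u: "u \<in> \<H>" and v: "v \<in> \<H>"
  then show "add_scaled u c v \<in> \<H>" by (simp add: Hsp_iff L2_comb)
  assume w: "w \<in> \<H>"
  show "\<I> (add_scaled u c v) w = \<I> u w + c * \<I> v w"
    using u v w by (simp add: Hsp_inner_def Hsp_iff L2_inner_linear L2_\<W> distrib_left)
qed

lemmas Hsp_CS = Hs.cs[folded Hsp_norm_def]
lemmas Hsp_triangle = Hs.triangle[folded Hsp_norm_def]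

lemma form_dom_iff: "u \<in> \<D> \<longleftrightarrow> u \<in> \<H> \<and> fst u \<in> dom_neumann_laplacian \<Omega> \<and> has_trace \<Omega> (fst u) (snd u)"
  by (auto simp: form_dom_def)

lemma form_domD:
  assumes "u \<in> \<D>"
  shows "u \<in> \<H>" "fst u \<in> dom_neumann_laplacian \<Omega>" "has_trace \<Omega> (fst u) (snd u)"
    "fst u \<in> H1_Delta \<Omega>" "fst u \<in> H1 \<Omega>" "fst u \<in> L2 \<L>" "snd u \<in> L2 \<S>" "snd u \<in> L2 \<W>"
    "\<Delta> (fst u) \<in> L2 \<L>"
  using assms laplacian_L2[of "fst u"] L2_\<W>
  by (auto simp: form_dom_iff Hsp_iff dom_neumann_laplacian_def H1_Delta_def)

lemma form_dom_comb: "u \<in> \<D> \<Longrightarrow> v \<in> \<D> \<Longrightarrow> add_scaled u c v \<in> \<D>"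
  unfolding form_dom_iff add_scaled_simps
  by (intro conjI Hs.comb_in dom_neumann_comb has_trace_comb) (elim conjE; assumption)+

lemma form_dom_zero: "(\<lambda>x. 0, \<lambda>x. 0) \<in> \<D>"
  by (simp add: form_dom_iff Hsp_iff L2_zero dom_neumann_zero has_trace_zero)

lemma \<gamma>_L2: "f \<in> L2 \<W> \<Longrightarrow> (\<lambda>x. of_real (\<gamma> x) * f x) \<in> L2 \<W>"
  using AE_\<W>[OF \<gamma>_le] measurable_coeffs(3) by (intro L2_mult_bounded) auto

lemma \<alpha>_L2: "f \<in> L2 \<L> \<Longrightarrow> (\<lambda>x. of_real (\<alpha> x) * f x) \<in> L2 \<L>"
  using \<alpha>_le measurable_coeffs(1) by (intro L2_mult_bounded) auto

text \<open>\<open>\<Delta>\<close> of a combination is known only almost everywhere. The real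
  weight \<alpha> is moved to the other argument by hermitian symmetry, so that linearity of the
  pairing of \<open>\<Delta>\<close> with a fixed L2 function applies.\<close>

lemma form_linear:
  assumes u: "u \<in> \<D>" and v: "v \<in> \<D>" and w: "w \<in> \<D>"
  shows "\<aa> (add_scaled u c v) w = \<aa> u w + c * \<aa> v w"
proof -
  note U = form_domD[OF u] and V = form_domD[OF v] and W = form_domD[OF w]
  have "L2_inner \<L> (\<lambda>x. of_real (\<alpha> x) * \<Delta> (\<lambda>x. fst u x + c * fst v x) x) (\<Delta> (fst w)) =
      cnj (L2_inner \<L> (\<lambda>x. of_real (\<alpha> x) * \<Delta> (fst w) x) (\<Delta> (\<lambda>x. fst u x + c * fst v x)))"
    by (rule L2_inner_real_weight)
  also have "\<dots> = L2_inner \<L> (\<Delta> (\<lambda>x. fst u x + c * fst v x)) (\<lambda>x. of_real (\<alpha> x) * \<Delta> (fst w) x)"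
    by (rule L2_inner_cnj[symmetric])
  also have "\<dots> = L2_inner \<L> (\<Delta> (fst u)) (\<lambda>x. of_real (\<alpha> x) * \<Delta> (fst w) x) +
      c * L2_inner \<L> (\<Delta> (fst v)) (\<lambda>x. of_real (\<alpha> x) * \<Delta> (fst w) x)"
    by (rule L2_inner_laplacian_comb[OF U(4) V(4) \<alpha>_L2[OF W(9)]])
  also have "\<dots> = L2_inner \<L> (\<lambda>x. of_real (\<alpha> x) * \<Delta> (fst u) x) (\<Delta> (fst w)) +
      c * L2_inner \<L> (\<lambda>x. of_real (\<alpha> x) * \<Delta> (fst v) x) (\<Delta> (fst w))"
    using L2_inner_real_weight[of \<L> \<alpha> "\<Delta> (fst w)" "\<Delta> (fst u)"]
      L2_inner_real_weight[of \<L> \<alpha> "\<Delta> (fst w)" "\<Delta> (fst v)"]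
      L2_inner_cnj[of \<L> "\<Delta> (fst u)" "\<lambda>x. of_real (\<alpha> x) * \<Delta> (fst w) x"]
      L2_inner_cnj[of \<L> "\<Delta> (fst v)" "\<lambda>x. of_real (\<alpha> x) * \<Delta> (fst w) x"]
    by simp
  finally have 1: "L2_inner \<L> (\<lambda>x. of_real (\<alpha> x) * \<Delta> (\<lambda>x. fst u x + c * fst v x) x) (\<Delta> (fst w)) =
      L2_inner \<L> (\<lambda>x. of_real (\<alpha> x) * \<Delta> (fst u) x) (\<Delta> (fst w)) +
      c * L2_inner \<L> (\<lambda>x. of_real (\<alpha> x) * \<Delta> (fst v) x) (\<Delta> (fst w))" .
  have "(\<lambda>x. complex_of_real (\<gamma> x) * (snd u x + c * snd v x)) = (\<lambda>x. of_real (\<gamma> x) * snd u x + c * (of_real (\<gamma> x) * snd v x))"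
    by (auto simp: algebra_simps)
  then have "L2_inner \<W> (\<lambda>x. of_real (\<gamma> x) * (snd u x + c * snd v x)) (snd w) =
      L2_inner \<W> (\<lambda>x. of_real (\<gamma> x) * snd u x) (snd w) + c * L2_inner \<W> (\<lambda>x. of_real (\<gamma> x) * snd v x) (snd w)"
    by (simp only: L2_inner_linear[OF \<gamma>_L2[OF U(8)] \<gamma>_L2[OF V(8)] W(8)])
  then show ?thesis by (simp add: form_def 1 algebra_simps)
qed

lemma form_hermitian: "\<aa> u v = cnj (\<aa> v u)"
  unfolding form_def
  using L2_inner_real_weight[of \<L> \<alpha> "\<Delta> (fst u)" "\<Delta> (fst v)"]
    L2_inner_real_weight[of \<W> \<gamma> "snd u" "snd v"] by simp

text \<open>The ellipticity bound on \<alpha> controls \<Delta> u; the term with \<gamma> can be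
  negative and is compensated by the boundary norm.\<close>

lemma form_lower:
  assumes u: "u \<in> \<D>"
  shows "\<eta> * (L2_norm \<L> (\<Delta> (fst u)))\<^sup>2 \<le> Re (\<aa> u u) + \<bar>C\<gamma>\<bar> * (L2_norm \<W> (snd u))\<^sup>2"
proof -
  note U = form_domD[OF u]
  have 1: "\<eta> * (L2_norm \<L> (\<Delta> (fst u)))\<^sup>2 \<le> Re (L2_inner \<L> (\<lambda>x. of_real (\<alpha> x) * \<Delta> (fst u) x) (\<Delta> (fst u)))"
    by (rule Re_L2_inner_weight(2)[OF U(9) measurable_coeffs(1) \<alpha>_le \<alpha>_ge])
  have "AE x in \<W>. - \<bar>C\<gamma>\<bar> \<le> \<gamma> x" using AE_\<W>[OF \<gamma>_le] by eventually_elim linarith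
  then have "- \<bar>C\<gamma>\<bar> * (L2_norm \<W> (snd u))\<^sup>2 \<le> Re (L2_inner \<W> (\<lambda>x. of_real (\<gamma> x) * snd u x) (snd u))"
    using measurable_coeffs(3) by (intro Re_L2_inner_weight(2)[OF U(8) _ AE_\<W>[OF \<gamma>_le]]) simp_all
  with 1 show ?thesis by (simp add: form_def)
qed

lemma form_upper:
  assumes u: "u \<in> \<D>"
  shows "Re (\<aa> u u) \<le> C\<alpha> * (L2_norm \<L> (\<Delta> (fst u)))\<^sup>2 + C\<gamma> * (L2_norm \<W> (snd u))\<^sup>2"
proof -
  note U = form_domD[OF u]
  have "Re (L2_inner \<L> (\<lambda>x. of_real (\<alpha> x) * \<Delta> (fst u) x) (\<Delta> (fst u))) \<le> C\<alpha> * (L2_norm \<L> (\<Delta> (fst u)))\<^sup>2"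
    by (rule Re_L2_inner_weight(1)[OF U(9) measurable_coeffs(1) \<alpha>_le])
  moreover have "Re (L2_inner \<W> (\<lambda>x. of_real (\<gamma> x) * snd u x) (snd u)) \<le> C\<gamma> * (L2_norm \<W> (snd u))\<^sup>2"
    using measurable_coeffs(3) by (intro Re_L2_inner_weight(1)[OF U(8) _ AE_\<W>[OF \<gamma>_le]]) simp_all
  ultimately show ?thesis by (simp add: form_def)
qed

text \<open>The absolute value of \<open>C\<gamma>\<close> absorbs a negative boundary term; the
  extra 1 makes the shifted form dominate the squared norm of the Hilbert space.\<close>

definition shift :: real where "shift = \<bar>C\<gamma>\<bar> + 1"

definition shifted_form :: "'a state \<Rightarrow> 'a state \<Rightarrow> complex" where
  "shifted_form u v = \<aa> u v + of_real shift * \<I> u v"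

lemma Re_shifted_form:
  "Re (shifted_form u u) = Re (\<aa> u u) + shift * ((L2_norm \<L> (fst u))\<^sup>2 + (L2_norm \<W> (snd u))\<^sup>2)"
  by (simp add: shifted_form_def Hsp_inner_def L2_inner_self L2_norm_sq)

lemma shifted_form_ge:
  assumes u: "u \<in> \<D>"
  shows "\<eta> * (L2_norm \<L> (\<Delta> (fst u)))\<^sup>2 + (L2_norm \<L> (fst u))\<^sup>2 + (L2_norm \<W> (snd u))\<^sup>2 \<le> Re (shifted_form u u)"
proof -
  have "0 \<le> \<bar>C\<gamma>\<bar> * (L2_norm \<L> (fst u))\<^sup>2" by simp
  moreover have eq: "shift * (a + b) = \<bar>C\<gamma>\<bar> * a + \<bar>C\<gamma>\<bar> * b + a + b" for a b
    by (simp add: shift_def algebra_simps)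
  ultimately show ?thesis
    using form_lower[OF u] unfolding Re_shifted_form eq by linarith
qed

lemma Hsp_norm_le_shifted_form:
  assumes u: "u \<in> \<D>"
  shows "(\<N> u)\<^sup>2 \<le> Re (shifted_form u u)"
proof -
  have "0 \<le> \<eta> * (L2_norm \<L> (\<Delta> (fst u)))\<^sup>2" using \<eta> by simp
  then show ?thesis using shifted_form_ge[OF u] by (simp add: Hsp_norm_sq)
qed

sublocale F: semi_inner \<D> add_scaled shifted_form
proof
  fix u v w :: "'a state" and c
  show "shifted_form u v = cnj (shifted_form v u)" if "u \<in> \<D>" "v \<in> \<D>"
    using form_hermitian[of u v] Hs.herm[of u v] form_domD(1)[OF that(1)] form_domD(1)[OF that(2)]
    by (simp add: shifted_form_def)
  assume u: "u \<in> \<D>"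
  show "0 \<le> Re (shifted_form u u)"
    using Hsp_norm_le_shifted_form[OF u] zero_le_power2 order_trans by blast
  assume v: "v \<in> \<D>"
  show "add_scaled u c v \<in> \<D>" by (rule form_dom_comb[OF u v])
  assume w: "w \<in> \<D>"
  show "shifted_form (add_scaled u c v) w = shifted_form u w + c * shifted_form v w"
    using form_linear[OF u v w] Hs.lin[OF form_domD(1)[OF u] form_domD(1)[OF v] form_domD(1)[OF w]]
    by (simp add: shifted_form_def algebra_simps)
qed

text \<open>The form norm controls u, \<Delta> u and the boundary values separately, so each has a
  limit. Closedness of the Neumann domain and of the trace relation puts the limit into the form
  domain, and \<open>form_upper\<close> converts the three limits back into convergence in the form
  norm.\<close>

lemma shifted_form_complete:
  assumes s: "\<And>n. s n \<in> \<D>"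
    and cauchy: "\<And>e. e > 0 \<Longrightarrow> \<exists>N. \<forall>i\<ge>N. \<forall>j\<ge>N. F.nrm (add_scaled (s i) (-1) (s j)) < e"
  shows "\<exists>u\<in>\<D>. (\<lambda>n. F.nrm (add_scaled u (-1) (s n))) \<longlonglongrightarrow> 0"
proof -
  note S = form_domD[OF s]
  interpret S: finite_measure \<S> by (rule finite_surface_measure)
  have d: "add_scaled (s i) (-1) (s j) \<in> \<D>" for i j by (rule form_dom_comb[OF s s])
  have sq: "x \<le> k * sqrt y" if "x\<^sup>2 \<le> k\<^sup>2 * y" "0 \<le> y" "0 \<le> k" for x k y :: real
  proof (rule power2_le_imp_le)
    show "x\<^sup>2 \<le> (k * sqrt y)\<^sup>2" using that by (simp add: power_mult_distrib)
  qed (use that in simp)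
  have parts: "L2_norm \<L> (\<lambda>x. fst (s i) x - fst (s j) x) \<le> 1 * F.nrm (add_scaled (s i) (-1) (s j))"
      "L2_norm \<L> (\<lambda>x. \<Delta> (fst (s i)) x - \<Delta> (fst (s j)) x) \<le> sqrt (inverse \<eta>) * F.nrm (add_scaled (s i) (-1) (s j))"
      "L2_norm \<W> (\<lambda>x. snd (s i) x - snd (s j) x) \<le> 1 * F.nrm (add_scaled (s i) (-1) (s j))" for i j
  proof -
    let ?d = "add_scaled (s i) (-1) (s j)"
    have g: "\<eta> * (L2_norm \<L> (\<Delta> (\<lambda>x. fst (s i) x - fst (s j) x)))\<^sup>2 + (L2_norm \<L> (\<lambda>x. fst (s i) x - fst (s j) x))\<^sup>2 +
        (L2_norm \<W> (\<lambda>x. snd (s i) x - snd (s j) x))\<^sup>2 \<le> Re (shifted_form ?d ?d)"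
      using shifted_form_ge[OF d[of i j]] by simp
    have p: "0 \<le> Re (shifted_form ?d ?d)" by (rule F.pos[OF d])
    have n: "0 \<le> \<eta> * (L2_norm \<L> (\<Delta> (\<lambda>x. fst (s i) x - fst (s j) x)))\<^sup>2" using \<eta> by simp
    have n2: "0 \<le> (L2_norm \<L> (\<lambda>x. fst (s i) x - fst (s j) x))\<^sup>2" "0 \<le> (L2_norm \<W> (\<lambda>x. snd (s i) x - snd (s j) x))\<^sup>2"
      by simp_all
    have "(L2_norm \<L> (\<lambda>x. fst (s i) x - fst (s j) x))\<^sup>2 \<le> 1\<^sup>2 * Re (shifted_form ?d ?d)"
      "(L2_norm \<W> (\<lambda>x. snd (s i) x - snd (s j) x))\<^sup>2 \<le> 1\<^sup>2 * Re (shifted_form ?d ?d)"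
      unfolding one_power2 mult_1_left using g n n2 by linarith+
    then show "L2_norm \<L> (\<lambda>x. fst (s i) x - fst (s j) x) \<le> 1 * F.nrm ?d"
      "L2_norm \<W> (\<lambda>x. snd (s i) x - snd (s j) x) \<le> 1 * F.nrm ?d"
      using p by (intro sq; simp)+
    have "\<eta> * (L2_norm \<L> (\<Delta> (\<lambda>x. fst (s i) x - fst (s j) x)))\<^sup>2 \<le> Re (shifted_form ?d ?d)"
      using g n2 by linarith
    then have "(L2_norm \<L> (\<Delta> (\<lambda>x. fst (s i) x - fst (s j) x)))\<^sup>2 \<le> (sqrt (inverse \<eta>))\<^sup>2 * Re (shifted_form ?d ?d)"
      using \<eta> by (simp add: field_simps)
    then show "L2_norm \<L> (\<lambda>x. \<Delta> (fst (s i)) x - \<Delta> (fst (s j)) x) \<le> sqrt (inverse \<eta>) * F.nrm ?d"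
      unfolding laplacian_diff_norm[OF S(4) S(4), symmetric] by (rule sq) (use p \<eta> in auto)
  qed
  have \<eta>': "sqrt (inverse \<eta>) > 0" using \<eta> by simp
  obtain u1 where u1: "u1 \<in> L2 \<L>" "(\<lambda>n. L2_norm \<L> (\<lambda>x. fst (s n) x - u1 x)) \<longlonglongrightarrow> 0"
    by (rule L2_complete[OF S(6) cauchy_mono[OF cauchy parts(1) zero_less_one]])
  obtain w where w: "w \<in> L2 \<L>" "(\<lambda>n. L2_norm \<L> (\<lambda>x. \<Delta> (fst (s n)) x - w x)) \<longlonglongrightarrow> 0"
    by (rule L2_complete[OF S(9) cauchy_mono[OF cauchy parts(2) \<eta>']])
  \<comment> \<open>The form sees the weighted boundary norm, whereas traces are defined with the
    unweighted one.\<close>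
  have partS: "L2_norm \<S> (\<lambda>x. snd (s i) x - snd (s j) x) \<le> sqrt C\<beta> * F.nrm (add_scaled (s i) (-1) (s j))" for i j
  proof -
    have "L2_norm \<S> (\<lambda>x. snd (s i) x - snd (s j) x) \<le> sqrt C\<beta> * L2_norm \<W> (\<lambda>x. snd (s i) x - snd (s j) x)"
      by (rule L2_norm_\<S>_le[OF L2_diff[OF S(7) S(7)]])
    also have "\<dots> \<le> sqrt C\<beta> * F.nrm (add_scaled (s i) (-1) (s j))"
      using parts(3)[of i j] C\<beta>_pos by (intro mult_left_mono) auto
    finally show ?thesis .
  qed
  have C\<beta>': "sqrt C\<beta> > 0" using C\<beta>_pos by simp
  obtain u2 where u2: "u2 \<in> L2 \<S>" "(\<lambda>n. L2_norm \<S> (\<lambda>x. snd (s n) x - u2 x)) \<longlonglongrightarrow> 0"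
    by (rule S.L2_complete[OF S(7) cauchy_mono[OF cauchy partS C\<beta>']])
  note N = dom_neumann_closed[OF S(2) u1 w]
  have uH1: "u1 \<in> H1_Delta \<Omega>" "u1 \<in> H1 \<Omega>" using N(1) by (auto simp: dom_neumann_laplacian_def H1_Delta_def)
  have tr: "has_trace \<Omega> u1 u2" by (rule has_trace_closed[OF S(3) uH1(2) N(3) u2])
  define u where "u = (u1, u2)"
  have u: "u \<in> \<D>" using N(1) tr u1(1) u2(1) by (simp add: form_dom_iff Hsp_iff u_def)
  have lim: "(\<lambda>n. Re (shifted_form (add_scaled u (-1) (s n)) (add_scaled u (-1) (s n)))) \<longlonglongrightarrow> 0"
  proof (rule tendsto_zero_if_le)
    let ?a = "\<lambda>n. L2_norm \<L> (\<lambda>x. fst (s n) x - u1 x)"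
    let ?b = "\<lambda>n. L2_norm \<L> (\<lambda>x. \<Delta> (fst (s n)) x - w x)"
    let ?c = "\<lambda>n. L2_norm \<W> (\<lambda>x. snd (s n) x - u2 x)"
    have c: "?c \<longlonglongrightarrow> 0" by (rule L2_norm_\<W>_tendsto[OF S(7) u2])
    have "(\<lambda>n. C\<alpha> * (?b n)\<^sup>2 + C\<gamma> * (?c n)\<^sup>2 + shift * ((?a n)\<^sup>2 + (?c n)\<^sup>2)) \<longlonglongrightarrow> C\<alpha> * 0\<^sup>2 + C\<gamma> * 0\<^sup>2 + shift * (0\<^sup>2 + 0\<^sup>2)"
      by (intro tendsto_intros u1(2) w(2) c)
    then show "(\<lambda>n. C\<alpha> * (?b n)\<^sup>2 + C\<gamma> * (?c n)\<^sup>2 + shift * ((?a n)\<^sup>2 + (?c n)\<^sup>2)) \<longlonglongrightarrow> 0" by simp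
    fix n
    have dn: "add_scaled u (-1) (s n) \<in> \<D>" by (rule form_dom_comb[OF u s])
    have "L2_norm \<L> (\<Delta> (\<lambda>x. u1 x - fst (s n) x)) = L2_norm \<L> (\<lambda>x. \<Delta> u1 x - \<Delta> (fst (s n)) x)"
      by (rule laplacian_diff_norm[OF uH1(1) S(4)])
    also have "\<dots> = L2_norm \<L> (\<lambda>x. \<Delta> (fst (s n)) x - \<Delta> u1 x)" by (rule L2_norm_minus_commute)
    also have "\<dots> = ?b n"
    proof (rule L2_norm_cong_AE)
      \<comment> \<open>The limit w of the Laplacians agrees with the chosen
        \<open>\<Delta> u1\<close> only almost everywhere.\<close>
      show "AE x in \<L>. \<Delta> (fst (s n)) x - \<Delta> u1 x = \<Delta> (fst (s n)) x - w x"
        using laplacian_eq[OF N(2)] by eventually_elim simp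
    qed (auto intro: L2_measurable L2_diff S(9) laplacian_L2 uH1 w)
    finally have b: "L2_norm \<L> (\<Delta> (\<lambda>x. u1 x - fst (s n) x)) = ?b n" .
    have "L2_norm \<L> (\<lambda>x. u1 x - fst (s n) x) = ?a n" "L2_norm \<W> (\<lambda>x. u2 x - snd (s n) x) = ?c n"
      by (rule L2_norm_minus_commute)+
    then show "Re (shifted_form (add_scaled u (-1) (s n)) (add_scaled u (-1) (s n))) \<le>
      C\<alpha> * (?b n)\<^sup>2 + C\<gamma> * (?c n)\<^sup>2 + shift * ((?a n)\<^sup>2 + (?c n)\<^sup>2)"
      using form_upper[OF dn] b by (simp add: Re_shifted_form u_def)
    show "0 \<le> Re (shifted_form (add_scaled u (-1) (s n)) (add_scaled u (-1) (s n)))"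
      by (rule F.pos[OF dn])
  qed
  from tendsto_real_sqrt[OF this] show ?thesis using u by (intro bexI[of _ u]) simp_all
qed

section \<open>Resolvent set and compactness of the resolvents\<close>

lemma resolvent_rel_iff:
  "resolvent_rel \<A> \<mu> f u \<longleftrightarrow> u \<in> \<D> \<and> add_scaled f \<mu> u \<in> \<H> \<and>
    (\<forall>v\<in>\<D>. \<aa> u v = \<I> (add_scaled f \<mu> u) v)"
  by (simp add: resolvent_rel_def op_A_def)

text \<open>For this scalar the resolvent equation is the weak equation of
  \<open>shifted_form\<close>, solved by \<open>F.riesz\<close>. Testing with u itself bounds the
  squared norm of u by the inner product of f and u, so the inverse has bound 1.\<close>

lemma shift_in_resolvent_set: "- of_real shift \<in> resolvent_set \<H> (\<N>) \<A>"
  unfolding resolvent_set_def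
proof (intro CollectI conjI ballI exI impI)
  fix f assume f: "f \<in> \<H>"
  have "\<exists>u\<in>\<D>. \<forall>v\<in>\<D>. shifted_form u v = \<I> f v"
  proof (rule F.riesz[where K = "\<N> f"])
    show "\<D> \<noteq> {}" using form_dom_zero by blast
    show "\<I> f (add_scaled u c v) = \<I> f u + cnj c * \<I> f v" if "u \<in> \<D>" "v \<in> \<D>" for u v c
      by (rule Hs.lin2[OF form_domD(1)[OF that(1)] form_domD(1)[OF that(2)] f])
    show "cmod (\<I> f u) \<le> \<N> f * F.nrm u" if u: "u \<in> \<D>" for u
    proof -
      have "\<N> u \<le> F.nrm u"
        using real_sqrt_le_mono[OF Hsp_norm_le_shifted_form[OF u]] Hsp_norm_nonneg[of u] by simp
      then show ?thesis
        using Hsp_CS[OF f form_domD(1)[OF u]] mult_left_mono[OF _ Hsp_norm_nonneg[of f]] order_trans by blast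
    qed
  qed (rule shifted_form_complete)
  then obtain u where u: "u \<in> \<D>" "\<And>v. v \<in> \<D> \<Longrightarrow> shifted_form u v = \<I> f v" by blast
  have "\<aa> u v = \<I> (add_scaled f (- of_real shift) u) v" if v: "v \<in> \<D>" for v
    unfolding Hs.lin[OF f form_domD(1)[OF u(1)] form_domD(1)[OF v]] u(2)[OF v, symmetric]
    by (simp add: shifted_form_def)
  then have "resolvent_rel \<A> (- of_real shift) f u"
    using u(1) f form_domD(1)[OF u(1)] by (simp add: resolvent_rel_iff Hs.comb_in)
  then show "\<exists>u\<in>\<H>. resolvent_rel \<A> (- of_real shift) f u"
    using form_domD(1)[OF u(1)] by blast
next
  fix f u assume f: "f \<in> \<H>" and "u \<in> \<H>" and r: "resolvent_rel \<A> (- of_real shift) f u"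
  then have u: "u \<in> \<D>" and uu: "\<aa> u u = \<I> (add_scaled f (- of_real shift) u) u"
    by (auto simp: resolvent_rel_iff)
  note uH = form_domD(1)[OF u]
  have "shifted_form u u = \<I> f u"
    using uu Hs.lin[OF f uH uH, of "- of_real shift"] by (simp add: shifted_form_def)
  then have "(\<N> u)\<^sup>2 \<le> Re (\<I> f u)" using Hsp_norm_le_shifted_form[OF u] by simp
  also have "\<dots> \<le> \<N> f * \<N> u"
    using Hsp_CS[OF f uH] complex_Re_le_cmod order_trans by blast
  finally have *: "\<N> u * \<N> u \<le> \<N> f * \<N> u" by (simp add: power2_eq_square)
  show "\<N> u \<le> 1 * \<N> f"
  proof (cases "\<N> u = 0")
    case True then show ?thesis using Hsp_norm_nonneg[of f] by simp
  next
    case False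
    then have "\<N> u > 0" using Hsp_norm_nonneg[of u] by simp
    then show ?thesis using mult_right_le_imp_le[OF *] by simp
  qed
qed

text \<open>Differences have Laplacian at most 2 B, so \<open>H1_norm_sq_neumann_le\<close> turns
  smallness in L2 into smallness in H1.\<close>

lemma H1_cauchy:
  fixes s :: "nat \<Rightarrow> 'a \<Rightarrow> complex"
  assumes s: "\<And>n. s n \<in> dom_neumann_laplacian \<Omega>"
    and lap: "\<And>n. L2_norm \<L> (\<Delta> (s n)) \<le> B"
    and cauchy: "\<And>e. e > 0 \<Longrightarrow> \<exists>N. \<forall>i\<ge>N. \<forall>j\<ge>N. L2_norm \<L> (\<lambda>x. s i x - s j x) < e" and e: "e > 0"
  shows "\<exists>N. \<forall>i\<ge>N. \<forall>j\<ge>N. H1_norm \<Omega> (\<lambda>x. s i x - s j x) < e"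
proof -
  have B: "B \<ge> 0" using lap[of 0] L2_norm_nonneg order_trans by blast
  \<comment> \<open>With \<delta> at most 1 the square of the L2 norm is below the norm itself, and
    the squared H1 norm is at most 1 + 2 B times it.\<close>
  define \<delta> where "\<delta> = min 1 (e\<^sup>2 / (1 + 2 * B))"
  have \<delta>: "0 < \<delta>" "\<delta> \<le> 1" "\<delta> * (1 + 2 * B) \<le> e\<^sup>2"
  proof -
    show "0 < \<delta>" "\<delta> \<le> 1" using e B by (auto simp: \<delta>_def)
    have "\<delta> \<le> e\<^sup>2 / (1 + 2 * B)" by (simp add: \<delta>_def)
    then show "\<delta> * (1 + 2 * B) \<le> e\<^sup>2" using B by (simp add: pos_le_divide_eq)
  qed
  obtain N where N: "\<forall>i\<ge>N. \<forall>j\<ge>N. L2_norm \<L> (\<lambda>x. s i x - s j x) < \<delta>" using cauchy[OF \<delta>(1)] by blast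
  have sD: "s n \<in> H1_Delta \<Omega>" for n using s[of n] by (simp add: dom_neumann_laplacian_def)
  have "H1_norm \<Omega> (\<lambda>x. s i x - s j x) < e" if ij: "i \<ge> N" "j \<ge> N" for i j
  proof -
    let ?d = "\<lambda>x. s i x - s j x"
    have d: "?d \<in> dom_neumann_laplacian \<Omega>" using dom_neumann_comb[OF s[of i] s[of j], of "-1"] by simp
    have a: "L2_norm \<L> ?d < \<delta>" using N ij by blast
    have "L2_norm \<L> (\<Delta> ?d) \<le> 2 * B"
      using L2_triangle_diff[OF laplacian_L2[OF sD[of i]] laplacian_L2[OF sD[of j]]] lap[of i] lap[of j]
      by (simp add: laplacian_diff_norm[OF sD sD])
    then have "L2_norm \<L> (\<Delta> ?d) * L2_norm \<L> ?d \<le> 2 * B * L2_norm \<L> ?d"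
      by (intro mult_right_mono) auto
    moreover have "(L2_norm \<L> ?d)\<^sup>2 \<le> 1 * L2_norm \<L> ?d"
      unfolding power2_eq_square using a \<delta>(2) by (intro mult_right_mono) auto
    ultimately have "(H1_norm \<Omega> ?d)\<^sup>2 \<le> L2_norm \<L> ?d * (1 + 2 * B)"
      using H1_norm_sq_neumann_le[OF d] by (simp add: algebra_simps)
    also have "\<dots> < \<delta> * (1 + 2 * B)" using a B by (intro mult_strict_right_mono) auto
    also have "\<dots> \<le> e\<^sup>2" by (rule \<delta>(3))
    finally have "(H1_norm \<Omega> ?d)\<^sup>2 < e\<^sup>2" .
    then show ?thesis by (rule power_less_imp_less_base) (use e in simp)
  qed
  then show ?thesis by blast
qed

text \<open>The Cauchy property of a subsequence is passed along a chain: L2 for the smooth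
  approximants by Rellich, L2 and then H1 for the solutions, H1 and then boundary L2 for the
  approximants, finally boundary L2 for the solutions.\<close>

lemma compact_resolvent:
  assumes \<mu>: "\<mu> \<in> resolvent_set \<H> (\<N>) \<A>"
  shows "compact_rel \<H> (\<N>) (resolvent_rel \<A> \<mu>)"
  unfolding compact_rel_def
proof (intro allI impI, elim conjE)
  fix f u :: "nat \<Rightarrow> 'a state"
  let ?N = "\<N>"
  assume fu: "\<forall>n. f n \<in> \<H> \<and> u n \<in> \<H> \<and> resolvent_rel \<A> \<mu> (f n) (u n)"
    and bd: "bounded (range (\<lambda>n. ?N (f n)))"
  interpret S: finite_measure \<S> by (rule finite_surface_measure)
  obtain b where "\<forall>x\<in>range (\<lambda>n. ?N (f n)). norm x \<le> b" using bd unfolding bounded_iff by (elim exE)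
  then have b: "?N (f n) \<le> b" for n by (auto intro: order_trans[OF abs_ge_self])
  obtain C where C: "\<And>f u. f \<in> \<H> \<Longrightarrow> u \<in> \<H> \<Longrightarrow> resolvent_rel \<A> \<mu> f u \<Longrightarrow> ?N u \<le> C * ?N f"
    using \<mu> unfolding resolvent_set_def by blast
  have f: "f n \<in> \<H>" and u: "u n \<in> \<D>" and eq: "\<aa> (u n) (u n) = \<I> (add_scaled (f n) \<mu> (u n)) (u n)" for n
    using fu by (auto simp: resolvent_rel_iff)
  note U = form_domD[OF u]
  have b0: "0 \<le> b" using b[of 0] Hsp_norm_nonneg[of "f 0"] by linarith
  \<comment> \<open>The constant from the resolvent set may be negative, hence the absolute
    value.\<close>
  define c where "c = \<bar>C\<bar> * b"
  have c: "?N (u n) \<le> c" for n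
  proof -
    have "?N (u n) \<le> C * ?N (f n)" using C fu by blast
    also have "\<dots> \<le> \<bar>C\<bar> * ?N (f n)" using Hsp_norm_nonneg by (intro mult_right_mono) auto
    also have "\<dots> \<le> c" unfolding c_def using b by (intro mult_left_mono) auto
    finally show ?thesis .
  qed
  have c0: "0 \<le> c" using c[of 0] Hsp_norm_nonneg[of "u 0"] by linarith
  \<comment> \<open>\<open>form_lower\<close> solved for \<Delta> u: the form is at most the norm of
    f + \<mu> u times that of u, and the boundary term contributes at most |C\<gamma>| c^2.\<close>
  define B where "B = sqrt (((b + cmod \<mu> * c) * c + \<bar>C\<gamma>\<bar> * c\<^sup>2) / \<eta>)"
  have lap: "L2_norm \<L> (\<Delta> (fst (u n))) \<le> B" for n
  proof -
    have "?N (add_scaled (f n) \<mu> (u n)) \<le> ?N (f n) + cmod \<mu> * ?N (u n)" by (rule Hsp_triangle[OF f U(1)])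
    also have "\<dots> \<le> b + cmod \<mu> * c" using b c by (intro add_mono mult_left_mono) auto
    finally have 1: "?N (add_scaled (f n) \<mu> (u n)) \<le> b + cmod \<mu> * c" .
    have "Re (\<aa> (u n) (u n)) \<le> cmod (\<I> (add_scaled (f n) \<mu> (u n)) (u n))"
      unfolding eq by (rule complex_Re_le_cmod)
    also have "\<dots> \<le> ?N (add_scaled (f n) \<mu> (u n)) * ?N (u n)" by (rule Hsp_CS[OF Hs.comb_in[OF f U(1)] U(1)])
    also have "\<dots> \<le> (b + cmod \<mu> * c) * c"
      using 1 c Hsp_norm_nonneg b0 c0 by (intro mult_mono) auto
    finally have 2: "Re (\<aa> (u n) (u n)) \<le> (b + cmod \<mu> * c) * c" .
    have "(L2_norm \<W> (snd (u n)))\<^sup>2 \<le> (?N (u n))\<^sup>2" by (simp add: Hsp_norm_sq)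
    also have "\<dots> \<le> c\<^sup>2" using c Hsp_norm_nonneg by (intro power_mono)
    finally have "\<bar>C\<gamma>\<bar> * (L2_norm \<W> (snd (u n)))\<^sup>2 \<le> \<bar>C\<gamma>\<bar> * c\<^sup>2" by (intro mult_left_mono) auto
    then have "\<eta> * (L2_norm \<L> (\<Delta> (fst (u n))))\<^sup>2 \<le> (b + cmod \<mu> * c) * c + \<bar>C\<gamma>\<bar> * c\<^sup>2"
      using form_lower[OF u[of n]] 2 by linarith
    then have "(L2_norm \<L> (\<Delta> (fst (u n))))\<^sup>2 \<le> ((b + cmod \<mu> * c) * c + \<bar>C\<gamma>\<bar> * c\<^sup>2) / \<eta>"
      using \<eta> by (simp add: pos_le_divide_eq mult.commute)
    from real_sqrt_le_mono[OF this] show ?thesis by (simp add: B_def)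
  qed
  have B0: "0 \<le> B" using lap[of 0] L2_norm_nonneg order_trans by blast
  have a: "L2_norm \<L> (fst (u n)) \<le> c" for n
  proof (rule power2_le_imp_le[OF _ c0])
    have "(L2_norm \<L> (fst (u n)))\<^sup>2 \<le> (?N (u n))\<^sup>2" by (simp add: Hsp_norm_sq)
    also have "\<dots> \<le> c\<^sup>2" using c Hsp_norm_nonneg by (intro power_mono)
    finally show "(L2_norm \<L> (fst (u n)))\<^sup>2 \<le> c\<^sup>2" .
  qed
  have h1: "H1_norm \<Omega> (fst (u n)) \<le> sqrt (c\<^sup>2 + B * c)" for n
  proof -
    have "(H1_norm \<Omega> (fst (u n)))\<^sup>2 \<le> (L2_norm \<L> (fst (u n)))\<^sup>2 + L2_norm \<L> (\<Delta> (fst (u n))) * L2_norm \<L> (fst (u n))"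
      by (rule H1_norm_sq_neumann_le[OF U(2)])
    also have "\<dots> \<le> c\<^sup>2 + B * c" using a lap B0 by (intro add_mono power_mono mult_mono) auto
    finally have "sqrt ((H1_norm \<Omega> (fst (u n)))\<^sup>2) \<le> sqrt (c\<^sup>2 + B * c)" by (rule real_sqrt_le_mono)
    then show ?thesis using H1_norm_nonneg[OF U(5)[of n]] by simp
  qed
  obtain \<phi> where \<phi>': "\<forall>n. smooth (\<phi> n) \<and> H1_norm \<Omega> (\<lambda>x. \<phi> n x - fst (u n) x) < 1 / real (Suc n) \<and>
    L2_norm \<S> (\<lambda>x. \<phi> n x - snd (u n) x) < 1 / real (Suc n)"
    using has_trace_approx_seq[of "\<lambda>n. fst (u n)" "\<lambda>n. snd (u n)", OF U(3)] by (elim exE)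
  then have \<phi>: "smooth (\<phi> n)" "H1_norm \<Omega> (\<lambda>x. \<phi> n x - fst (u n) x) < 1 / real (Suc n)"
    "L2_norm \<S> (\<lambda>x. \<phi> n x - snd (u n) x) < 1 / real (Suc n)" for n by simp_all
  note \<phi>1 = smooth_H1[OF \<phi>(1)] and \<phi>S = smooth_L2_surface[OF \<phi>(1)]
  have "H1_norm \<Omega> (\<phi> n) \<le> 1 + sqrt (c\<^sup>2 + B * c)" for n
  proof -
    have "H1_norm \<Omega> (\<phi> n) \<le> H1_norm \<Omega> (\<lambda>x. \<phi> n x - fst (u n) x) + H1_norm \<Omega> (fst (u n))"
      using H1_triangle[OF H1_diff[OF \<phi>1[of n] U(5)[of n]] U(5)[of n], of 1] by simp
    moreover have "1 / real (Suc n) \<le> 1" by simp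
    ultimately show ?thesis using \<phi>(2)[of n] h1[of n] by linarith
  qed
  then obtain r where r: "strict_mono (r :: nat \<Rightarrow> nat)"
    and rc: "\<And>e. e > 0 \<Longrightarrow> \<exists>N. \<forall>i\<ge>N. \<forall>j\<ge>N. L2_norm \<L> (\<lambda>x. \<phi> (r i) x - \<phi> (r j) x) < e"
    by (rule rellich[OF \<phi>(1)]) (rule that)
  have tail: "\<exists>N. \<forall>i\<ge>N. 1 / real (Suc (r i)) < e" if e: "e > 0" for e
  proof -
    obtain N where N: "1 / real (Suc N) < e" by (rule nat_approx_posE[OF e])
    have "1 / real (Suc (r i)) < e" if "i \<ge> N" for i
    proof -
      have "N \<le> r i" using seq_suble[OF r, of i] that by linarith
      then have "1 / real (Suc (r i)) \<le> 1 / real (Suc N)" by (intro divide_left_mono) auto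
      then show ?thesis using N by linarith
    qed
    then show ?thesis by blast
  qed
  \<comment> \<open>Replacing solutions by approximants, or conversely, costs 1 / (r i + 1) + 1 / (r
    j + 1) in each of the norms involved.\<close>
  have transfer: "\<exists>N. \<forall>i\<ge>N. \<forall>j\<ge>N. y i j < e"
    if x: "\<And>e. e > 0 \<Longrightarrow> \<exists>N. \<forall>i\<ge>N. \<forall>j\<ge>N. x i j < e"
      and xy: "\<And>i j. y i j \<le> x i j + 1 / real (Suc (r i)) + 1 / real (Suc (r j))" and e: "e > 0"
    for x y :: "nat \<Rightarrow> nat \<Rightarrow> real" and e
  proof -
    obtain N1 N2 where "\<forall>i\<ge>N1. \<forall>j\<ge>N1. x i j < e / 3" "\<forall>i\<ge>N2. 1 / real (Suc (r i)) < e / 3"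
      using x[of "e / 3"] tail[of "e / 3"] e by auto
    then have N: "x i j < e / 3" "1 / real (Suc (r i)) < e / 3" "1 / real (Suc (r j)) < e / 3"
      if "i \<ge> max N1 N2" "j \<ge> max N1 N2" for i j using that by auto
    have "y i j < e" if "i \<ge> max N1 N2" "j \<ge> max N1 N2" for i j
      using xy[of i j] N[OF that] by linarith
    then show ?thesis by blast
  qed
  have H\<phi>: "H1_norm \<Omega> (\<lambda>x. \<phi> n x - fst (u n) x) \<le> 1 / real (Suc n)" "H1_norm \<Omega> (\<lambda>x. fst (u n) x - \<phi> n x) \<le> 1 / real (Suc n)" for n
    using \<phi>(2)[of n] H1_norm_minus_commute[OF \<phi>1[of n] U(5)[of n]] by simp_all
  have L\<phi>: "L2_norm \<L> (\<lambda>x. \<phi> n x - fst (u n) x) \<le> 1 / real (Suc n)" "L2_norm \<L> (\<lambda>x. fst (u n) x - \<phi> n x) \<le> 1 / real (Suc n)" for n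
    using H\<phi>[of n] L2_norm_le_H1_norm[OF H1_diff[OF \<phi>1[of n] U(5)[of n]]] L2_norm_le_H1_norm[OF H1_diff[OF U(5)[of n] \<phi>1[of n]]] by simp_all
  have S\<phi>: "L2_norm \<S> (\<lambda>x. \<phi> n x - snd (u n) x) \<le> 1 / real (Suc n)" "L2_norm \<S> (\<lambda>x. snd (u n) x - \<phi> n x) \<le> 1 / real (Suc n)" for n
    using \<phi>(3)[of n] L2_norm_minus_commute[of \<S> "\<phi> n" "snd (u n)"] by simp_all
  have uc: "\<exists>N. \<forall>i\<ge>N. \<forall>j\<ge>N. L2_norm \<L> (\<lambda>x. fst (u (r i)) x - fst (u (r j)) x) < e" if "e > 0" for e
  proof (rule transfer[OF rc _ that])
    fix i j
    show "L2_norm \<L> (\<lambda>x. fst (u (r i)) x - fst (u (r j)) x) \<le>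
        L2_norm \<L> (\<lambda>x. \<phi> (r i) x - \<phi> (r j) x) + 1 / real (Suc (r i)) + 1 / real (Suc (r j))"
      using L2_triangle3[OF U(6)[of "r i"] H1_L2[OF \<phi>1[of "r i"]] U(6)[of "r j"]]
        L2_triangle3[OF H1_L2[OF \<phi>1[of "r i"]] H1_L2[OF \<phi>1[of "r j"]] U(6)[of "r j"]]
        L\<phi>(2)[of "r i"] L\<phi>(1)[of "r j"] by linarith
  qed
  have hc: "\<exists>N. \<forall>i\<ge>N. \<forall>j\<ge>N. H1_norm \<Omega> (\<lambda>x. fst (u (r i)) x - fst (u (r j)) x) < e" if "e > 0" for e
    by (rule H1_cauchy[OF U(2) lap uc that])
  have \<phi>c: "\<exists>N. \<forall>i\<ge>N. \<forall>j\<ge>N. H1_norm \<Omega> (\<lambda>x. \<phi> (r i) x - \<phi> (r j) x) < e" if "e > 0" for e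
  proof (rule transfer[OF hc _ that])
    fix i j
    show "H1_norm \<Omega> (\<lambda>x. \<phi> (r i) x - \<phi> (r j) x) \<le>
        H1_norm \<Omega> (\<lambda>x. fst (u (r i)) x - fst (u (r j)) x) + 1 / real (Suc (r i)) + 1 / real (Suc (r j))"
      using H1_triangle3[OF \<phi>1[of "r i"] U(5)[of "r i"] \<phi>1[of "r j"]]
        H1_triangle3[OF U(5)[of "r i"] U(5)[of "r j"] \<phi>1[of "r j"]]
        H\<phi>(1)[of "r i"] H\<phi>(2)[of "r j"] by linarith
  qed
  obtain K where K: "K \<ge> 0" "\<And>\<phi>. smooth \<phi> \<Longrightarrow> L2_norm \<S> \<phi> \<le> K * H1_norm \<Omega> \<phi>"
    by (rule trace_inequality) (rule that)
  have \<phi>Sc: "\<exists>N. \<forall>i\<ge>N. \<forall>j\<ge>N. L2_norm \<S> (\<lambda>x. \<phi> (r i) x - \<phi> (r j) x) < e" if "e > 0" for e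
  proof (rule cauchy_mono[OF \<phi>c _ _ that])
    \<comment> \<open>\<open>cauchy_mono\<close> asks for a positive factor, while the trace
      constant may be 0.\<close>
    show "K + 1 > 0" using K(1) by simp
    show "L2_norm \<S> (\<lambda>x. \<phi> (r i) x - \<phi> (r j) x) \<le> (K + 1) * H1_norm \<Omega> (\<lambda>x. \<phi> (r i) x - \<phi> (r j) x)" for i j
      using K(2)[OF smooth_diff[OF \<phi>(1)[of "r i"] \<phi>(1)[of "r j"]]] H1_norm_nonneg[OF H1_diff[OF \<phi>1[of "r i"] \<phi>1[of "r j"]]]
      by (simp add: distrib_right)
  qed
  have sc: "\<exists>N. \<forall>i\<ge>N. \<forall>j\<ge>N. L2_norm \<S> (\<lambda>x. snd (u (r i)) x - snd (u (r j)) x) < e" if "e > 0" for e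
  proof (rule transfer[OF \<phi>Sc _ that])
    fix i j
    show "L2_norm \<S> (\<lambda>x. snd (u (r i)) x - snd (u (r j)) x) \<le>
        L2_norm \<S> (\<lambda>x. \<phi> (r i) x - \<phi> (r j) x) + 1 / real (Suc (r i)) + 1 / real (Suc (r j))"
      using L2_triangle3[OF U(7)[of "r i"] \<phi>S[of "r i"] U(7)[of "r j"]]
        L2_triangle3[OF \<phi>S[of "r i"] \<phi>S[of "r j"] U(7)[of "r j"]]
        S\<phi>(2)[of "r i"] S\<phi>(1)[of "r j"] by linarith
  qed
  obtain w1 where w1: "w1 \<in> L2 \<L>" "(\<lambda>n. L2_norm \<L> (\<lambda>x. fst (u (r n)) x - w1 x)) \<longlonglongrightarrow> 0"
    by (rule L2_complete[OF U(6) uc])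
  obtain w2 where w2: "w2 \<in> L2 \<S>" "(\<lambda>n. L2_norm \<S> (\<lambda>x. snd (u (r n)) x - w2 x)) \<longlonglongrightarrow> 0"
    by (rule S.L2_complete[OF U(7) sc])
  have w2': "(\<lambda>n. L2_norm \<W> (\<lambda>x. snd (u (r n)) x - w2 x)) \<longlonglongrightarrow> 0"
    by (rule L2_norm_\<W>_tendsto[OF U(7) w2])
  have "(\<lambda>n. (L2_norm \<L> (\<lambda>x. fst (u (r n)) x - w1 x))\<^sup>2 + (L2_norm \<W> (\<lambda>x. snd (u (r n)) x - w2 x))\<^sup>2) \<longlonglongrightarrow> 0\<^sup>2 + 0\<^sup>2"
    by (intro tendsto_intros w1(2) w2')
  then have "(\<lambda>n. (?N (add_scaled (u (r n)) (-1) (w1, w2)))\<^sup>2) \<longlonglongrightarrow> 0"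
    by (simp add: Hsp_norm_sq)
  from tendsto_real_sqrt[OF this] have "(\<lambda>n. ?N (add_scaled (u (r n)) (-1) (w1, w2))) \<longlonglongrightarrow> 0"
    using Hsp_norm_nonneg by simp
  moreover have "(w1, w2) \<in> \<H>" using w1 w2 by (simp add: Hsp_iff)
  ultimately show "\<exists>r w. strict_mono (r :: nat \<Rightarrow> nat) \<and> w \<in> \<H> \<and> (\<lambda>n. ?N (add_scaled (u (r n)) (-1) w)) \<longlonglongrightarrow> 0"
    using r by (intro exI[of _ r] exI[of _ "(w1, w2)"]) simp
qed

end

theorem lemma6p1:
  fixes \<Omega> :: "'a::euclidean_space set" and \<alpha> \<beta> \<gamma> :: "'a \<Rightarrow> real" and \<eta> :: real
  assumes "bounded_lipschitz_domain \<Omega>"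
    and "\<alpha> \<in> Linfty (lebesgue_on \<Omega>)"
    and "\<beta> \<in> Linfty (surface_measure \<Omega>)"
    and "\<gamma> \<in> Linfty (surface_measure \<Omega>)"
    and "\<eta> > 0"
    and "AE x in lebesgue_on \<Omega>. \<alpha> x \<ge> \<eta>"
    and "AE x in surface_measure \<Omega>. \<beta> x \<ge> \<eta>"
  shows "has_compact_resolvent (Hsp \<Omega> \<beta>) (Hsp_norm \<Omega> \<beta>) (op_A \<Omega> \<alpha> \<beta> \<gamma>)"
proof -
  interpret bulk_surface \<Omega> \<alpha> \<beta> \<gamma> \<eta>
    using assms by unfold_locales
  show ?thesis
    unfolding has_compact_resolvent_def using shift_in_resolvent_set compact_resolvent by blast
qed

end
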